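(* There exist a countable set $S$ and a finite list of formulas $\Phi$ such that the following holds. Let $(K,\tau)$ be a compact space, $(\Gamma,\le)$ be an up-directed set and $r:\Gamma\to\mathcal{C}(K,K)$, $s\mapsto r_s=r(s)$, be a mapping such that $\mathfrak{s}=\{r(s):s\in\Gamma\}$ is a retractional skeleton on $K$. Let $\kappa:=w(K)$ and let $\mathcal{U}:\kappa\to\tau$ be such that $\{\mathcal{U}(i):i<\kappa\}$ is an open basis of $\tau$. Put $S':=S\cup\{K,D(\mathfrak{s}),\Gamma,\le,r,\tau,\mathcal{U}\}$. Let $(M_\alpha)_{\alpha\le\kappa}$ be a sequence of sets satisfying (Ra) $M_\alpha\prec(\Phi;S')$ for every $\alpha\in[0,\kappa]$; (Rb) $|M_\alpha|\le\max(\omega,|\alpha|)$ for every $\alpha\in[0,\kappa]$; (Rc) $M_{\alpha+1}\supset M_\alpha\cup\{\alpha\}$ for every $\alpha\in[0,\kappa)$; (Rd) $M_\alpha=\bigcup_{\beta<\alpha}M_\beta$ if $\alpha\in(0,\kappa]$ is a limit ordinal. Then for every $\alpha\in[0,\kappa]$ there exists a canonical retraction $r_\alpha$ associated to $M_\alpha$, $K$ and $D(\mathfrak{s})$, and the following holds. (R1) For every $\alpha<\beta$, $r_\alpha\circ r_\beta=r_\beta\circ r_\alpha=r_\alpha$. (R2) The net $(r_\alpha(x))_{\alpha<\kappa}$ converges to $x$, for every $x\in K$. (R3) Let $\alpha\le\kappa$, let $\eta:[0,\alpha)\to\kappa$ be an increasing function and let $\xi\le\kappa$ be a limit ordinal with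 $\sup_{\beta<\alpha}\eta(\beta)=\xi$. Then $\lim_{\beta<\alpha}r_{\eta(\beta)}(x)=r_\xi(x)$ for every $x\in K$. (R4) $r_\kappa=\mathrm{id}$. (R5) For every $\alpha\in[0,\kappa]$, $w(r_\alpha[K])\le\max(\omega,|\alpha|)$ and $(r_s|_{r_\alpha[K]})_{s\in(\Gamma\cap M_\alpha)_\sigma}$ is a retractional skeleton on $r_\alpha[K]$ with induced set $D(\mathfrak{s})\cap r_\alpha[K]$. (R6) If $\mathcal{A}$ is a closed subset of $\mathcal{C}(K)$ and $f\circ r_s\in\mathcal{A}$ for every $f\in\mathcal{A}$ and $s\in\Gamma$, then $\{f\circ r_\alpha: f\in\mathcal{A},\alpha\le\kappa\}\subset\mathcal{A}$. (R7) If $x,y$ are distinct points of $K$, then $\beta:=\min\{\alpha<\kappa: r_\alpha(x)\ne r_\alpha(y)\}$ exists and it is a successor ordinal or $\beta=0$. (R8) For every $\alpha\le\kappa$, the set $\Gamma\cap M_\alpha$ is up-directed and $r_\alpha(x)=\lim_{s\in M_\alpha\cap\Gamma}r_s(x)$ for every $x\in K$. (R9) For every $\alpha\le\kappa$ and $t\in(\Gamma\cap M_\alpha)_\sigma$, $r_t\circ r_\alpha=r_\alpha\circ r_t$. (R10) Let $\mathcal{A}\subset\mathcal{C}(K)$ be a set that separates the points of $K$ and let $\alpha<\kappa$. If $\mathcal{A}\in M_\alpha$, then $\mathcal{A}\cap M_\alpha$ separates the points of $r_\alpha[K]$ and $f\circ r_\alpha=f$ for every $f\in\mathcal{A}\cap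 M_\alpha$. Moreover, if $\mathfrak{s}$ is full or commutative, then $r_\alpha[D(\mathfrak{s})]\subset D(\mathfrak{s})$ for every $\alpha\in[0,\kappa]$; and if $D\subset D(\mathfrak{s})$ is such that $r_\alpha[D]\subset D$ for every $\alpha\in[0,\kappa]$, then we also have: (R11) The sets $\{r_\alpha(x):\alpha<\kappa\}$ and $\{\alpha<\kappa: r_\alpha(x)\ne r_{\alpha+1}(x)\}$ are countable for every $x\in D$.
   Context: For a set $N$ and a formula $\phi$ of the language of set theory, the relativization $\phi^N$ is obtained by replacing each quantifier $\exists x$ by $\exists x\in N$ (and $\forall x$ by $\forall x\in N$). A formula $\phi(x_1,\dots,x_n)$ (all free variables shown) is absolute for $N$ if for all $a_1,\dots,a_n\in N$: $\phi^N(a_1,\dots,a_n)\leftrightarrow\phi(a_1,\dots,a_n)$. For a finite list of formulas $\Phi$ and a set $X$, $M\prec(\Phi;X)$ means that $M\supset X$ is a set such that every formula in $\Phi$ is absolute for $M$. All topological spaces are Tychonoff; retractions are continuous; $w$ denotes weight; $\mathcal{C}(K)$ is the Banach space of real-valued continuous functions on $K$ with the supremum norm; $\mathcal{C}(K,K)$ is the set of continuous maps $K\to K$. Up-directed means nonempty and any two elements have an upper bound. An up-directed partially ordered set $\Gamma$ is $\sigma$-complete if every increasing sequence $(s_n)_{n\in\omega}$ ($s_n\le s_{n+1}$) has a supremum in $\Gamma$; for $A\subset\Gamma$, $A_\sigma$ denotes the smallest subset of $\Gamma$ containing $A$ and closed under suprema of increasing sequences. A retractional skeleton on a compact space $K$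 is a family $\mathfrak{s}=(r_s)_{s\in\Gamma}$ of continuous retractions on $K$ indexed by an up-directed $\sigma$-complete partially ordered set $\Gamma$ such that: (1) $r_s[K]$ is metrizable compact for each $s$; (2) if $s\le t$ then $r_s=r_t\circ r_s=r_s\circ r_t$; (3) if $(s_n)$ is increasing with $s=\sup_n s_n$, then $r_s(x)=\lim_n r_{s_n}(x)$ for every $x\in K$; (4) $x=\lim_{s\in\Gamma}r_s(x)$ for every $x\in K$. The set induced by $\mathfrak{s}$ is $D(\mathfrak{s})=\bigcup_{s\in\Gamma}r_s[K]$. $\mathfrak{s}$ is full if $D(\mathfrak{s})=K$, and commutative if $r_s\circ r_t=r_t\circ r_s$ for all $s,t\in\Gamma$. Given a compact space $K$, a dense $D\subset K$ contained in the set induced by a retractional skeleton, and a set $M$, the canonical retraction associated to $M$, $K$ and $D$ is (if it exists) the unique retraction $r_M$ on $K$ satisfying $r_M[K]=\overline{D\cap M}$ and $f=f\circ r_M$ for every $f\in\mathcal{C}(K)\cap M$. *)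

theory Defs
  imports "HOL-Analysis.Analysis" "HOL-Library.Equipollence"
begin

section \<open>The universe of sets\<close>

text \<open>
  A type of this class plays the role of the set-theoretic universe \<open>V\<close>: \<open>elts x\<close> is the collection
  of the members of the set \<open>x\<close>. The axioms are those of ZFC, with separation and replacement for
  arbitrary HOL predicates and functions (the axiom of choice then follows from choice in HOL).
  Consequently every HOL subset of \<open>elts x\<close> is again (the extension of) a set, and notions such as
  compactness or countability of a set in the universe coincide with the HOL notions for its extension.
\<close>

class set_universe =
  fixes elts :: "'a \<Rightarrow> 'a set"
  assumes extensionality: "elts x = elts y \<Longrightarrow> x = y"
    and foundation: "elts x \<noteq> {} \<Longrightarrow> \<exists>y\<in>elts x. elts y \<inter> elts x = {}"
    and pairing: "\<exists>z. elts z = {x, y}"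
    and union: "\<exists>z. elts z = (\<Union>y\<in>elts x. elts y)"
    and powerset: "\<exists>z. elts z = {y. elts y \<subseteq> elts x}"
    and infinity: "\<exists>z. (\<exists>e\<in>elts z. elts e = {}) \<and>
                       (\<forall>x\<in>elts z. \<exists>y\<in>elts z. elts y = insert x (elts x))"
    and separation: "\<exists>z. elts z = {y \<in> elts x. P y}"
    and replacement: "\<exists>z. elts z = F ` elts x"

text \<open>The set with a given extension; only meaningful if there is one.\<close>

definition vset :: "'v set \<Rightarrow> 'v::set_universe" where
  "vset A = (THE x. elts x = A)"

definition vpair :: "'v \<Rightarrow> 'v \<Rightarrow> 'v::set_universe" where
  "vpair x y = vset {vset {x}, vset {x, y}}"

definition vrel :: "'v::set_universe \<Rightarrow> 'v \<Rightarrow> 'v \<Rightarrow> bool" where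
  "vrel R x y \<longleftrightarrow> vpair x y \<in> elts R"

definition vapp :: "'v \<Rightarrow> 'v \<Rightarrow> 'v::set_universe" where
  "vapp f x = (THE y. vpair x y \<in> elts f)"

definition vfunction :: "'v::set_universe \<Rightarrow> 'v set \<Rightarrow> 'v set \<Rightarrow> bool" where
  "vfunction f A B \<longleftrightarrow>
     elts f \<subseteq> {vpair x y |x y. x \<in> A \<and> y \<in> B} \<and> (\<forall>x\<in>A. \<exists>!y. vpair x y \<in> elts f)"

definition vgraph :: "'v set \<Rightarrow> ('v \<Rightarrow> 'v) \<Rightarrow> 'v::set_universe" where
  "vgraph A f = vset {vpair x (f x) |x. x \<in> A}"


section \<open>Ordinals and cardinals\<close>

text \<open>Von Neumann ordinals: \<open>\<alpha> < \<beta>\<close> is \<open>\<alpha> \<in> elts \<beta>\<close>, \<open>\<alpha> \<le> \<beta>\<close> is inclusion.\<close>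

definition vord :: "'v::set_universe \<Rightarrow> bool" where
  "vord \<alpha> \<longleftrightarrow> (\<forall>x\<in>elts \<alpha>. elts x \<subseteq> elts \<alpha>) \<and> (\<forall>x\<in>elts \<alpha>. \<forall>y\<in>elts x. elts y \<subseteq> elts x)"

definition vle :: "'v::set_universe \<Rightarrow> 'v \<Rightarrow> bool" where
  "vle \<alpha> \<beta> \<longleftrightarrow> elts \<alpha> \<subseteq> elts \<beta>"

definition vmax :: "'v::set_universe \<Rightarrow> 'v \<Rightarrow> 'v" where
  "vmax \<alpha> \<beta> = (if vle \<alpha> \<beta> then \<beta> else \<alpha>)"

definition vzero :: "'v::set_universe" where
  "vzero = vset {}"

definition vsucc :: "'v \<Rightarrow> 'v::set_universe" where
  "vsucc \<alpha> = vset (insert \<alpha> (elts \<alpha>))"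

definition vlimit :: "'v::set_universe \<Rightarrow> bool" where
  "vlimit \<alpha> \<longleftrightarrow> vord \<alpha> \<and> \<alpha> \<noteq> vzero \<and> (\<forall>\<beta>\<in>elts \<alpha>. vsucc \<beta> \<in> elts \<alpha>)"

primrec vnat :: "nat \<Rightarrow> 'v::set_universe" where
  "vnat 0 = vzero"
| "vnat (Suc n) = vsucc (vnat n)"

definition vomega :: "'v::set_universe" where
  "vomega = vset (range vnat)"

definition vleast :: "('v \<Rightarrow> bool) \<Rightarrow> 'v::set_universe" where
  "vleast P = (THE \<alpha>. vord \<alpha> \<and> P \<alpha> \<and> (\<forall>\<beta>\<in>elts \<alpha>. \<not> P \<beta>))"

definition vcard :: "'v \<Rightarrow> 'v::set_universe" where
  "vcard x = vleast (\<lambda>\<alpha>. elts x \<approx> elts \<alpha>)"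


section \<open>Formulas, relativization and absoluteness\<close>

text \<open>Formulas of the language of set theory; variables are natural numbers.\<close>

datatype fm =
    FMem nat nat
  | FEq nat nat
  | FNeg fm
  | FConj fm fm
  | FEx nat fm
  | FAll nat fm

primrec fv :: "fm \<Rightarrow> nat set" where
  "fv (FMem i j) = {i, j}"
| "fv (FEq i j) = {i, j}"
| "fv (FNeg \<phi>) = fv \<phi>"
| "fv (FConj \<phi> \<psi>) = fv \<phi> \<union> fv \<psi>"
| "fv (FEx i \<phi>) = fv \<phi> - {i}"
| "fv (FAll i \<phi>) = fv \<phi> - {i}"

text \<open>
  \<open>holds N \<phi> a\<close>: the relativization of \<open>\<phi>\<close> to \<open>N\<close> is true under the assignment \<open>a\<close>.
  For \<open>N = UNIV\<close> this is truth in the universe.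
\<close>

primrec holds :: "'v::set_universe set \<Rightarrow> fm \<Rightarrow> (nat \<Rightarrow> 'v) \<Rightarrow> bool" where
  "holds N (FMem i j) a \<longleftrightarrow> a i \<in> elts (a j)"
| "holds N (FEq i j) a \<longleftrightarrow> a i = a j"
| "holds N (FNeg \<phi>) a \<longleftrightarrow> \<not> holds N \<phi> a"
| "holds N (FConj \<phi> \<psi>) a \<longleftrightarrow> holds N \<phi> a \<and> holds N \<psi> a"
| "holds N (FEx i \<phi>) a \<longleftrightarrow> (\<exists>x\<in>N. holds N \<phi> (a(i := x)))"
| "holds N (FAll i \<phi>) a \<longleftrightarrow> (\<forall>x\<in>N. holds N \<phi> (a(i := x)))"

definition absolute_for :: "'v::set_universe \<Rightarrow> fm \<Rightarrow> bool" where
  "absolute_for N \<phi> \<longleftrightarrow>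
     (\<forall>a. (\<forall>i\<in>fv \<phi>. a i \<in> elts N) \<longrightarrow> (holds (elts N) \<phi> a \<longleftrightarrow> holds UNIV \<phi> a))"

definition suitable_model :: "'v::set_universe \<Rightarrow> fm list \<Rightarrow> 'v set \<Rightarrow> bool" where
  "suitable_model M \<Phi> A \<longleftrightarrow> A \<subseteq> elts M \<and> (\<forall>\<phi>\<in>set \<Phi>. absolute_for M \<phi>)"


section \<open>Topological spaces and spaces of continuous functions\<close>

definition tychonoff_space :: "'a topology \<Rightarrow> bool" where
  "tychonoff_space X \<longleftrightarrow> completely_regular_space X \<and> Hausdorff_space X"

definition base_of :: "'a topology \<Rightarrow> 'a set set \<Rightarrow> bool" where
  "base_of X B \<longleftrightarrow> (\<forall>V\<in>B. openin X V) \<and>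
     (\<forall>U x. openin X U \<and> x \<in> U \<longrightarrow> (\<exists>V\<in>B. x \<in> V \<and> V \<subseteq> U))"

definition weight :: "'v topology \<Rightarrow> 'v::set_universe" where
  "weight X = vleast (\<lambda>\<kappa>. \<exists>B. base_of X B \<and> B \<approx> elts \<kappa>)"

definition vtopology :: "'v::set_universe \<Rightarrow> 'v \<Rightarrow> bool" where
  "vtopology K \<tau> \<longleftrightarrow> istopology (\<lambda>U. U \<in> elts ` elts \<tau>) \<and> \<Union>(elts ` elts \<tau>) = elts K"

text \<open>The library topology whose open sets are the (extensions of the) members of \<open>\<tau>\<close>.\<close>

definition vspace :: "'v \<Rightarrow> 'v::set_universe topology" where
  "vspace \<tau> = topology (\<lambda>U. U \<in> elts ` elts \<tau>)"

text \<open>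
  \<open>\<C>(K)\<close> with the supremum metric. Its elements are HOL functions that are \<open>undefined\<close> outside
  the space.
\<close>

abbreviation cspace :: "'a topology \<Rightarrow> ('a \<Rightarrow> real) metric" where
  "cspace X \<equiv> cfunspace X euclidean_metric"

text \<open>
  Real numbers inside the universe: a rational number is coded by its reduced fraction
  (with the integer numerator \<open>a\<close> written as the difference of \<open>nat a\<close> and \<open>nat (- a)\<close>),
  a real number by its lower Dedekind cut.
\<close>

definition vrat :: "rat \<Rightarrow> 'v::set_universe" where
  "vrat q = (let (a, b) = quotient_of q
     in vpair (vpair (vnat (nat a)) (vnat (nat (- a)))) (vnat (nat b)))"

definition vreal :: "real \<Rightarrow> 'v::set_universe" where
  "vreal x = vset (vrat ` {q. of_rat q < x})"

text \<open>The set in the universe which is the (graph of the) function \<open>f \<in> \<C>(K)\<close>.\<close>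

definition vcfun :: "'v topology \<Rightarrow> ('v \<Rightarrow> real) \<Rightarrow> 'v::set_universe" where
  "vcfun X f = vgraph (topspace X) (\<lambda>x. vreal (f x))"

definition separates_points :: "('a \<Rightarrow> real) set \<Rightarrow> 'a set \<Rightarrow> bool" where
  "separates_points F A \<longleftrightarrow> (\<forall>x\<in>A. \<forall>y\<in>A. x \<noteq> y \<longrightarrow> (\<exists>f\<in>F. f x \<noteq> f y))"


section \<open>Retractional skeletons\<close>

definition up_directed :: "'i set \<Rightarrow> ('i \<Rightarrow> 'i \<Rightarrow> bool) \<Rightarrow> bool" where
  "up_directed G le \<longleftrightarrow> G \<noteq> {} \<and> (\<forall>s\<in>G. \<forall>t\<in>G. \<exists>u\<in>G. le s u \<and> le t u)"

definition poset_on :: "'i set \<Rightarrow> ('i \<Rightarrow> 'i \<Rightarrow> bool) \<Rightarrow> bool" where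
  "poset_on G le \<longleftrightarrow> reflp_on G le \<and> antisymp_on G le \<and> transp_on G le"

definition is_sup :: "'i set \<Rightarrow> ('i \<Rightarrow> 'i \<Rightarrow> bool) \<Rightarrow> 'i set \<Rightarrow> 'i \<Rightarrow> bool" where
  "is_sup G le A t \<longleftrightarrow> t \<in> G \<and> (\<forall>a\<in>A. le a t) \<and> (\<forall>u\<in>G. (\<forall>a\<in>A. le a u) \<longrightarrow> le t u)"

definition increasing_seq :: "'i set \<Rightarrow> ('i \<Rightarrow> 'i \<Rightarrow> bool) \<Rightarrow> (nat \<Rightarrow> 'i) \<Rightarrow> bool" where
  "increasing_seq G le s \<longleftrightarrow> (\<forall>n. s n \<in> G \<and> le (s n) (s (Suc n)))"

definition sigma_complete :: "'i set \<Rightarrow> ('i \<Rightarrow> 'i \<Rightarrow> bool) \<Rightarrow> bool" where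
  "sigma_complete G le \<longleftrightarrow> (\<forall>s. increasing_seq G le s \<longrightarrow> (\<exists>t. is_sup G le (range s) t))"

definition sigma_closure :: "'i set \<Rightarrow> ('i \<Rightarrow> 'i \<Rightarrow> bool) \<Rightarrow> 'i set \<Rightarrow> 'i set" where
  "sigma_closure G le A = \<Inter>{B. A \<subseteq> B \<and> B \<subseteq> G \<and>
     (\<forall>s t. increasing_seq B le s \<and> is_sup G le (range s) t \<longrightarrow> t \<in> B)}"

text \<open>Convergence along this filter is convergence of nets indexed by the up-directed set \<open>G\<close>.\<close>

definition net_filter :: "'i set \<Rightarrow> ('i \<Rightarrow> 'i \<Rightarrow> bool) \<Rightarrow> 'i filter" where
  "net_filter G le = (INF s\<in>G. principal {t \<in> G. le s t})"

lemma eventually_net_filter: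
  assumes "up_directed G le" "poset_on G le"
  shows "eventually P (net_filter G le) \<longleftrightarrow> (\<exists>s\<in>G. \<forall>t\<in>G. le s t \<longrightarrow> P t)"
proof -
  have "eventually P (net_filter G le) \<longleftrightarrow> (\<exists>s\<in>G. eventually P (principal {t \<in> G. le s t}))"
    unfolding net_filter_def
  proof (rule eventually_INF_base)
    show "G \<noteq> {}"
      using assms(1) by (simp add: up_directed_def)
  next
    fix s t assume st: "s \<in> G" "t \<in> G"
    then obtain u where u: "u \<in> G" "le s u" "le t u"
      using assms(1) by (auto simp: up_directed_def)
    have "{v \<in> G. le u v} \<subseteq> {v \<in> G. le s v} \<inter> {v \<in> G. le t v}"
      using st u transp_onD[of G le] assms(2) unfolding poset_on_def by blast
    then show "\<exists>x\<in>G. principal {v \<in> G. le x v}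
        \<le> inf (principal {v \<in> G. le s v}) (principal {v \<in> G. le t v})"
      using u(1) by (simp only: inf_principal principal_le_iff) blast
  qed
  then show ?thesis
    by (auto simp: eventually_principal)
qed

definition continuous_retraction :: "'a topology \<Rightarrow> ('a \<Rightarrow> 'a) \<Rightarrow> bool" where
  "continuous_retraction X \<rho> \<longleftrightarrow> continuous_map X X \<rho> \<and> (\<forall>x\<in>topspace X. \<rho> (\<rho> x) = \<rho> x)"

definition retractional_skeleton ::
    "'a topology \<Rightarrow> 'i set \<Rightarrow> ('i \<Rightarrow> 'i \<Rightarrow> bool) \<Rightarrow> ('i \<Rightarrow> 'a \<Rightarrow> 'a) \<Rightarrow> bool" where
  "retractional_skeleton X G le r \<longleftrightarrow>
     tychonoff_space X \<and> compact_space X \<and>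
     poset_on G le \<and> up_directed G le \<and> sigma_complete G le \<and>
     (\<forall>s\<in>G. continuous_retraction X (r s)) \<and>
     (\<forall>s\<in>G. metrizable_space (subtopology X (r s ` topspace X)) \<and>
             compact_space (subtopology X (r s ` topspace X))) \<and>
     (\<forall>s\<in>G. \<forall>t\<in>G. le s t \<longrightarrow> (\<forall>x\<in>topspace X. r s x = r t (r s x) \<and> r s x = r s (r t x))) \<and>
     (\<forall>s t. increasing_seq G le s \<and> is_sup G le (range s) t \<longrightarrow>
        (\<forall>x\<in>topspace X. limitin X (\<lambda>n. r (s n) x) (r t x) sequentially)) \<and>
     (\<forall>x\<in>topspace X. limitin X (\<lambda>s. r s x) x (net_filter G le))"

definition induced_set :: "'a topology \<Rightarrow> 'i set \<Rightarrow> ('i \<Rightarrow> 'a \<Rightarrow> 'a) \<Rightarrow> 'a set" where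
  "induced_set X G r = (\<Union>s\<in>G. r s ` topspace X)"

definition full_skeleton :: "'a topology \<Rightarrow> 'i set \<Rightarrow> ('i \<Rightarrow> 'a \<Rightarrow> 'a) \<Rightarrow> bool" where
  "full_skeleton X G r \<longleftrightarrow> induced_set X G r = topspace X"

definition commutative_skeleton :: "'a topology \<Rightarrow> 'i set \<Rightarrow> ('i \<Rightarrow> 'a \<Rightarrow> 'a) \<Rightarrow> bool" where
  "commutative_skeleton X G r \<longleftrightarrow> (\<forall>s\<in>G. \<forall>t\<in>G. \<forall>x\<in>topspace X. r s (r t x) = r t (r s x))"


section \<open>Canonical retractions\<close>

definition fits_model ::
    "'v::set_universe topology \<Rightarrow> 'v set \<Rightarrow> 'v \<Rightarrow> ('v \<Rightarrow> 'v) \<Rightarrow> bool" where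
  "fits_model X D M \<rho> \<longleftrightarrow>
     continuous_retraction X \<rho> \<and>
     \<rho> ` topspace X = X closure_of (D \<inter> elts M) \<and>
     (\<forall>f\<in>mspace (cspace X). vcfun X f \<in> elts M \<longrightarrow> (\<forall>x\<in>topspace X. f x = f (\<rho> x)))"

text \<open>Uniqueness can only be asked for on the points of the space, as \<open>\<rho>\<close> is a total HOL function.\<close>

definition canonical_retraction ::
    "'v::set_universe topology \<Rightarrow> 'v set \<Rightarrow> 'v \<Rightarrow> ('v \<Rightarrow> 'v) \<Rightarrow> bool" where
  "canonical_retraction X D M \<rho> \<longleftrightarrow>
     fits_model X D M \<rho> \<and>
     (\<forall>\<rho>'. fits_model X D M \<rho>' \<longrightarrow> (\<forall>x\<in>topspace X. \<rho>' x = \<rho> x))"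

end

theory Submission
  imports Defs
begin

text \<open>
  For an up-directed \<open>T \<subseteq> \<Gamma>\<close> the limits of \<open>r\<^sub>s x\<close> for \<open>s \<in> T\<close> exist, because two cluster points
  would be visited alternately along an increasing sequence, and they define a continuous retraction
  onto the closure of \<open>\<Union>\<^sub>s r\<^sub>s[K]\<close>: its graph is closed, since a point of this closure is determined
  by its images under the \<open>r\<^sub>s\<close>. The canonical retraction of a model \<open>M\<close> is this limit for
  \<open>T = \<Gamma> \<inter> M\<close>. Elementarity is only used in the form of closure of \<open>M\<close> under witnesses for ten
  definable properties: if \<open>\<phi>\<close> and \<open>\<exists>x. \<phi>\<close> are absolute for \<open>M\<close> and the parameters are in \<open>M\<close>,
  then a witness for \<open>\<phi>\<close> in the universe can be replaced by one in \<open>M\<close>. Countable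
  dense sets, countable bases and countable separating families of functions are obtained in \<open>M\<close>
  as enumerations, so that their members are in \<open>M\<close> as well.
\<close>

section \<open>Compact spaces and increasing sequences of indices\<close>

text \<open>The topological half is free of models: it works for any up-directed \<open>T\<close>
  inside the index set. Because \<open>r s (rlim T x) = r s x\<close> for \<open>s \<in> T\<close>,
  the values \<open>r s x\<close> act as coordinates of a point of \<open>limrange T\<close>, and
  (R3), for instance, says that each coordinate is eventually constant. The obstacle is that
  \<open>T\<close> is not closed under suprema of sequences, and that \<open>rlim T x = x\<close> on
  \<open>limrange T\<close> cannot come from continuity, which is itself deduced from it. The
  substitute is \<open>countable_approximation\<close>: a supremum \<open>t\<close> such that
  \<open>r t x\<close> is in the closure of countably many points of a given set. Statements about
  all indices are reduced to one index by compactness. In the model half, uniqueness does much of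
  the work: if a formula determines its witness, as for the value of \<open>r\<close> at
  \<open>s\<close> or for the set of all continuous functions, the witness found in \<open>M\<close>
  is the intended object. (R11) rests on limit ordinals in which countable sets are bounded: there,
  countably many indices from stages below already come from a single earlier stage.\<close>

lemma poset_on_subset: "poset_on G le \<Longrightarrow> T \<subseteq> G \<Longrightarrow> poset_on T le"
  unfolding poset_on_def by (meson antisymp_on_subset reflp_on_subset transp_on_subset)

lemma up_directed_finite_ub:
  assumes "up_directed T le" "poset_on T le" "finite F" "F \<subseteq> T"
  shows "\<exists>u\<in>T. \<forall>s\<in>F. le s u"
  using assms(3,4)
proof (induction F)
  case empty
  then show ?case using assms(1) by (auto simp: up_directed_def)
next
  case (insert x F)
  then obtain u where u: "u \<in> T" "\<forall>s\<in>F. le s u" by auto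
  obtain v where v: "v \<in> T" "le x v" "le u v"
    using assms(1) u insert.prems unfolding up_directed_def by blast
  have "le s v" if "s \<in> F" for s
    using assms(2) u v that insert.prems unfolding poset_on_def by (meson insert_subset subsetD transp_onD)
  with v show ?case by auto
qed

lemma compact_space_indexed_subcover:
  assumes "compact_space X" "\<And>i. i \<in> I \<Longrightarrow> openin X (f i)" "topspace X \<subseteq> (\<Union>i\<in>I. f i)"
  obtains F where "finite F" "F \<subseteq> I" "topspace X \<subseteq> (\<Union>i\<in>F. f i)"
proof -
  have "\<exists>\<F>. finite \<F> \<and> \<F> \<subseteq> f ` I \<and> topspace X \<subseteq> \<Union>\<F>"
    using assms(1)[unfolded compact_space_alt, rule_format, of "f ` I"] assms(2,3) by auto
  then obtain \<F> where \<F>: "finite \<F>" "\<F> \<subseteq> f ` I" "topspace X \<subseteq> \<Union>\<F>" by auto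
  obtain F where "F \<subseteq> I" "finite F" "\<F> = f ` F"
    using finite_subset_image[OF \<F>(1,2)] by auto
  then show ?thesis using that \<F>(3) by auto
qed

text \<open>The complements cover, so finitely many of them do, and an upper bound \<open>u\<close>
  of their indices has \<open>C u\<close> contained in all the corresponding closed sets, which
  leaves nothing. This form of the finite intersection property is the standard way below to find a
  single index.\<close>

lemma compact_directed_closed_empty:
  assumes "compact_space Z" "up_directed T le" "poset_on T le"
    and cl: "\<And>s. s \<in> T \<Longrightarrow> closedin Z (C s)"
    and mono: "\<And>s t. s \<in> T \<Longrightarrow> t \<in> T \<Longrightarrow> le s t \<Longrightarrow> C t \<subseteq> C s"
    and emp: "(\<Inter>s\<in>T. C s) = {}"
  shows "\<exists>s\<in>T. C s = {}"
proof -
  have "topspace Z \<subseteq> \<Union>((\<lambda>s. topspace Z - C s) ` T)"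
    using emp assms(2) unfolding up_directed_def by auto
  moreover have "\<forall>U\<in>(\<lambda>s. topspace Z - C s) ` T. openin Z U"
    using cl by auto
  ultimately obtain F where F: "finite F" "F \<subseteq> T" "topspace Z \<subseteq> (\<Union>s\<in>F. topspace Z - C s)"
    using compact_space_indexed_subcover[OF assms(1), of T "\<lambda>s. topspace Z - C s"] by auto
  obtain u where u: "u \<in> T" "\<forall>s\<in>F. le s u"
    using up_directed_finite_ub[OF assms(2,3) F(1,2)] by auto
  have "C u = {}"
  proof (rule ccontr)
    assume "C u \<noteq> {}"
    then obtain z where z: "z \<in> C u" by auto
    then have "z \<in> topspace Z" using cl[OF u(1)] closedin_subset by blast
    then obtain s where "s \<in> F" "z \<notin> C s" using F(3) by auto
    then show False using mono[of s u] u F z by auto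
  qed
  then show ?thesis using u by auto
qed

text \<open>The open sets that \<open>f\<close> eventually avoids cover everything except possibly
  \<open>l\<close>. Together with a neighbourhood \<open>W\<close> of \<open>l\<close> finitely many
  of them cover the space, and eventually \<open>f\<close> has left all but
  \<open>W\<close>.\<close>

lemma limitin_compactI:
  assumes "compact_space X" "l \<in> topspace X" "eventually (\<lambda>i. f i \<in> topspace X) F"
    and sep: "\<And>y. y \<in> topspace X \<Longrightarrow> y \<noteq> l \<Longrightarrow> \<exists>U. openin X U \<and> y \<in> U \<and> eventually (\<lambda>i. f i \<notin> U) F"
  shows "limitin X f l F"
  unfolding limitin_def
proof (intro conjI allI impI)
  fix W assume W: "openin X W \<and> l \<in> W"
  define \<U> where "\<U> = {U. openin X U \<and> eventually (\<lambda>i. f i \<notin> U) F}"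
  have "topspace X \<subseteq> \<Union>(insert W \<U>)"
  proof
    fix y assume "y \<in> topspace X"
    then show "y \<in> \<Union>(insert W \<U>)"
      using sep[of y] W by (cases "y = l") (auto simp: \<U>_def)
  qed
  moreover have "\<forall>U\<in>insert W \<U>. openin X U" using W by (auto simp: \<U>_def)
  ultimately obtain \<F> where \<F>: "finite \<F>" "\<F> \<subseteq> insert W \<U>" "topspace X \<subseteq> \<Union>\<F>"
    using assms(1)[unfolded compact_space_alt, rule_format, of "insert W \<U>"] by auto
  have "eventually (\<lambda>i. \<forall>U\<in>\<F>-{W}. f i \<notin> U) F"
    by (rule eventually_ball_finite) (use \<F> in \<open>auto simp: \<U>_def\<close>)
  then show "eventually (\<lambda>i. f i \<in> W) F"
    using assms(3) by eventually_elim (use \<F>(3) in auto)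
qed (use assms in auto)

text \<open>The preimage of a closed \<open>C\<close> is the projection of a closed part of the
  graph, and projecting along a compact factor is a closed map.\<close>

lemma closed_graph_imp_continuous_map:
  assumes "compact_space Y" "f \<in> topspace X \<rightarrow> topspace Y"
    and cl: "closedin (prod_topology X Y) {(x, y). x \<in> topspace X \<and> y = f x}"
  shows "continuous_map X Y f"
  unfolding continuous_map_closedin
proof (intro conjI allI impI)
  show "f \<in> topspace X \<rightarrow> topspace Y" using assms(2) .
next
  fix C assume C: "closedin Y C"
  have "{x \<in> topspace X. f x \<in> C} = fst ` ({(x, y). x \<in> topspace X \<and> y = f x} \<inter> topspace X \<times> C)"
    by force
  moreover have "closedin (prod_topology X Y) ({(x, y). x \<in> topspace X \<and> y = f x} \<inter> topspace X \<times> C)"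
    using cl C by (intro closedin_Int) (auto simp: closedin_prod_Times_iff)
  ultimately show "closedin X {x \<in> topspace X. f x \<in> C}"
    using closed_map_fst[OF assms(1), of X] by (simp add: closed_map_def)
qed

lemma compact_metrizable_second_countable:
  assumes "compact_space X" "metrizable_space X"
  shows "second_countable X"
proof -
  obtain m d where md: "Metric_space m d" "X = Metric_space.mtopology m d"
    using assms(2) unfolding metrizable_space_def by auto
  interpret Metric_space m d by fact
  have "\<exists>F. finite F \<and> F \<subseteq> m \<and> m \<subseteq> (\<Union>x\<in>F. mball x (inverse (Suc n)))" for n
  proof -
    have "mtotally_bounded m"
      using assms(1) md by (metis compact_space_def compactin_imp_mtotally_bounded topspace_mtopology)
    then show ?thesis unfolding mtotally_bounded_def by simp
  qed
  then obtain F where F: "\<And>n. finite (F n)" "\<And>n. F n \<subseteq> m"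
      "\<And>n. m \<subseteq> (\<Union>x\<in>F n. mball x (inverse (Suc n)))"
    by metis
  define B where "B = (\<Union>n. (\<lambda>x. mball x (inverse (Suc n))) ` F n)"
  have "countable B" unfolding B_def using F(1) by (auto intro: countable_finite)
  moreover have "\<forall>V\<in>B. openin mtopology V" unfolding B_def by auto
  moreover have "\<exists>V\<in>B. x \<in> V \<and> V \<subseteq> U" if U: "openin mtopology U" "x \<in> U" for U x
  proof -
    obtain e where e: "e > 0" "mball x e \<subseteq> U" using U unfolding openin_mtopology by blast
    have xm: "x \<in> m" using U by (metis openin_mtopology subsetD)
    \<comment> \<open>With radius below \<open>e/2\<close>, a ball around a net point
      \<open>y\<close> that contains \<open>x\<close> lies inside the \<open>e\<close>-ball around
      \<open>x\<close>.\<close>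
    obtain n where n: "inverse (Suc n) < e/2" using e reals_Archimedean[of "e/2"] by auto
    obtain y where y: "y \<in> F n" "x \<in> mball y (inverse (Suc n))" using F(3) xm by blast
    have "mball y (inverse (Suc n)) \<subseteq> mball x e"
    proof
      fix z assume z: "z \<in> mball y (inverse (Suc n))"
      have "d x z \<le> d x y + d y z" using z y by (intro triangle) auto
      also have "\<dots> < e" using z y n by (auto simp: commute)
      finally show "z \<in> mball x e" using z xm by auto
    qed
    then show ?thesis using y e unfolding B_def by blast
  qed
  ultimately show ?thesis unfolding second_countable_def md(2) by (intro exI[of _ B]) simp
qed

lemma fst_prod_decode_le: "fst (prod_decode n) \<le> n"
  by (metis le_prod_encode_1 prod.collapse prod_decode_inverse)

text \<open>Bookkeeping construction: step \<open>n\<close> decodes \<open>n\<close> as a pair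
  \<open>(i, k)\<close> and adds an upper bound for the request \<open>g\<close> makes at the
  \<open>i\<close>-th term with number \<open>k\<close>. Since \<open>i \<le> n\<close>, only terms
  already built are consulted, and every pair has its turn.\<close>

function cofinal_seq :: "('i \<Rightarrow> 'i \<Rightarrow> 'i) \<Rightarrow> ('i \<Rightarrow> nat \<Rightarrow> 'i) \<Rightarrow> 'i \<Rightarrow> nat \<Rightarrow> 'i" where
  "cofinal_seq ub g s 0 = s"
| "cofinal_seq ub g s (Suc n) =
     ub (cofinal_seq ub g s n) (g (cofinal_seq ub g s (fst (prod_decode n))) (snd (prod_decode n)))"
  by pat_completeness auto
termination
  by (relation "Wellfounded.measure (\<lambda>(ub, g, s, n). n)")
     (simp_all add: less_Suc_eq_le fst_prod_decode_le)

lemma increasing_seq_mono: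
  assumes "poset_on T le" "increasing_seq T le u" "i \<le> j"
  shows "le (u i) (u j)"
  using assms(3)
proof (induction rule: dec_induct)
  case base
  show ?case using assms(1,2) by (auto simp: poset_on_def increasing_seq_def reflp_onD)
next
  case (step n)
  then show ?case using assms(1,2) unfolding poset_on_def increasing_seq_def by (meson transp_onD)
qed

text \<open>The requests depend on the sequence under construction, so they cannot be listed
  beforehand; the request of the pair \<open>(n, k)\<close> is met at step
  \<open>prod_encode (n, k)\<close>.\<close>

lemma ex_closed_increasing_seq:
  fixes g :: "'i \<Rightarrow> nat \<Rightarrow> 'i"
  assumes "up_directed T le" "poset_on T le" "s0 \<in> T" "\<And>s k. s \<in> T \<Longrightarrow> g s k \<in> T"
  shows "\<exists>u. increasing_seq T le u \<and> u 0 = s0 \<and> (\<forall>n k. \<exists>m. le (g (u n) k) (u m))"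
proof -
  obtain ub where ub: "\<And>s t. s \<in> T \<Longrightarrow> t \<in> T \<Longrightarrow> ub s t \<in> T \<and> le s (ub s t) \<and> le t (ub s t)"
    using assms(1) unfolding up_directed_def by metis
  define u where "u = cofinal_seq ub g s0"
  have uT: "u n \<in> T" for n
  proof (induction n rule: less_induct)
    case (less n)
    show ?case
    proof (cases n)
      case 0
      then show ?thesis using assms(3) by (simp add: u_def)
    next
      case (Suc k)
      have "fst (prod_decode k) < n"
        using Suc fst_prod_decode_le[of k] by simp
      then show ?thesis using less Suc ub assms(4) by (simp add: u_def)
    qed
  qed
  have uS: "u (Suc n) = ub (u n) (g (u (fst (prod_decode n))) (snd (prod_decode n)))" for n
    by (simp add: u_def)
  have "increasing_seq T le u"
    unfolding increasing_seq_def using uT uS ub assms(4) by metis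
  moreover have "u 0 = s0" by (simp add: u_def)
  moreover have "\<exists>m. le (g (u n) k) (u m)" for n k
    using uS[of "prod_encode (n, k)"] ub uT assms(4) by (metis fst_conv prod_encode_inverse snd_conv)
  ultimately show ?thesis by blast
qed

section \<open>Basic properties of a retractional skeleton and its countable approximations\<close>

locale skeleton =
  fixes X :: "'a topology" and G :: "'i set" and le :: "'i \<Rightarrow> 'i \<Rightarrow> bool" and r :: "'i \<Rightarrow> 'a \<Rightarrow> 'a"
  assumes skel: "retractional_skeleton X G le r"
begin

lemma compact: "compact_space X"
  and poset: "poset_on G le"
  and directed: "up_directed G le"
  using skel unfolding retractional_skeleton_def by auto

lemma Hausdorff: "Hausdorff_space X"
  and regular: "regular_space X"
  using skel completely_regular_imp_regular_space
  unfolding retractional_skeleton_def tychonoff_space_def by auto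

lemma cont: "s \<in> G \<Longrightarrow> continuous_map X X (r s)"
  using skel unfolding retractional_skeleton_def continuous_retraction_def by auto

lemma in_space [simp]: "s \<in> G \<Longrightarrow> x \<in> topspace X \<Longrightarrow> r s x \<in> topspace X"
  using cont continuous_map_image_subset_topspace by fastforce

lemma idem [simp]: "s \<in> G \<Longrightarrow> x \<in> topspace X \<Longrightarrow> r s (r s x) = r s x"
  using skel unfolding retractional_skeleton_def continuous_retraction_def by auto

lemma mono1: "s \<in> G \<Longrightarrow> t \<in> G \<Longrightarrow> le s t \<Longrightarrow> x \<in> topspace X \<Longrightarrow> r t (r s x) = r s x"
  and mono2: "s \<in> G \<Longrightarrow> t \<in> G \<Longrightarrow> le s t \<Longrightarrow> x \<in> topspace X \<Longrightarrow> r s (r t x) = r s x"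
  using skel unfolding retractional_skeleton_def by (metis+)

lemma image_eq: "s \<in> G \<Longrightarrow> r s ` topspace X = {x \<in> topspace X. r s x = x}"
proof (intro equalityI subsetI)
  fix x assume s: "s \<in> G" "x \<in> {x \<in> topspace X. r s x = x}"
  then show "x \<in> r s ` topspace X" by (auto simp: image_iff intro: sym)
qed (use idem in_space in auto)

lemma le_refl: "s \<in> G \<Longrightarrow> le s s"
  using poset by (auto simp: poset_on_def reflp_onD)

lemma le_trans: "s \<in> G \<Longrightarrow> t \<in> G \<Longrightarrow> u \<in> G \<Longrightarrow> le s t \<Longrightarrow> le t u \<Longrightarrow> le s u"
  using poset unfolding poset_on_def by (meson transp_onD)

lemma closed_map: "s \<in> G \<Longrightarrow> closed_map X X (r s)"
  by (rule continuous_imp_closed_map[OF cont compact Hausdorff])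

lemma image_closed: "s \<in> G \<Longrightarrow> closedin X (r s ` topspace X)"
  using closed_map by (auto simp: closed_map_def)

lemma ex_sup:
  assumes "increasing_seq G le u"
  obtains t where "t \<in> G" "is_sup G le (range u) t" "\<And>n. le (u n) t"
    "\<And>x. x \<in> topspace X \<Longrightarrow> limitin X (\<lambda>n. r (u n) x) (r t x) sequentially"
proof -
  obtain t where "is_sup G le (range u) t"
    using skel assms unfolding retractional_skeleton_def sigma_complete_def by blast
  moreover from this have "t \<in> G" "\<And>n. le (u n) t" by (auto simp: is_sup_def)
  moreover have "\<And>x. x \<in> topspace X \<Longrightarrow> limitin X (\<lambda>n. r (u n) x) (r t x) sequentially"
    using skel assms \<open>is_sup G le (range u) t\<close> unfolding retractional_skeleton_def by blast
  ultimately show ?thesis using that by blast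
qed

lemma sup_limit:
  assumes "increasing_seq G le u" "is_sup G le (range u) t" "x \<in> topspace X"
  shows "limitin X (\<lambda>n. r (u n) x) (r t x) sequentially"
  using skel assms unfolding retractional_skeleton_def by blast

lemma net_limit: "x \<in> topspace X \<Longrightarrow> limitin X (\<lambda>s. r s x) x (net_filter G le)"
  using skel unfolding retractional_skeleton_def by blast

lemma image_second_countable: "s \<in> G \<Longrightarrow> second_countable (subtopology X (r s ` topspace X))"
  using skel compact_metrizable_second_countable unfolding retractional_skeleton_def by blast

text \<open>The members of \<open>B\<close> are the preimages under \<open>r s\<close> of a base of its metrizable image.\<close>

lemma countable_base:
  assumes "s \<in> G"
  obtains B where "countable B" "\<forall>U\<in>B. openin X U"
    "\<forall>V x. openin X V \<longrightarrow> x \<in> topspace X \<longrightarrow> (\<forall>z\<in>topspace X. r s z = r s x \<longrightarrow> z \<in> V) \<longrightarrow>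
      (\<exists>U\<in>B. x \<in> U \<and> U \<subseteq> V)"
proof -
  define L where "L = r s ` topspace X"
  obtain B where B: "countable B" "\<forall>V \<in> B. openin (subtopology X L) V"
    "\<And>U x. openin (subtopology X L) U \<Longrightarrow> x \<in> U \<Longrightarrow> (\<exists>V \<in> B. x \<in> V \<and> V \<subseteq> U)"
    using image_second_countable[OF assms] unfolding second_countable_def L_def by metis
  have contL: "continuous_map X (subtopology X L) (r s)"
    using cont[OF assms] by (auto simp: L_def continuous_map_in_subtopology)
  define B' where "B' = (\<lambda>V. {z \<in> topspace X. r s z \<in> V}) ` B"
  have b1: "countable B'" using B(1) by (simp add: B'_def)
  have b2: "openin X U" if "U \<in> B'" for U
    using B(2) contL that by (auto simp: B'_def continuous_map)
  have b3: "\<exists>U\<in>B'. x \<in> U \<and> U \<subseteq> V"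
    if V: "openin X V" "x \<in> topspace X" "\<forall>z\<in>topspace X. r s z = r s x \<longrightarrow> z \<in> V" for V x
  proof -
    \<comment> \<open>The condition on the fibre says that \<open>r s x\<close> misses this closed
      image of the complement of \<open>V\<close>. A basic set around \<open>r s x\<close> that also
      misses it has its preimage inside \<open>V\<close>.\<close>
    have "closedin X (r s ` (topspace X - V))"
      using closed_map[OF assms] V(1) by (auto simp: closed_map_def)
    then have "openin (subtopology X L) (L - r s ` (topspace X - V))"
      by (metis Int_Diff closedin_def inf.absorb2 inf_commute openin_subtopology_Int2 image_closed[OF assms, folded L_def] closedin_subset)
    moreover have "r s x \<in> L - r s ` (topspace X - V)" using V by (auto simp: L_def)
    ultimately obtain W where W: "W \<in> B" "r s x \<in> W" "W \<subseteq> L - r s ` (topspace X - V)" using B(3) by blast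
    show ?thesis
    proof (rule bexI[of _ "{z \<in> topspace X. r s z \<in> W}"])
      show "{z \<in> topspace X. r s z \<in> W} \<in> B'" using W(1) by (auto simp: B'_def)
      show "x \<in> {z \<in> topspace X. r s z \<in> W} \<and> {z \<in> topspace X. r s z \<in> W} \<subseteq> V"
        using V(2) W(2,3) by blast
    qed
  qed
  show ?thesis using that[OF b1] b2 b3 by simp
qed

text \<open>The closure construction is run with a request function that ignores its first argument
  and enumerates \<open>C\<close>; the empty set has no such enumeration and gets a constant
  sequence.\<close>

lemma dominating_seq:
  assumes "T \<subseteq> G" "up_directed T le" "countable C" "C \<subseteq> T"
  shows "\<exists>u. increasing_seq T le u \<and> (\<forall>c\<in>C. \<exists>m. le c (u m))"
proof (cases "C = {}")
  case True
  obtain s where "s \<in> T" using assms(2) by (auto simp: up_directed_def)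
  then have "increasing_seq T le (\<lambda>_. s)" using le_refl assms(1) by (auto simp: increasing_seq_def)
  then show ?thesis using True by auto
next
  case False
  then obtain s where s: "s \<in> C" by auto
  have g: "from_nat_into C k \<in> T" for k using from_nat_into[OF False] assms(4) by auto
  have "s \<in> T" using s assms(4) by auto
  then obtain u where "increasing_seq T le u" "\<forall>k. \<exists>m. le (from_nat_into C k) (u m)"
    using ex_closed_increasing_seq[OF assms(2) poset_on_subset[OF poset assms(1)], of s "\<lambda>_. from_nat_into C"] g
    by auto
  then show ?thesis using assms(3) by (metis from_nat_into_to_nat_on)
qed

lemma increasing_seq_superset: "increasing_seq T le u \<Longrightarrow> T \<subseteq> G \<Longrightarrow> increasing_seq G le u"
  by (auto simp: increasing_seq_def)

text \<open>
  The sequence is closed under passing to indices of points of \<open>A\<close> chosen in a countable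
  neighbourhood base of the fibre of each \<open>r (u n)\<close> through \<open>x\<close>. A point of \<open>r t ` topspace X\<close>
  with the same image as \<open>x\<close> under all \<open>r (u n)\<close> is \<open>r t x\<close>, so these points accumulate there.
\<close>

lemma countable_approximation:
  assumes T: "T \<subseteq> G" "up_directed T le" and A: "A \<subseteq> (\<Union>s\<in>T. r s ` topspace X)"
    and x: "x \<in> X closure_of A" and s0: "s0 \<in> T"
  obtains u t C where "increasing_seq T le u" "u 0 = s0" "is_sup G le (range u) t"
    "countable C" "C \<subseteq> A" "C \<subseteq> r t ` topspace X" "r t x \<in> X closure_of C"
proof -
  have xX: "x \<in> topspace X" using x by (simp add: in_closure_of)
  have PT: "poset_on T le" using poset_on_subset poset T(1) .
  define P where "P = (\<lambda>s N. (\<forall>k. openin X (N k) \<and> x \<in> N k) \<and>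
      (\<forall>V. openin X V \<longrightarrow> (\<forall>z\<in>topspace X. r s z = r s x \<longrightarrow> z \<in> V) \<longrightarrow>
        (\<exists>k::nat. N k \<subseteq> V)))"
  have "\<exists>N. P s N" if sT: "s \<in> T" for s
  proof -
    obtain B where B: "countable B" "\<forall>U\<in>B. openin X U"
      "\<forall>V x. openin X V \<longrightarrow> x \<in> topspace X \<longrightarrow> (\<forall>z\<in>topspace X. r s z = r s x \<longrightarrow> z \<in> V) \<longrightarrow>
        (\<exists>U\<in>B. x \<in> U \<and> U \<subseteq> V)"
      by (rule countable_base[OF subsetD[OF T(1) sT]])
    define B' where "B' = {U \<in> B. x \<in> U}"
    have "\<exists>U\<in>B. x \<in> U" using B(3)[rule_format, OF openin_topspace xX] by blast
    then have ne: "B' \<noteq> {}" by (auto simp: B'_def)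
    have cB': "countable B'" using B(1) by (auto simp: B'_def)
    show ?thesis unfolding P_def
    proof (intro exI[of _ "from_nat_into B'"] allI conjI impI)
      fix k
      have "from_nat_into B' k \<in> B'" using ne by (rule from_nat_into)
      then show "openin X (from_nat_into B' k)" "x \<in> from_nat_into B' k" using B(2) by (auto simp: B'_def)
    next
      fix V assume "openin X V" "\<forall>z\<in>topspace X. r s z = r s x \<longrightarrow> z \<in> V"
      then obtain U where U: "U \<in> B" "x \<in> U" "U \<subseteq> V"
        using B(3)[rule_format, of V x] xX by blast
      then have "U \<in> B'" by (auto simp: B'_def)
      then show "\<exists>k. from_nat_into B' k \<subseteq> V"
        using U by (intro exI[of _ "to_nat_on B' U"]) (simp add: cB')
    qed
  qed
  then have "\<exists>N. \<forall>s\<in>T. P s (N s)" by (intro bchoice ballI)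
  then obtain N where "\<forall>s\<in>T. P s (N s)" ..
  then have N: "\<And>s k. s \<in> T \<Longrightarrow> openin X (N s k)" "\<And>s k. s \<in> T \<Longrightarrow> x \<in> N s k"
    "\<And>s V. s \<in> T \<Longrightarrow> openin X V \<Longrightarrow> \<forall>z\<in>topspace X. r s z = r s x \<longrightarrow> z \<in> V \<Longrightarrow>
        \<exists>k. N s k \<subseteq> V"
    by (auto simp: P_def)
  have "\<forall>a\<in>A. \<exists>v. v \<in> T \<and> a \<in> r v ` topspace X" using A by blast
  then obtain v where v: "\<And>a. a \<in> A \<Longrightarrow> v a \<in> T" "\<And>a. a \<in> A \<Longrightarrow> a \<in> r (v a) ` topspace X"
    by metis
  define e where "e s k = (SOME a. a \<in> A \<and> a \<in> N s k)" for s k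
  have e: "e s k \<in> A" "e s k \<in> N s k" if "s \<in> T" for s k
  proof -
    have "\<exists>a. a \<in> A \<and> a \<in> N s k" using x N(1,2)[OF that] unfolding in_closure_of by blast
    then have "e s k \<in> A \<and> e s k \<in> N s k" unfolding e_def by (rule someI_ex)
    then show "e s k \<in> A" "e s k \<in> N s k" by auto
  qed
  \<comment> \<open>\<open>v (e s k)\<close> is an index whose retraction fixes the point
    \<open>e s k\<close>. Once the sequence dominates it, the supremum \<open>t\<close> fixes that
    point too, which puts all of \<open>C\<close> into the range of \<open>r t\<close>.\<close>
  obtain u where u: "increasing_seq T le u" "u 0 = s0" "\<And>n k. \<exists>m. le (v (e (u n) k)) (u m)"
    using ex_closed_increasing_seq[OF T(2) PT s0, of "\<lambda>s k. v (e s k)"] e v by auto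
  have uG: "increasing_seq G le u" using increasing_seq_superset[OF u(1) T(1)] .
  have uT: "u n \<in> T" for n using u(1) by (auto simp: increasing_seq_def)
  have unG: "u n \<in> G" for n using uT T(1) by auto
  obtain t where t: "t \<in> G" "is_sup G le (range u) t" "\<And>n. le (u n) t"
    "\<And>x. x \<in> topspace X \<Longrightarrow> limitin X (\<lambda>n. r (u n) x) (r t x) sequentially"
    using ex_sup[OF uG] by metis
  define C where "C = (\<lambda>(n, k). e (u n) k) ` UNIV"
  have CA: "C \<subseteq> A" using e uT by (auto simp: C_def)
  have Ct: "C \<subseteq> r t ` topspace X"
  proof
    fix c assume "c \<in> C"
    then obtain n k where c: "c = e (u n) k" by (auto simp: C_def)
    obtain m where m: "le (v (e (u n) k)) (u m)" using u(3) by blast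
    have vG: "v (e (u n) k) \<in> G" "u m \<in> G" using e v uT T(1) by auto
    have "le (v (e (u n) k)) t" using le_trans[OF vG t(1) m t(3)] .
    moreover obtain z where "z \<in> topspace X" "c = r (v (e (u n) k)) z" using v(2)[OF e(1)[OF uT]] c by blast
    ultimately have "r t c = c" "c \<in> topspace X" using mono1[OF vG(1) t(1)] vG by auto
    then show "c \<in> r t ` topspace X" by (metis image_eqI)
  qed
  have "r t x \<in> X closure_of C"
    unfolding in_closure_of
  proof (intro conjI allI impI)
    fix W assume W: "r t x \<in> W \<and> openin X W"
    define Cn where "Cn = (\<lambda>n. {z \<in> r t ` topspace X - W. r (u n) z = r (u n) x})"
    have "\<exists>n\<in>UNIV. Cn n = {}"
    proof (rule compact_directed_closed_empty[OF compact, of UNIV "(\<le>)"])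
      show "up_directed UNIV ((\<le>) :: nat \<Rightarrow> nat \<Rightarrow> bool)"
        unfolding up_directed_def by (auto intro: max.cobounded1 max.cobounded2)
      show "poset_on UNIV ((\<le>) :: nat \<Rightarrow> nat \<Rightarrow> bool)"
        unfolding poset_on_def by (auto intro!: reflp_onI antisymp_onI transp_onI)
      show "closedin X (Cn n)" for n
      proof -
        have "Cn n = (r t ` topspace X - W) \<inter> {z \<in> topspace X. r (u n) z \<in> {r (u n) x}}"
          using t(1) in_space by (auto simp: Cn_def)
        moreover have "closedin X {r (u n) x}"
          using Hausdorff uT T(1) xX by (meson closedin_Hausdorff_singleton in_space subsetD)
        moreover have "continuous_map X X (r (u n))" using cont uT T(1) by blast
        moreover have "closedin X (r t ` topspace X - W)" using image_closed[OF t(1)] W by blast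
        ultimately show ?thesis
          by (simp only: closedin_Int closedin_continuous_map_preimage)
      qed
      show "Cn j \<subseteq> Cn i" if "i \<le> j" for i j
      proof
        fix z assume z: "z \<in> Cn j"
        have zX: "z \<in> topspace X" using z t(1) in_space by (auto simp: Cn_def)
        have ij: "le (u i) (u j)" using increasing_seq_mono[OF PT u(1) that] .
        have "r (u i) z = r (u i) (r (u j) z)" using mono2[OF unG unG ij zX] by simp
        also have "\<dots> = r (u i) x" using z mono2[OF unG unG ij xX] by (auto simp: Cn_def)
        finally show "z \<in> Cn i" using z by (auto simp: Cn_def)
      qed
      show "(\<Inter>n. Cn n) = {}"
      proof (rule ccontr)
        assume "(\<Inter>n. Cn n) \<noteq> {}"
        then obtain z where z: "\<And>n. z \<in> Cn n" by auto
        have zX: "z \<in> topspace X" "z = r t z" using z[of 0] t(1) by (auto simp: Cn_def image_eq)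
        have "limitin X (\<lambda>n. r (u n) z) (r t x) sequentially"
          using t(4)[OF xX] z by (simp add: Cn_def)
        then have "r t z = r t x"
          using limitin_Hausdorff_unique[OF t(4)[OF zX(1)] _ _ Hausdorff] by simp
        then show False using zX z[of 0] W by (simp add: Cn_def)
      qed
    qed
    then obtain n where n: "Cn n = {}" by (elim bexE)
    \<comment> \<open>\<open>V\<close> contains the whole fibre of \<open>r (u n)\<close> through
      \<open>x\<close>, so some \<open>N (u n) k\<close> lies in it. The point chosen there belongs
      to \<open>C\<close>, hence to the range of \<open>r t\<close>, and the points of that range in
      \<open>V\<close> are in \<open>W\<close>.\<close>
    define V where "V = topspace X - (r t ` topspace X - W)"
    have "openin X V" unfolding V_def using image_closed[OF t(1)] W by (meson closedin_diff openin_diff openin_topspace)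
    moreover have "\<forall>z\<in>topspace X. r (u n) z = r (u n) x \<longrightarrow> z \<in> V"
      using n by (auto simp: V_def Cn_def)
    ultimately obtain k where k: "N (u n) k \<subseteq> V"
      using N(3)[OF uT, of V n] by auto
    have "e (u n) k \<in> C" by (auto simp: C_def)
    moreover have "e (u n) k \<in> V" using k e(2)[OF uT] Ct \<open>e (u n) k \<in> C\<close> image_eq[OF t(1)] by blast
    ultimately have "e (u n) k \<in> W" using Ct by (auto simp: V_def)
    then show "\<exists>y. y \<in> C \<and> y \<in> W" using \<open>e (u n) k \<in> C\<close> by blast
  qed (use xX t(1) in auto)
  moreover have "countable C" unfolding C_def by simp
  ultimately show ?thesis using that[OF u(1,2) t(2) _ CA Ct] by simp
qed

end

section \<open>Limits of retractions along up-directed sets\<close>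

lemma sigma_closure_induct [consumes 2, case_names base sup]:
  assumes "t \<in> sigma_closure G le T" "T \<subseteq> G"
    and "\<And>s. s \<in> T \<Longrightarrow> P s"
    and "\<And>s t. increasing_seq G le s \<Longrightarrow> (\<And>n. P (s n)) \<Longrightarrow> is_sup G le (range s) t \<Longrightarrow> P t"
  shows "P t"
proof -
  have "sigma_closure G le T \<subseteq> {t \<in> G. P t}"
    unfolding sigma_closure_def
  proof (rule Inter_lower, rule CollectI, intro conjI allI impI)
    fix s t assume "increasing_seq {t \<in> G. P t} le s \<and> is_sup G le (range s) t"
    then show "t \<in> {t \<in> G. P t}"
      using assms(4)[of s t] by (auto simp: increasing_seq_def is_sup_def)
  qed (use assms in auto)
  then show ?thesis using assms(1) by auto
qed

lemma sigma_closure_superset: "T \<subseteq> sigma_closure G le T"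
  by (auto simp: sigma_closure_def)

lemma sigma_closure_subset: "T \<subseteq> G \<Longrightarrow> sigma_closure G le T \<subseteq> G"
  unfolding sigma_closure_def by (rule Inter_lower) (auto simp: is_sup_def)

lemma sigma_closure_sup:
  assumes "increasing_seq (sigma_closure G le T) le s" "is_sup G le (range s) t"
  shows "t \<in> sigma_closure G le T"
  unfolding sigma_closure_def
proof (rule InterI)
  fix B assume B: "B \<in> {B. T \<subseteq> B \<and> B \<subseteq> G \<and>
     (\<forall>s t. increasing_seq B le s \<and> is_sup G le (range s) t \<longrightarrow> t \<in> B)}"
  then have "increasing_seq B le s"
    using assms(1) unfolding increasing_seq_def sigma_closure_def by auto
  then show "t \<in> B" using B assms(2) by auto
qed

lemma closedin_kernel_pair:
  assumes "Hausdorff_space Y" "continuous_map X Y f"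
  shows "closedin (prod_topology X X) {p \<in> topspace (prod_topology X X). f (fst p) = f (snd p)}"
  using closedin_continuous_maps_eq[OF assms(1) continuous_map_compose[OF continuous_map_fst assms(2)]
      continuous_map_compose[OF continuous_map_snd assms(2)]]
  by (simp add: o_def)

text \<open>Compactness applied to the family of all finite subsets of \<open>A\<close>.\<close>

lemma finite_separating_subset:
  assumes "compact_space X" "closedin X P" "closedin X Q"
    and contA: "\<And>f. f \<in> A \<Longrightarrow> continuous_map X euclideanreal f"
    and sep: "\<And>x y. x \<in> P \<Longrightarrow> y \<in> Q \<Longrightarrow> \<exists>f\<in>A. f x \<noteq> f y"
  shows "\<exists>F. finite F \<and> F \<subseteq> A \<and> (\<forall>x\<in>P. \<forall>y\<in>Q. \<exists>f\<in>F. f x \<noteq> f y)"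
proof -
  define C where "C F = (P \<times> Q) \<inter> (\<Inter>f\<in>F. {p \<in> topspace (prod_topology X X). f (fst p) = f (snd p)})" for F :: "('a \<Rightarrow> real) set"
  have "\<exists>F\<in>{F. finite F \<and> F \<subseteq> A}. C F = {}"
  proof (rule compact_directed_closed_empty[of "prod_topology X X" _ "(\<subseteq>)"])
    show "compact_space (prod_topology X X)" using assms(1) by (simp add: compact_space_prod_topology)
    show "up_directed {F. finite F \<and> F \<subseteq> A} (\<subseteq>)"
      unfolding up_directed_def
    proof (intro conjI ballI)
      fix s t assume "s \<in> {F. finite F \<and> F \<subseteq> A}" "t \<in> {F. finite F \<and> F \<subseteq> A}"
      then show "\<exists>u\<in>{F. finite F \<and> F \<subseteq> A}. s \<subseteq> u \<and> t \<subseteq> u" by (intro bexI[of _ "s \<union> t"]) auto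
    qed auto
    show "poset_on {F. finite F \<and> F \<subseteq> A} (\<subseteq>)"
      unfolding poset_on_def by (auto intro!: reflp_onI antisymp_onI transp_onI)
    show "closedin (prod_topology X X) (C F)" if F: "F \<in> {F. finite F \<and> F \<subseteq> A}" for F
    proof -
      have "closedin (prod_topology X X) {p \<in> topspace (prod_topology X X). f (fst p) = f (snd p)}" if "f \<in> F" for f
        by (rule closedin_kernel_pair[where Y = euclideanreal]) (use contA F that in auto)
      moreover have "closedin (prod_topology X X) (P \<times> Q)"
        using assms by (simp add: closedin_prod_Times_iff)
      moreover have "C F = \<Inter>(insert (P \<times> Q) ((\<lambda>f. {p \<in> topspace (prod_topology X X). f (fst p) = f (snd p)}) ` F))"
        by (auto simp: C_def)
      ultimately show ?thesis
        by (simp only:) (intro closedin_Inter; auto)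
    qed
    show "C t \<subseteq> C s" if "s \<subseteq> t" for s t using that by (auto simp: C_def)
    show "(\<Inter>F\<in>{F. finite F \<and> F \<subseteq> A}. C F) = {}"
    proof (rule ccontr)
      assume "(\<Inter>F\<in>{F. finite F \<and> F \<subseteq> A}. C F) \<noteq> {}"
      then obtain p where p: "\<And>F. finite F \<Longrightarrow> F \<subseteq> A \<Longrightarrow> p \<in> C F" by auto
      obtain f where f: "f \<in> A" "f (fst p) \<noteq> f (snd p)"
        using sep[of "fst p" "snd p"] p[of "{}"] by (auto simp: C_def)
      then show False using p[of "{f}"] by (auto simp: C_def)
    qed
  qed
  then obtain F where F: "finite F" "F \<subseteq> A" "C F = {}" by auto
  have "\<exists>f\<in>F. f x \<noteq> f y" if "x \<in> P" "y \<in> Q" for x y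
  proof -
    have "(x, y) \<notin> C F" using F(3) by simp
    moreover have "x \<in> topspace X" "y \<in> topspace X" using that assms closedin_subset by blast+
    ultimately show ?thesis using that by (auto simp: C_def)
  qed
  then show ?thesis using F by blast
qed

text \<open>Regularity shrinks disjoint neighbourhoods. The closures have to be disjoint because a
  limit of points of \<open>U\<close> is only known to lie in the closure of
  \<open>U\<close>.\<close>

lemma disjoint_closures:
  assumes "Hausdorff_space X" "regular_space X" "y \<in> topspace X" "z \<in> topspace X" "y \<noteq> z"
  obtains U V where "openin X U" "openin X V" "y \<in> U" "z \<in> V"
    "X closure_of U \<inter> X closure_of V = {}"
proof -
  obtain U0 V0 where UV: "openin X U0" "openin X V0" "y \<in> U0" "z \<in> V0" "disjnt U0 V0"
    using assms unfolding Hausdorff_space_def by metis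
  have *: "\<exists>U. openin X U \<and> a \<in> U \<and> X closure_of U \<subseteq> W" if W: "openin X W" "a \<in> W" for a W
  proof -
    have "closedin X (topspace X - W)" "a \<in> topspace X - (topspace X - W)"
      using W openin_subset by auto
    then obtain U where "openin X U" "a \<in> U" "disjnt (topspace X - W) (X closure_of U)"
      using assms(2)[unfolded regular_space, rule_format, of "topspace X - W" a] by auto
    then show ?thesis using closure_of_subset_topspace[of X U] by (auto simp: disjnt_def)
  qed
  obtain U where "openin X U" "y \<in> U" "X closure_of U \<subseteq> U0" using *[OF UV(1,3)] by auto
  moreover obtain V where "openin X V" "z \<in> V" "X closure_of V \<subseteq> V0" using *[OF UV(2,4)] by auto
  ultimately show ?thesis using that[of U V] UV(5) by (auto simp: disjnt_def)
qed

context skeleton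
begin

text \<open>This becomes the range of \<open>rlim T\<close> (\<open>rlim_image\<close>) and, when
  \<open>T\<close> comes from a model \<open>M\<close>, the closure of the points of the induced set
  in \<open>M\<close> (\<open>limrange_eq\<close>).\<close>

definition limrange :: "'i set \<Rightarrow> 'a set" where
  "limrange T = X closure_of (\<Union>s\<in>T. r s ` topspace X)"

definition rlim :: "'i set \<Rightarrow> 'a \<Rightarrow> 'a" where
  "rlim T x = (SOME y. limitin X (\<lambda>s. r s x) y (net_filter T le))"

text \<open>Points with different images under \<open>r s\<close> lie in members of the countable
  base with disjoint closures. There are countably many such pairs of members, and by compactness
  finitely many functions of \<open>A\<close> separate the two closures of each pair.\<close>

lemma countable_separating_subset:
  assumes "s \<in> G" and contA: "\<And>f. f \<in> A \<Longrightarrow> continuous_map X euclideanreal f"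
    and sep: "separates_points A (topspace X)"
  shows "\<exists>A'. countable A' \<and> A' \<subseteq> A \<and>
    (\<forall>x\<in>topspace X. \<forall>y\<in>topspace X. r s x \<noteq> r s y \<longrightarrow> (\<exists>f\<in>A'. f x \<noteq> f y))"
proof -
  obtain B where B: "countable B" "\<forall>U\<in>B. openin X U"
    "\<forall>V x. openin X V \<longrightarrow> x \<in> topspace X \<longrightarrow> (\<forall>z\<in>topspace X. r s z = r s x \<longrightarrow> z \<in> V) \<longrightarrow>
      (\<exists>U\<in>B. x \<in> U \<and> U \<subseteq> V)"
    by (rule countable_base[OF assms(1)])
  define Q where "Q = {p \<in> B \<times> B. X closure_of (fst p) \<inter> X closure_of (snd p) = {}}"
  define sep_on where "sep_on F p \<longleftrightarrow> finite F \<and> F \<subseteq> A \<and>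
      (\<forall>x\<in>X closure_of (fst p). \<forall>y\<in>X closure_of (snd p). \<exists>f\<in>F. f x \<noteq> f y)" for F p
  have "\<forall>p\<in>Q. \<exists>F. sep_on F p"
    unfolding sep_on_def
  proof (intro ballI finite_separating_subset[OF compact])
    fix p x y assume p: "p \<in> Q" and xy: "x \<in> X closure_of (fst p)" "y \<in> X closure_of (snd p)"
    then have "x \<in> topspace X" "y \<in> topspace X" by (simp_all add: in_closure_of)
    moreover have "x \<noteq> y" using p xy by (auto simp: Q_def)
    ultimately show "\<exists>f\<in>A. f x \<noteq> f y" using sep unfolding separates_points_def by auto
  qed (use contA in auto)
  then obtain F where "\<forall>p\<in>Q. sep_on (F p) p" using bchoice[of Q "\<lambda>p F. sep_on F p"] by auto
  then have F: "\<forall>p\<in>Q. finite (F p) \<and> F p \<subseteq> A \<and>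
      (\<forall>x\<in>X closure_of (fst p). \<forall>y\<in>X closure_of (snd p). \<exists>f\<in>F p. f x \<noteq> f y)"
    unfolding sep_on_def .
  have "countable Q" using B(1) unfolding Q_def by (intro countable_Collect) auto
  then have "countable (\<Union>p\<in>Q. F p)" using F by (intro countable_UN) (auto intro: countable_finite)
  moreover have "(\<Union>p\<in>Q. F p) \<subseteq> A" using F by auto
  moreover have "\<exists>f\<in>(\<Union>p\<in>Q. F p). f x \<noteq> f y"
    if xy: "x \<in> topspace X" "y \<in> topspace X" "r s x \<noteq> r s y" for x y
  proof -
    obtain U0 V0 where UV: "openin X U0" "openin X V0" "r s x \<in> U0" "r s y \<in> V0"
      "X closure_of U0 \<inter> X closure_of V0 = {}"
      using disjoint_closures[OF Hausdorff regular _ _ xy(3)] xy assms(1) by auto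
    \<comment> \<open>A basic set is found whose closure is still mapped into the closure of
      \<open>W\<close> by \<open>r s\<close>. Disjointness of the closures of \<open>U0\<close> and
      \<open>V0\<close> is thereby inherited by the closures of the two basic sets.\<close>
    have *: "\<exists>U\<in>B. a \<in> U \<and> X closure_of U \<subseteq> {z \<in> topspace X. r s z \<in> X closure_of W}"
      if a: "openin X W" "r s a \<in> W" "a \<in> topspace X" for a W
    proof -
      have "openin X {z \<in> topspace X. r s z \<in> W}"
        using cont[OF assms(1)] a(1) by (auto simp: continuous_map)
      then obtain U where U: "U \<in> B" "a \<in> U" "U \<subseteq> {z \<in> topspace X. r s z \<in> W}"
        using B(3)[rule_format, of "{z \<in> topspace X. r s z \<in> W}" a] a by auto
      have "W \<subseteq> X closure_of W" using a(1) by (intro closure_of_subset openin_subset)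
      moreover have "U \<subseteq> topspace X" using U(1) B(2) openin_subset by auto
      ultimately have UW: "U \<subseteq> {z \<in> topspace X. r s z \<in> X closure_of W}"
        using U(3) by auto
      have "closedin X {z \<in> topspace X. r s z \<in> X closure_of W}"
        by (rule closedin_continuous_map_preimage[OF cont[OF assms(1)]]) simp
      then have "X closure_of U \<subseteq> {z \<in> topspace X. r s z \<in> X closure_of W}"
        by (rule closure_of_minimal[OF UW])
      then show ?thesis using U(1,2) by auto
    qed
    obtain U where U: "U \<in> B" "x \<in> U" "X closure_of U \<subseteq> {z \<in> topspace X. r s z \<in> X closure_of U0}"
      using *[OF UV(1,3) xy(1)] by auto
    obtain V where V: "V \<in> B" "y \<in> V" "X closure_of V \<subseteq> {z \<in> topspace X. r s z \<in> X closure_of V0}"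
      using *[OF UV(2,4) xy(2)] by auto
    have "(U, V) \<in> Q" using U V UV(5) by (auto simp: Q_def)
    moreover have "x \<in> X closure_of U" "y \<in> X closure_of V"
      using U(1,2) V(1,2) B(2) closure_of_subset[OF openin_subset, of X] by auto
    ultimately obtain f where "f \<in> F (U, V)" "f x \<noteq> f y"
      using F[rule_format, of "(U, V)"] by (metis fst_conv snd_conv)
    then show ?thesis using \<open>(U, V) \<in> Q\<close> by blast
  qed
  ultimately show ?thesis by (intro exI[of _ "\<Union>p\<in>Q. F p"]) simp
qed

lemma countable_dense_subset:
  assumes "s \<in> G"
  shows "\<exists>C. countable C \<and> C \<subseteq> r s ` topspace X \<and> r s ` topspace X \<subseteq> X closure_of C"
proof -
  let ?L = "r s ` topspace X"
  have L: "topspace (subtopology X ?L) = ?L" using in_space assms by auto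
  obtain C where C: "countable C" "C \<subseteq> ?L" "subtopology X ?L closure_of C = ?L"
    using second_countable_imp_separable_space[OF image_second_countable[OF assms]]
    unfolding separable_space_def L by auto
  then show ?thesis using closure_of_subtopology_subset[of X ?L C] by auto
qed

end

section \<open>Pointwise limits along an up-directed set of indices\<close>

locale subskeleton = skeleton +
  fixes T
  assumes TG: "T \<subseteq> G" and Tdir: "up_directed T le"
begin

lemma Tpos: "poset_on T le" using poset_on_subset[OF poset TG] .

lemma T_G [simp]: "s \<in> T \<Longrightarrow> s \<in> G" using TG by auto

lemma T_ne: obtains s where "s \<in> T"
  using Tdir by (auto simp: up_directed_def)

lemma ev_net: "eventually P (net_filter T le) \<longleftrightarrow> (\<exists>s\<in>T. \<forall>t\<in>T. le s t \<longrightarrow> P t)"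
  by (rule eventually_net_filter[OF Tdir Tpos])

lemma ev_netI: "s \<in> T \<Longrightarrow> (\<And>t. t \<in> T \<Longrightarrow> le s t \<Longrightarrow> P t) \<Longrightarrow> eventually P (net_filter T le)"
  by (auto simp: ev_net)

lemma net_nontrivial: "net_filter T le \<noteq> bot"
proof
  assume "net_filter T le = bot"
  then have "eventually (\<lambda>_. False) (net_filter T le)" by simp
  then obtain s where "s \<in> T" "\<forall>t\<in>T. \<not> le s t" unfolding ev_net by auto
  then show False using le_refl by auto
qed

lemma ex_rlim:
  assumes x: "x \<in> topspace X"
  shows "\<exists>y. limitin X (\<lambda>s. r s x) y (net_filter T le)"
proof -
  \<comment> \<open>The closures of the tails of the net; their intersection consists of its cluster
    points.\<close>
  define C where "C s = X closure_of {r t x |t. t \<in> T \<and> le s t}" for s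
  have "(\<Inter>s\<in>T. C s) \<noteq> {}"
  proof
    assume E: "(\<Inter>s\<in>T. C s) = {}"
    have "\<exists>s\<in>T. C s = {}"
    proof (rule compact_directed_closed_empty[OF compact Tdir Tpos _ _ E])
      fix s t assume st: "s \<in> T" "t \<in> T" "le s t"
      have "{r u x |u. u \<in> T \<and> le t u} \<subseteq> {r u x |u. u \<in> T \<and> le s u}"
      proof
        fix z assume "z \<in> {r u x |u. u \<in> T \<and> le t u}"
        then obtain u where u: "z = r u x" "u \<in> T" "le t u" by auto
        then have "le s u" using le_trans[of s t u] st by simp
        then show "z \<in> {r u x |u. u \<in> T \<and> le s u}" using u by auto
      qed
      then show "C t \<subseteq> C s" unfolding C_def by (rule closure_of_mono)
    qed (auto simp: C_def)
    then obtain s where s: "s \<in> T" "C s = {}" by auto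
    have "r s x \<in> C s" unfolding C_def
      using s(1) x le_refl by (intro closure_of_subset[THEN subsetD]) auto
    then show False using s by auto
  qed
  then obtain y where y: "\<And>s. s \<in> T \<Longrightarrow> y \<in> C s" by auto
  obtain s0 where s0: "s0 \<in> T" by (rule T_ne)
  have yX: "y \<in> topspace X" using y[OF s0] by (auto simp: C_def in_closure_of)
  have yf: "\<exists>t\<in>T. le s t \<and> r t x \<in> U" if "openin X U" "y \<in> U" "s \<in> T" for U s
    using y[OF that(3)] that(1,2) unfolding C_def in_closure_of by blast
  have "limitin X (\<lambda>s. r s x) y (net_filter T le)"
  proof (rule limitin_compactI[OF compact yX])
    show "\<forall>\<^sub>F i in net_filter T le. r i x \<in> topspace X"
      using s0 x by (intro ev_netI[of s0]) auto
  next
    fix z assume z: "z \<in> topspace X" "z \<noteq> y"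
    show "\<exists>U. openin X U \<and> z \<in> U \<and> (\<forall>\<^sub>F i in net_filter T le. r i x \<notin> U)"
    proof (rule ccontr)
      assume "\<nexists>U. openin X U \<and> z \<in> U \<and> (\<forall>\<^sub>F i in net_filter T le. r i x \<notin> U)"
      then have zf: "\<exists>t\<in>T. le s t \<and> r t x \<in> U" if "openin X U" "z \<in> U" "s \<in> T" for U s
        using that unfolding ev_net by blast
      obtain U V where UV: "openin X U" "openin X V" "y \<in> U" "z \<in> V" "X closure_of U \<inter> X closure_of V = {}"
        using disjoint_closures[OF Hausdorff regular yX z(1)] z(2) by metis
      obtain a where a: "\<And>s. s \<in> T \<Longrightarrow> a s \<in> T \<and> le s (a s) \<and> r (a s) x \<in> U"
        using yf[OF UV(1,3)] by metis
      obtain b where b: "\<And>s. s \<in> T \<Longrightarrow> b s \<in> T \<and> le s (b s) \<and> r (b s) x \<in> V"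
        using zf[OF UV(2,4)] by metis
      \<comment> \<open>\<open>u (Suc n)\<close> comes from \<open>a\<close> for even
        \<open>n\<close> and from \<open>b\<close> for odd \<open>n\<close>. So the odd terms send
        \<open>x\<close> into \<open>U\<close> and the even terms from index 2 on send it into
        \<open>V\<close>, while sigma-completeness makes the whole sequence of images
        converge.\<close>
      define u where "u = rec_nat s0 (\<lambda>n s. if even n then a s else b s)"
      have uS: "u (Suc n) = (if even n then a (u n) else b (u n))" "u 0 = s0" for n
        by (auto simp: u_def)
      have uT: "u n \<in> T" for n by (induction n) (use uS s0 a b in auto)
      have "increasing_seq T le u" unfolding increasing_seq_def using uT uS a b by simp
      then obtain t where t: "t \<in> G" "\<And>x. x \<in> topspace X \<Longrightarrow> limitin X (\<lambda>n. r (u n) x) (r t x) sequentially"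
        using ex_sup[of u] increasing_seq_superset[OF _ TG] by metis
      have "limitin X ((\<lambda>n. r (u n) x) \<circ> (\<lambda>n. Suc (2 * n))) (r t x) sequentially"
        by (rule limitin_subsequence[OF _ t(2)[OF x]]) (auto simp: strict_mono_def)
      then have "r t x \<in> X closure_of U"
      proof (rule limitin_closedin)
        show "\<forall>\<^sub>F n in sequentially. ((\<lambda>n. r (u n) x) \<circ> (\<lambda>n. Suc (2 * n))) n \<in> X closure_of U"
          using a[OF uT] uS UV(1) by (intro always_eventually allI closure_of_subset[THEN subsetD] openin_subset) auto
      qed auto
      moreover have "limitin X ((\<lambda>n. r (u n) x) \<circ> (\<lambda>n. Suc (Suc (2 * n)))) (r t x) sequentially"
        by (rule limitin_subsequence[OF _ t(2)[OF x]]) (auto simp: strict_mono_def)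
      then have "r t x \<in> X closure_of V"
      proof (rule limitin_closedin)
        show "\<forall>\<^sub>F n in sequentially. ((\<lambda>n. r (u n) x) \<circ> (\<lambda>n. Suc (Suc (2 * n)))) n \<in> X closure_of V"
          using b[OF uT] uS(1)[of "Suc (2 * _)"] UV(2) by (intro always_eventually allI closure_of_subset[THEN subsetD] openin_subset) auto
      qed auto
      ultimately show False using UV(5) by auto
    qed
  qed
  then show ?thesis by blast
qed

lemma rlim_limit: "x \<in> topspace X \<Longrightarrow> limitin X (\<lambda>s. r s x) (rlim T x) (net_filter T le)"
  unfolding rlim_def using ex_rlim by (rule someI_ex)

lemma rlim_unique:
  assumes "limitin X (\<lambda>s. r s x) y (net_filter T le)" "x \<in> topspace X"
  shows "rlim T x = y"
  by (rule limitin_Hausdorff_unique[OF rlim_limit[OF assms(2)] assms(1) net_nontrivial Hausdorff])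

lemma rlim_in [simp]: "x \<in> topspace X \<Longrightarrow> rlim T x \<in> topspace X"
  using rlim_limit limitin_topspace by fast

lemma limit_eq:
  assumes "limitin X (\<lambda>s. r s x) y (net_filter T le)" "continuous_map X X h"
    "s \<in> T" "\<And>t. t \<in> T \<Longrightarrow> le s t \<Longrightarrow> h (r t x) = c" "c \<in> topspace X"
  shows "h y = c"
proof -
  have "limitin X (h \<circ> (\<lambda>s. r s x)) (h y) (net_filter T le)"
    by (rule continuous_map_limit[OF assms(2,1)])
  moreover have "limitin X (h \<circ> (\<lambda>s. r s x)) c (net_filter T le)"
    by (rule limitin_eventually[OF assms(5)]) (use assms(3,4) in \<open>auto intro: ev_netI\<close>)
  ultimately show ?thesis using limitin_Hausdorff_unique[OF _ _ net_nontrivial Hausdorff] by metis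
qed

text \<open>Above \<open>s\<close> the net \<open>r s (r t x)\<close> is constantly
  \<open>r s x\<close>, and \<open>r s\<close> is continuous. Hence \<open>rlim T\<close> keeps all
  coordinates with index in \<open>T\<close>.\<close>

lemma r_rlim [simp]:
  assumes "s \<in> T" "x \<in> topspace X"
  shows "r s (rlim T x) = r s x"
  using limit_eq[OF rlim_limit[OF assms(2)] cont[of s] assms(1), of "r s x"] assms mono2[of s] by auto

lemma image_subset_limrange: "s \<in> T \<Longrightarrow> r s ` topspace X \<subseteq> limrange T"
  unfolding limrange_def by (rule order_trans[OF _ closure_of_subset]) auto

lemma limrange_closed: "closedin X (limrange T)" by (simp add: limrange_def)

lemma limrange_subset: "limrange T \<subseteq> topspace X" by (simp add: limrange_def closure_of_subset_topspace)

lemma limrange_in_space: "x \<in> limrange T \<Longrightarrow> x \<in> topspace X" using limrange_subset by auto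

lemma rlim_in_limrange:
  assumes "x \<in> topspace X"
  shows "rlim T x \<in> limrange T"
proof (rule limitin_closedin[OF rlim_limit[OF assms] limrange_closed])
  obtain s where "s \<in> T" by (rule T_ne)
  then show "\<forall>\<^sub>F s in net_filter T le. r s x \<in> limrange T"
    using image_subset_limrange assms by (intro ev_netI[of s]) auto
qed (rule net_nontrivial)

text \<open>Fixing a dense set is not enough, as continuity of \<open>rlim T\<close> is proved only
  later and from this lemma. If the limit were another point, separate it from \<open>x\<close> by
  \<open>U\<close> and \<open>V\<close> and approximate from the part of the ranges in
  \<open>V\<close>, starting at an index \<open>s0\<close> beyond which \<open>r t x\<close> stays
  in \<open>U\<close>. Then \<open>r t x\<close> for the resulting supremum lies in the closure of
  \<open>V\<close> through \<open>C\<close> and in the closure of \<open>U\<close> through the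
  sequence.\<close>

lemma rlim_limrange:
  assumes x: "x \<in> limrange T"
  shows "rlim T x = x"
proof (rule ccontr)
  assume ne: "rlim T x \<noteq> x"
  have xX: "x \<in> topspace X" using x limrange_in_space by auto
  let ?y = "rlim T x" let ?E = "\<Union>s\<in>T. r s ` topspace X"
  obtain U V where UV: "openin X U" "openin X V" "?y \<in> U" "x \<in> V" "X closure_of U \<inter> X closure_of V = {}"
    using disjoint_closures[OF Hausdorff regular rlim_in[OF xX] xX ne] by metis
  obtain s0 where s0: "s0 \<in> T" "\<And>t. t \<in> T \<Longrightarrow> le s0 t \<Longrightarrow> r t x \<in> U"
    using rlim_limit[OF xX] UV(1,3) unfolding limitin_def ev_net by metis
  have xEV: "x \<in> X closure_of (?E \<inter> V)"
    unfolding in_closure_of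
  proof (intro conjI allI impI)
    fix W assume "x \<in> W \<and> openin X W"
    then have "x \<in> W \<inter> V \<and> openin X (W \<inter> V)" using UV by auto
    then show "\<exists>y. y \<in> ?E \<inter> V \<and> y \<in> W" using x unfolding limrange_def in_closure_of by blast
  qed (fact xX)
  obtain u t C where u: "increasing_seq T le u" "u 0 = s0" "is_sup G le (range u) t"
    "countable C" "C \<subseteq> ?E \<inter> V" "C \<subseteq> r t ` topspace X" "r t x \<in> X closure_of C"
    by (rule countable_approximation[OF TG Tdir Int_lower1 xEV s0(1)])
  have "X closure_of C \<subseteq> X closure_of V" using u(5) by (intro closure_of_mono) auto
  then have "r t x \<in> X closure_of V" using u(7) by auto
  moreover have "r t x \<in> X closure_of U"
  proof (rule limitin_closedin[OF sup_limit[OF increasing_seq_superset[OF u(1) TG] u(3) xX]])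
    have "r (u n) x \<in> U" for n
      using s0(2)[of "u n"] increasing_seq_mono[OF Tpos u(1), of 0 n] u(1,2) by (auto simp: increasing_seq_def)
    then show "\<forall>\<^sub>F n in sequentially. r (u n) x \<in> X closure_of U"
      using UV(1) openin_subset by (intro always_eventually allI closure_of_subset[THEN subsetD]) auto
  qed auto
  ultimately show False using UV(5) by auto
qed

lemma rlim_image: "rlim T ` topspace X = limrange T"
proof
  show "limrange T \<subseteq> rlim T ` topspace X"
  proof
    fix x assume "x \<in> limrange T"
    then show "x \<in> rlim T ` topspace X"
      using rlim_limrange[of x] limrange_in_space[of x] by (intro image_eqI[of _ _ x]) auto
  qed
qed (use rlim_in_limrange in auto)

lemma rlim_r [simp]: "s \<in> T \<Longrightarrow> x \<in> topspace X \<Longrightarrow> rlim T (r s x) = r s x"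
  using rlim_limrange image_subset_limrange by blast

lemma rlim_eqI:
  assumes "x \<in> topspace X" "y \<in> topspace X" "\<And>s. s \<in> T \<Longrightarrow> r s x = r s y"
  shows "rlim T x = rlim T y"
proof (rule rlim_unique[OF _ assms(1)])
  obtain s where "s \<in> T" by (rule T_ne)
  then have "\<forall>\<^sub>F s in net_filter T le. r s y = r s x" using assms(3) by (intro ev_netI[of s]) auto
  then show "limitin X (\<lambda>s. r s x) (rlim T y) (net_filter T le)"
    using rlim_limit[OF assms(2)] by (rule limitin_transform_eventually)
qed

lemma limrange_eqI:
  assumes "x \<in> limrange T" "y \<in> limrange T" "\<And>s. s \<in> T \<Longrightarrow> r s x = r s y"
  shows "x = y"
  using rlim_eqI[of x y] rlim_limrange assms limrange_in_space by auto

text \<open>Another point of \<open>limrange T\<close> differs from \<open>l\<close> in some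
  coordinate \<open>r s\<close>, and the open set where \<open>r s\<close> differs from
  \<open>r s l\<close> is eventually avoided; a point outside \<open>limrange T\<close> has the
  complement as such a set. This is the convergence criterion behind (R3).\<close>

lemma limitin_limrangeI:
  assumes l: "l \<in> limrange T" and ev: "eventually (\<lambda>i. f i \<in> limrange T) F"
    and evr: "\<And>s. s \<in> T \<Longrightarrow> eventually (\<lambda>i. r s (f i) = r s l) F"
  shows "limitin X f l F"
proof (rule limitin_compactI[OF compact])
  show "l \<in> topspace X" using l limrange_in_space by auto
  show "\<forall>\<^sub>F i in F. f i \<in> topspace X" using ev by eventually_elim (rule limrange_in_space)
  fix y assume y: "y \<in> topspace X" "y \<noteq> l"
  show "\<exists>U. openin X U \<and> y \<in> U \<and> (\<forall>\<^sub>F i in F. f i \<notin> U)"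
  proof (cases "y \<in> limrange T")
    case True
    then obtain s where s: "s \<in> T" "r s y \<noteq> r s l" using limrange_eqI[OF True l] y by auto
    have "closedin X {z \<in> topspace X. r s z \<in> {r s l}}"
      using s l limrange_in_space by (intro closedin_continuous_map_preimage[OF cont] closedin_Hausdorff_singleton Hausdorff) auto
    then have "openin X (topspace X - {z \<in> topspace X. r s z \<in> {r s l}})" by blast
    moreover have "\<forall>\<^sub>F i in F. f i \<notin> topspace X - {z \<in> topspace X. r s z \<in> {r s l}}"
      using evr[OF s(1)] by eventually_elim auto
    ultimately show ?thesis using y s by blast
  next
    case False
    have "openin X (topspace X - limrange T)" using limrange_closed by blast
    moreover have "\<forall>\<^sub>F i in F. f i \<notin> topspace X - limrange T" using ev by eventually_elim auto
    ultimately show ?thesis using y False by blast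
  qed
qed

lemma rlim_continuous: "continuous_map X X (rlim T)"
proof (rule closed_graph_imp_continuous_map[OF compact])
  let ?Z = "prod_topology X X"
  obtain s0 where s0: "s0 \<in> T" by (rule T_ne)
  have "{(x, y). x \<in> topspace X \<and> y = rlim T x} =
      \<Inter>(insert (topspace X \<times> limrange T) ((\<lambda>s. {p \<in> topspace ?Z. r s (fst p) = r s (snd p)}) ` T))" (is "?A = ?B")
  proof
    show "?A \<subseteq> ?B" using rlim_in_limrange by auto
    show "?B \<subseteq> ?A"
    proof
      fix p assume p: "p \<in> ?B"
      obtain x y where xy: "p = (x, y)" by fastforce
      have "x \<in> topspace X" "y \<in> limrange T" "\<And>s. s \<in> T \<Longrightarrow> r s x = r s y" using p xy by auto
      then have "rlim T x = y" using rlim_eqI[of x y] rlim_limrange[of y] limrange_in_space by auto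
      then show "p \<in> ?A" using xy \<open>x \<in> topspace X\<close> by auto
    qed
  qed
  moreover have "closedin ?Z {p \<in> topspace ?Z. r s (fst p) = r s (snd p)}" if "s \<in> T" for s
    by (rule closedin_kernel_pair[OF Hausdorff cont[OF T_G[OF that]]])
  moreover have "closedin ?Z (topspace X \<times> limrange T)"
    using limrange_closed by (simp add: closedin_prod_Times_iff)
  ultimately show "closedin ?Z {(x, y). x \<in> topspace X \<and> y = rlim T x}"
    by (simp only:) (intro closedin_Inter; auto)
qed auto

lemma rlim_retraction: "continuous_retraction X (rlim T)"
  unfolding continuous_retraction_def using rlim_continuous rlim_limrange[OF rlim_in_limrange] by auto

text \<open>Compactness of the square gives an \<open>s\<close> such that points with equal image
  under \<open>r s\<close> have limits whose values under \<open>f\<close> differ by less than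
  \<open>e\<close>. For \<open>t\<close> above \<open>s\<close> this applies to the pair of
  \<open>r t x\<close> and \<open>x\<close>, and \<open>rlim T\<close> fixes
  \<open>r t x\<close>.\<close>

lemma uniform_limit:
  fixes f :: "'a \<Rightarrow> real" and e :: real
  assumes f: "continuous_map X euclideanreal f" and e: "e > 0"
  shows "\<exists>s\<in>T. \<forall>t\<in>T. le s t \<longrightarrow> (\<forall>x\<in>topspace X. \<bar>f (r t x) - f (rlim T x)\<bar> < e)"
proof -
  let ?Z = "prod_topology X X"
  define d where "d p = \<bar>f (rlim T (fst p)) - f (rlim T (snd p))\<bar>" for p
  define C where "C s = {p \<in> topspace ?Z. r s (fst p) = r s (snd p)} \<inter> {p \<in> topspace ?Z. d p \<in> {e..}}" for s
  have "\<exists>s\<in>T. C s = {}"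
  proof (rule compact_directed_closed_empty[OF _ Tdir Tpos])
    show "compact_space ?Z" using compact by (simp add: compact_space_prod_topology)
    show "closedin ?Z (C s)" if "s \<in> T" for s
      unfolding C_def
    proof (intro closedin_Int closedin_kernel_pair[OF Hausdorff cont[OF T_G[OF that]]])
      have fl: "continuous_map X euclideanreal (\<lambda>x. f (rlim T x))"
        using continuous_map_compose[OF rlim_continuous f] by (simp add: o_def)
      have "continuous_map ?Z euclideanreal d"
        unfolding d_def
        using continuous_map_compose[OF continuous_map_fst fl] continuous_map_compose[OF continuous_map_snd fl]
        by (intro continuous_intros) (simp_all add: o_def)
      then show "closedin ?Z {p \<in> topspace ?Z. d p \<in> {e..}}"
        by (rule closedin_continuous_map_preimage) simp
    qed
    show "C t \<subseteq> C s" if st: "s \<in> T" "t \<in> T" "le s t" for s t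
    proof
      fix p assume p: "p \<in> C t"
      then have "fst p \<in> topspace X" "snd p \<in> topspace X" by (auto simp: C_def)
      then have "r s (fst p) = r s (snd p)"
        using p mono2[of s t "fst p"] mono2[of s t "snd p"] st by (auto simp: C_def)
      then show "p \<in> C s" using p by (auto simp: C_def)
    qed
    show "(\<Inter>s\<in>T. C s) = {}"
    proof (rule ccontr)
      assume "(\<Inter>s\<in>T. C s) \<noteq> {}"
      then obtain p where p: "\<And>s. s \<in> T \<Longrightarrow> p \<in> C s" by auto
      obtain s0 where s0: "s0 \<in> T" by (rule T_ne)
      have "rlim T (fst p) = rlim T (snd p)"
        using p p[OF s0] by - (rule rlim_eqI, auto simp: C_def)
      then show False using p[OF s0] e by (auto simp: C_def d_def)
    qed
  qed
  then obtain s where s: "s \<in> T" "C s = {}" by auto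
  show ?thesis
  proof (intro bexI[OF _ s(1)] ballI impI)
    fix t x assume t: "t \<in> T" "le s t" "x \<in> topspace X"
    have "(r t x, x) \<notin> C s" using s by auto
    then show "\<bar>f (r t x) - f (rlim T x)\<bar> < e"
      using t s(1) mono2[of s t x] by (auto simp: C_def d_def)
  qed
qed

text \<open>The fibres of \<open>r s\<close> through \<open>y\<close> within
  \<open>limrange T\<close> decrease to \<open>y\<close> alone as \<open>s\<close> increases, so by
  compactness one of them is inside \<open>V\<close>. This localises neighbourhoods for the weight
  estimate.\<close>

lemma limrange_nbhd:
  assumes y: "y \<in> limrange T" "y \<in> V" "openin X V"
  shows "\<exists>s\<in>T. \<forall>z\<in>limrange T. r s z = r s y \<longrightarrow> z \<in> V"
proof -
  have yX: "y \<in> topspace X" using y limrange_in_space by auto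
  define C where "C s = (limrange T - V) \<inter> {z \<in> topspace X. r s z \<in> {r s y}}" for s
  have "\<exists>s\<in>T. C s = {}"
  proof (rule compact_directed_closed_empty[OF compact Tdir Tpos])
    show "closedin X (C s)" if "s \<in> T" for s
      unfolding C_def
      using that yX y limrange_closed
      by (intro closedin_Int closedin_diff closedin_continuous_map_preimage[OF cont] closedin_Hausdorff_singleton Hausdorff) auto
    show "C t \<subseteq> C s" if st: "s \<in> T" "t \<in> T" "le s t" for s t
    proof
      fix z assume z: "z \<in> C t"
      then have "r s z = r s y"
        using mono2[of s t z] mono2[of s t y] st yX by (auto simp: C_def)
      then show "z \<in> C s" using z by (auto simp: C_def)
    qed
    show "(\<Inter>s\<in>T. C s) = {}"
    proof (rule ccontr)
      assume "(\<Inter>s\<in>T. C s) \<noteq> {}"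
      then obtain z where z: "\<And>s. s \<in> T \<Longrightarrow> z \<in> C s" by auto
      obtain s0 where s0: "s0 \<in> T" by (rule T_ne)
      have "r s z = r s y" if "s \<in> T" for s using z[OF that] by (simp add: C_def)
      then have "z = y" using z[OF s0] y(1) by - (rule limrange_eqI, simp_all add: C_def)
      then show False using z[OF s0] y by (auto simp: C_def)
    qed
  qed
  then obtain s where s: "s \<in> T" "C s = {}" by auto
  then show ?thesis using limrange_in_space by (intro bexI[of _ s]) (auto simp: C_def)
qed

section \<open>The sigma-closure of the index set and the skeleton it induces on the range\<close>

abbreviation "TS \<equiv> sigma_closure G le T"

lemma TS_G: "t \<in> TS \<Longrightarrow> t \<in> G" using sigma_closure_subset[OF TG] by auto

text \<open>Both identities pass to suprema of increasing sequences: the first because the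
  retractions converge at \<open>x\<close> and at \<open>rlim T x\<close>, the second by continuity
  of \<open>rlim T\<close>. Together they give (R9).\<close>

lemma TS_fix:
  assumes "t \<in> TS" "x \<in> topspace X"
  shows "r t (rlim T x) = r t x \<and> rlim T (r t x) = r t x"
  using assms(1) TG
proof (induction rule: sigma_closure_induct)
  case (base s)
  then show ?case using assms(2) by simp
next
  case (sup s t)
  have tG: "t \<in> G" using sup(2) by (auto simp: is_sup_def)
  have lx: "limitin X (\<lambda>n. r (s n) x) (r t x) sequentially"
    using sup_limit[OF sup(1,2) assms(2)] .
  have "limitin X (\<lambda>n. r (s n) (rlim T x)) (r t (rlim T x)) sequentially"
    using sup_limit[OF sup(1,2)] assms(2) by simp
  then have "limitin X (\<lambda>n. r (s n) x) (r t (rlim T x)) sequentially" using sup(3) by simp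
  then have 1: "r t (rlim T x) = r t x"
    using lx limitin_Hausdorff_unique[OF _ _ trivial_limit_sequentially Hausdorff] by metis
  have "limitin X (rlim T \<circ> (\<lambda>n. r (s n) x)) (rlim T (r t x)) sequentially"
    by (rule continuous_map_limit[OF rlim_continuous lx])
  then have "limitin X (\<lambda>n. r (s n) x) (rlim T (r t x)) sequentially" using sup(3) by (simp add: o_def)
  then have "rlim T (r t x) = r t x"
    using lx limitin_Hausdorff_unique[OF _ _ trivial_limit_sequentially Hausdorff] by metis
  with 1 show ?case by simp
qed

text \<open>Suprema of unrelated sequences are hard to compare directly. This reduces each of them
  to countably many members of \<open>T\<close>, so that the directedness of \<open>TS\<close>
  follows from a common bound of two countable sets.\<close>

lemma TS_dominated:
  assumes "t \<in> TS"
  shows "\<exists>C. countable C \<and> C \<subseteq> T \<and> (\<forall>u\<in>G. (\<forall>c\<in>C. le c u) \<longrightarrow> le t u)"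
  using assms TG
proof (induction rule: sigma_closure_induct)
  case (base s)
  then show ?case by (intro exI[of _ "{s}"]) auto
next
  case (sup s t)
  then obtain C where C: "\<And>n. countable (C n)" "\<And>n. C n \<subseteq> T"
    "\<And>n u. u \<in> G \<Longrightarrow> (\<forall>c\<in>C n. le c u) \<Longrightarrow> le (s n) u" by metis
  have "le t u" if u: "u \<in> G" "\<forall>c\<in>(\<Union>n. C n). le c u" for u
    using sup(2) C(3)[OF u(1)] u by (auto simp: is_sup_def)
  then show ?case using C(1,2) by (intro exI[of _ "\<Union>n. C n"]) auto
qed

lemma countable_bound:
  assumes "countable C" "C \<subseteq> T"
  shows "\<exists>t\<in>TS. \<forall>c\<in>C. le c t"
proof -
  obtain u where u: "increasing_seq T le u" "\<forall>c\<in>C. \<exists>m. le c (u m)"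
    using dominating_seq[OF TG Tdir assms] by auto
  obtain t where t: "t \<in> G" "is_sup G le (range u) t" "\<And>n. le (u n) t"
    using ex_sup[OF increasing_seq_superset[OF u(1) TG]] by metis
  have "t \<in> TS"
    using sigma_closure_sup[OF _ t(2)] u(1) sigma_closure_superset[of T G le] by (auto simp: increasing_seq_def)
  moreover have "le c t" if c: "c \<in> C" for c
  proof -
    obtain m where "le c (u m)" using u(2) c by auto
    moreover have "c \<in> G" "u m \<in> G" using c assms(2) u(1) TG by (auto simp: increasing_seq_def)
    ultimately show ?thesis using le_trans t by blast
  qed
  ultimately show ?thesis by blast
qed

lemma TS_directed: "up_directed TS le"
  unfolding up_directed_def
proof (intro conjI ballI)
  show "TS \<noteq> {}" using Tdir sigma_closure_superset[of T G le] by (auto simp: up_directed_def)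
next
  fix s t assume st: "s \<in> TS" "t \<in> TS"
  obtain C where C: "countable C" "C \<subseteq> T" "\<forall>u\<in>G. (\<forall>c\<in>C. le c u) \<longrightarrow> le s u" using TS_dominated[OF st(1)] by auto
  obtain C' where C': "countable C'" "C' \<subseteq> T" "\<forall>u\<in>G. (\<forall>c\<in>C'. le c u) \<longrightarrow> le t u" using TS_dominated[OF st(2)] by auto
  obtain u where "u \<in> TS" "\<forall>c\<in>C \<union> C'. le c u" using countable_bound[of "C \<union> C'"] C C' by auto
  then show "\<exists>u\<in>TS. le s u \<and> le t u" using C(3) C'(3) TS_G by (intro bexI[of _ u]) auto
qed

lemma TS_image: "t \<in> TS \<Longrightarrow> r t ` topspace X \<subseteq> limrange T"
  using TS_fix rlim_in_limrange TS_G in_space by (metis image_subsetI)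

lemma TS_image_limrange:
  assumes "t \<in> TS"
  shows "r t ` limrange T = r t ` topspace X"
proof
  show "r t ` topspace X \<subseteq> r t ` limrange T"
  proof
    fix y assume "y \<in> r t ` topspace X"
    then obtain x where "x \<in> topspace X" "y = r t x" by auto
    then show "y \<in> r t ` limrange T"
      using TS_fix[OF assms, of x] rlim_in_limrange[of x] by (intro image_eqI[of _ _ "rlim T x"]) auto
  qed
qed (use limrange_subset in auto)

lemma sub_TS: "subskeleton X G le r TS"
  by unfold_locales (use TS_directed TS_G in auto)

text \<open>Both points lie in \<open>limrange T\<close> and have the same coordinates in
  \<open>T\<close>. It yields the convergence of the net over \<open>TS\<close> to the identity on
  \<open>limrange T\<close>.\<close>

lemma rlim_TS:
  assumes x: "x \<in> topspace X"
  shows "rlim TS x = rlim T x"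
proof -
  interpret S: subskeleton X G le r TS by (rule sub_TS)
  have "limrange TS \<subseteq> limrange T"
    unfolding limrange_def[of TS] by (rule closure_of_minimal[OF _ limrange_closed]) (use TS_image in auto)
  then have "rlim TS x \<in> limrange T" using S.rlim_in_limrange[OF x] by auto
  moreover have "r s (rlim TS x) = r s (rlim T x)" if "s \<in> T" for s
    using that x sigma_closure_superset[of T G le] by auto
  ultimately show ?thesis using rlim_in_limrange[OF x] by - (rule limrange_eqI, auto)
qed

lemma limrange_skeleton: "retractional_skeleton (subtopology X (limrange T)) TS le r"
proof -
  let ?Y = "subtopology X (limrange T)"
  have tY: "topspace ?Y = limrange T" using limrange_subset by auto
  have pos: "poset_on TS le" using poset_on_subset[OF poset] TS_G by blast
  \<comment> \<open>Convergence along sequences is known for suprema taken in \<open>G\<close>. Such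
    a supremum lies in \<open>TS\<close>, so by antisymmetry it equals the one taken in
    \<open>TS\<close>.\<close>
  have supG: "is_sup G le (range s) t" if s: "increasing_seq TS le s" "is_sup TS le (range s) t" for s t
  proof -
    have sG: "increasing_seq G le s" using s(1) TS_G by (auto simp: increasing_seq_def)
    obtain t' where t': "t' \<in> G" "is_sup G le (range s) t'" using ex_sup[OF sG] by metis
    have t'S: "t' \<in> TS" using sigma_closure_sup[OF s(1) t'(2)] .
    have "le t t'" using s(2) t'(2) t'S by (auto simp: is_sup_def)
    moreover have "le t' t" using s(2) t'(2) TS_G by (auto simp: is_sup_def)
    ultimately have "t = t'" using s(2) t'(1) TS_G poset unfolding poset_on_def is_sup_def by (meson antisymp_onD)
    then show ?thesis using t' by simp
  qed
  have retr: "continuous_retraction ?Y (r s)" if "s \<in> TS" for s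
    unfolding continuous_retraction_def tY
  proof (intro conjI ballI)
    show "continuous_map ?Y ?Y (r s)"
      using cont[OF TS_G[OF that]] TS_image[OF that] limrange_subset
      by (auto simp: continuous_map_in_subtopology intro: continuous_map_from_subtopology)
    show "r s (r s x) = r s x" if "x \<in> limrange T" for x
      using idem[OF TS_G[OF \<open>s \<in> TS\<close>]] limrange_in_space that by auto
  qed
  have sub: "subtopology ?Y (r s ` topspace ?Y) = subtopology X (r s ` topspace X)" if "s \<in> TS" for s
    unfolding tY TS_image_limrange[OF that] subtopology_subtopology using TS_image[OF that] by (simp add: inf.absorb2)
  show ?thesis
    unfolding retractional_skeleton_def
  proof (intro conjI ballI allI impI)
    show "tychonoff_space ?Y"
      using skel completely_regular_space_subtopology Hausdorff_space_subtopology
      unfolding retractional_skeleton_def tychonoff_space_def by auto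
    show "compact_space ?Y"
      using closedin_compact_space[OF compact limrange_closed] by (simp add: compact_space_subtopology)
    show "poset_on TS le" "up_directed TS le" by (fact pos TS_directed)+
    show "sigma_complete TS le"
      unfolding sigma_complete_def
    proof (intro allI impI)
      fix s assume s: "increasing_seq TS le s"
      have sG: "increasing_seq G le s" using s TS_G by (auto simp: increasing_seq_def)
      obtain t where t: "t \<in> G" "is_sup G le (range s) t" using ex_sup[OF sG] by metis
      have "is_sup TS le (range s) t" using t sigma_closure_sup[OF s t(2)] TS_G by (auto simp: is_sup_def)
      then show "\<exists>t. is_sup TS le (range s) t" by blast
    qed
    fix s assume s: "s \<in> TS"
    show "continuous_retraction ?Y (r s)" using retr[OF s] .
    show "metrizable_space (subtopology ?Y (r s ` topspace ?Y))" "compact_space (subtopology ?Y (r s ` topspace ?Y))"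
      unfolding sub[OF s] using skel TS_G[OF s] unfolding retractional_skeleton_def by blast+
  next
    fix s t x assume "s \<in> TS" "t \<in> TS" "le s t" "x \<in> topspace ?Y"
    then show "r s x = r t (r s x)" "r s x = r s (r t x)"
      using mono1[of s t x] mono2[of s t x] TS_G limrange_in_space tY by auto
  next
    fix s t x assume st: "increasing_seq TS le s \<and> is_sup TS le (range s) t" "x \<in> topspace ?Y"
    have x: "x \<in> topspace X" "x \<in> limrange T" using st tY limrange_in_space by auto
    have sG: "increasing_seq G le s" using st TS_G by (auto simp: increasing_seq_def)
    have "t \<in> TS" "\<And>n. s n \<in> TS" using st by (auto simp: is_sup_def increasing_seq_def)
    then have "r t x \<in> limrange T" "\<And>n. r (s n) x \<in> limrange T" using TS_image x(1) by blast+
    moreover have "limitin X (\<lambda>n. r (s n) x) (r t x) sequentially" using sup_limit[OF sG supG x(1)] st by auto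
    ultimately show "limitin ?Y (\<lambda>n. r (s n) x) (r t x) sequentially"
      by (auto simp: limitin_subtopology)
  next
    fix x assume "x \<in> topspace ?Y"
    then have x: "x \<in> topspace X" "x \<in> limrange T" using tY limrange_in_space by auto
    interpret S: subskeleton X G le r TS by (rule sub_TS)
    have "limitin X (\<lambda>s. r s x) x (net_filter TS le)"
      using S.rlim_limit[OF x(1)] rlim_TS[OF x(1)] rlim_limrange[OF x(2)] by simp
    moreover obtain s where "s \<in> TS" using TS_directed by (auto simp: up_directed_def)
    then have "\<forall>\<^sub>F s in net_filter TS le. r s x \<in> limrange T"
      using TS_image x(1) by (intro S.ev_netI[of s]) auto
    ultimately show "limitin ?Y (\<lambda>s. r s x) x (net_filter TS le)" using x(2) by (auto simp: limitin_subtopology)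
  qed
qed

text \<open>
  Points of the induced set are countably tight: \<open>countable_approximation\<close> for the whole index set,
  started at an index fixing \<open>y\<close>, shows that \<open>y\<close> lies in the closure of countably many points.
\<close>

lemma limrange_induced:
  assumes y: "y \<in> limrange T" "y \<in> induced_set X G r"
  shows "\<exists>t\<in>TS. r t y = y"
proof -
  obtain v where v: "v \<in> G" "r v y = y" using y(2) by (auto simp: induced_set_def)
  have yX: "y \<in> topspace X" using y limrange_in_space by auto
  let ?E = "\<Union>s\<in>T. r s ` topspace X"
  have E: "?E \<subseteq> (\<Union>s\<in>G. r s ` topspace X)" using TG by auto
  have yE: "y \<in> X closure_of ?E" using y(1) by (simp add: limrange_def)
  obtain u t C where u: "increasing_seq G le u" "u 0 = v" "is_sup G le (range u) t"
    "countable C" "C \<subseteq> ?E" "C \<subseteq> r t ` topspace X" "r t y \<in> X closure_of C"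
    by (rule countable_approximation[OF subset_refl directed E yE v(1)])
  have tG: "t \<in> G" "le v t" using u(2,3) by (auto simp: is_sup_def)
  then have "r t y = y" using mono1[of v t y] v yX by auto
  then have yC: "y \<in> X closure_of C" using u(7) by simp
  have "\<forall>c\<in>C. \<exists>s. s \<in> T \<and> c \<in> r s ` topspace X" using u(5) by blast
  then obtain S where S: "\<forall>c\<in>C. S c \<in> T \<and> c \<in> r (S c) ` topspace X" using bchoice[of C] by metis
  \<comment> \<open>\<open>w\<close> bounds indices fixing the points of \<open>C\<close>, so the
    range of \<open>r w\<close> contains \<open>C\<close>; being closed, it also contains
    \<open>y\<close>.\<close>
  then obtain w where w: "w \<in> TS" "\<forall>c\<in>C. le (S c) w"
    using countable_bound[of "S ` C"] u(4) by auto
  have "C \<subseteq> r w ` topspace X"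
  proof
    fix c assume c: "c \<in> C"
    then have "S c \<in> G" "c \<in> r (S c) ` topspace X" using S TG by auto
    then have "c \<in> topspace X" "r (S c) c = c" using image_eq by auto
    then have "r w c = c" using mono1[of "S c" w c] S c w TS_G[OF w(1)] by auto
    then show "c \<in> r w ` topspace X" using \<open>c \<in> topspace X\<close> by (metis image_eqI)
  qed
  then have "y \<in> r w ` topspace X"
    using yC closure_of_minimal[OF _ image_closed[OF TS_G[OF w(1)]]] by blast
  then show ?thesis using w(1) image_eq[OF TS_G[OF w(1)]] by auto
qed

lemma induced_set_limrange: "induced_set (subtopology X (limrange T)) TS r = induced_set X G r \<inter> limrange T"
proof -
  have tY: "topspace (subtopology X (limrange T)) = limrange T" using limrange_subset by auto
  have "induced_set (subtopology X (limrange T)) TS r = (\<Union>t\<in>TS. r t ` topspace X)"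
    unfolding induced_set_def tY using TS_image_limrange by auto
  also have "\<dots> = induced_set X G r \<inter> limrange T"
  proof
    show "(\<Union>t\<in>TS. r t ` topspace X) \<subseteq> induced_set X G r \<inter> limrange T"
      using TS_image TS_G by (auto simp: induced_set_def)
    show "induced_set X G r \<inter> limrange T \<subseteq> (\<Union>t\<in>TS. r t ` topspace X)"
    proof
      fix y assume "y \<in> induced_set X G r \<inter> limrange T"
      then obtain t where "t \<in> TS" "r t y = y" "y \<in> topspace X" using limrange_induced limrange_in_space by auto
      then show "y \<in> (\<Union>t\<in>TS. r t ` topspace X)" by (metis UN_I image_eqI)
    qed
  qed
  finally show ?thesis .
qed

end

context skeleton
begin

lemma sub_G: "subskeleton X G le r G"
  by unfold_locales (use directed in auto)

lemma rlim_G: "x \<in> topspace X \<Longrightarrow> rlim G x = x"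
  using subskeleton.rlim_unique[OF sub_G net_limit] by simp

text \<open>Here \<open>T\<close> is the whole index set and \<open>rlim\<close> is the identity.
  Uniform convergence provides for each \<open>n\<close> an index beyond which the error is below
  \<open>1/(n+1)\<close>, and at a common bound of these countably many indices the error is
  zero.\<close>

lemma factor_through:
  fixes f :: "'a \<Rightarrow> real"
  assumes f: "continuous_map X euclideanreal f"
  shows "\<exists>s\<in>G. \<forall>x\<in>topspace X. f (r s x) = f x"
proof -
  interpret subskeleton X G le r G by (rule sub_G)
  have "\<forall>n. \<exists>s\<in>G. \<forall>t\<in>G. le s t \<longrightarrow> (\<forall>x\<in>topspace X. \<bar>f (r t x) - f x\<bar> < inverse (Suc n))"
    using uniform_limit[OF f, of "inverse (Suc _)"] rlim_G by simp
  then obtain s where s: "\<And>n. s n \<in> G"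
    "\<And>n t x. t \<in> G \<Longrightarrow> le (s n) t \<Longrightarrow> x \<in> topspace X \<Longrightarrow> \<bar>f (r t x) - f x\<bar> < inverse (Suc n)"
    by metis
  obtain t where t: "t \<in> TS" "\<forall>c\<in>range s. le c t"
    using countable_bound[of "range s"] s(1) by auto
  have "f (r t x) = f x" if x: "x \<in> topspace X" for x
  proof (rule ccontr)
    assume "f (r t x) \<noteq> f x"
    then have "\<bar>f (r t x) - f x\<bar> > 0" by simp
    then obtain n where "inverse (real (Suc n)) < \<bar>f (r t x) - f x\<bar>" using reals_Archimedean by blast
    then show False using s(2)[OF TS_G[OF t(1)] _ x, of n] t(2) by auto
  qed
  then show ?thesis using TS_G[OF t(1)] by blast
qed

end

section \<open>Sets, ordinals and cardinals\<close>

text \<open>The bridge from HOL sets to sets of the universe: \<open>vset A\<close> has the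
  extension \<open>A\<close> exactly in this case.\<close>

definition vsmall :: "'v::set_universe set \<Rightarrow> bool" where
  "vsmall A \<longleftrightarrow> (\<exists>x. elts x = A)"

lemma elts_inject [simp]: "elts x = elts y \<longleftrightarrow> x = y"
  using extensionality by auto

lemma elts_vset [simp]: "vsmall A \<Longrightarrow> elts (vset A) = A"
  unfolding vsmall_def vset_def by (rule theI') (metis extensionality)

lemma vset_elts [simp]: "vset (elts x) = x"
  by (rule extensionality) (auto simp: vsmall_def)

lemma vsmall_elts [simp]: "vsmall (elts x)" by (auto simp: vsmall_def)

lemma vsmall_subset:
  assumes "vsmall B" "A \<subseteq> B"
  shows "vsmall A"
proof -
  obtain b where b: "elts b = B" using assms(1) by (auto simp: vsmall_def)
  obtain z where "elts z = {y \<in> elts b. y \<in> A}" using separation by metis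
  then have "elts z = A" using assms(2) b by auto
  then show ?thesis by (auto simp: vsmall_def)
qed

lemma vsmall_empty [simp]: "vsmall {}"
  by (rule vsmall_subset[OF vsmall_elts]) simp

lemma vsmall_pair [simp]: "vsmall {x, y}"
  using pairing unfolding vsmall_def by blast

lemma vsmall_single [simp]: "vsmall {x}"
  using vsmall_pair[of x x] by simp

lemma vsmall_image:
  fixes F :: "'v::set_universe \<Rightarrow> 'v"
  assumes "vsmall A"
  shows "vsmall (F ` A)"
proof -
  obtain a where "elts a = A" using assms by (auto simp: vsmall_def)
  then show ?thesis using replacement[of F a] by (auto simp: vsmall_def)
qed

lemma vsmall_UN:
  fixes F :: "'v::set_universe \<Rightarrow> 'v set"
  assumes "vsmall A" "\<And>a. a \<in> A \<Longrightarrow> vsmall (F a)"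
  shows "vsmall (\<Union>a\<in>A. F a)"
proof -
  have z: "elts (vset ((\<lambda>a. vset (F a)) ` A)) = (\<lambda>a. vset (F a)) ` A"
    by (rule elts_vset[OF vsmall_image[OF assms(1)]])
  obtain w where "elts w = (\<Union>y\<in>elts (vset ((\<lambda>a. vset (F a)) ` A)). elts y)" using union by metis
  then have "elts w = (\<Union>a\<in>A. F a)" using z assms(2) by auto
  then show ?thesis unfolding vsmall_def by metis
qed

lemma vsmall_Un: "vsmall A \<Longrightarrow> vsmall B \<Longrightarrow> vsmall (A \<union> B)"
proof -
  assume A: "vsmall A" "vsmall B"
  have "vsmall (\<Union>a\<in>{vset A, vset B}. elts a)" by (rule vsmall_UN) auto
  then show "vsmall (A \<union> B)" using A by simp
qed

lemma vsmall_insert [simp]: "vsmall A \<Longrightarrow> vsmall (insert x A)"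
  using vsmall_Un[OF vsmall_single] by fastforce

lemma vsmall_Pow: "vsmall {y. elts y \<subseteq> elts x}"
  using powerset unfolding vsmall_def by metis

lemma elts_vzero [simp]: "elts vzero = {}" by (simp add: vzero_def)

lemma elts_vsucc [simp]: "elts (vsucc x) = insert x (elts x)" by (simp add: vsucc_def)

lemma mem_irrefl [simp]: "x \<notin> elts x"
proof
  assume x: "x \<in> elts x"
  obtain z where z: "elts z = {x}" using vsmall_single unfolding vsmall_def by blast
  show False using foundation[of z] z x by auto
qed

lemma mem_asym: "x \<in> elts y \<Longrightarrow> y \<notin> elts x"
proof
  assume x: "x \<in> elts y" "y \<in> elts x"
  obtain z where z: "elts z = {x, y}" using vsmall_pair unfolding vsmall_def by blast
  show False using foundation[of z] z x by auto
qed

lemma vpair_inject [simp]: "vpair x y = vpair a b \<longleftrightarrow> x = a \<and> y = b"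
proof
  assume "vpair x y = vpair a b"
  then have "elts (vpair x y) = elts (vpair a b)" by simp
  then have e: "{vset {x}, vset {x, y}} = {vset {a}, vset {a, b}}" by (simp add: vpair_def)
  have "vset A = vset B \<Longrightarrow> vsmall A \<Longrightarrow> vsmall B \<Longrightarrow> A = B" for A B :: "'a set" by (metis elts_vset)
  then have i: "vset {x} = vset {a} \<longleftrightarrow> {x} = {a}" "vset {x} = vset {a, b} \<longleftrightarrow> {x} = {a, b}"
    "vset {x, y} = vset {a} \<longleftrightarrow> {x, y} = {a}" "vset {x, y} = vset {a, b} \<longleftrightarrow> {x, y} = {a, b}" for x y a b :: 'a
    by (metis vsmall_pair vsmall_single)+
  show "x = a \<and> y = b" using e unfolding doubleton_eq_iff i by auto
qed simp

lemma elts_vpair: "elts (vpair x y) = {vset {x}, vset {x, y}}" by (simp add: vpair_def)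

lemma elts_vgraph: "elts (vgraph (elts K) f) = (\<lambda>x. vpair x (f x)) ` elts K"
  unfolding vgraph_def using vsmall_image[OF vsmall_elts, of "\<lambda>x. vpair x (f x)" K]
  by (simp add: Setcompr_eq_image)

lemma vapp_eq:
  assumes "vfunction f A B" "x \<in> A"
  shows "vpair x y \<in> elts f \<longleftrightarrow> y = vapp f x"
proof -
  have "\<exists>!y. vpair x y \<in> elts f" using assms unfolding vfunction_def by blast
  then show ?thesis unfolding vapp_def by (metis (mono_tags, lifting) the1_equality)
qed

lemma vapp_in:
  assumes "vfunction f A B" "x \<in> A"
  shows "vapp f x \<in> B"
  using vapp_eq[OF assms, of "vapp f x"] assms unfolding vfunction_def by auto

section \<open>Von Neumann ordinals and cardinals\<close>

lemma vord_trans: "vord \<alpha> \<Longrightarrow> x \<in> elts \<alpha> \<Longrightarrow> elts x \<subseteq> elts \<alpha>"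
  by (auto simp: vord_def)

lemma vord_mem: "vord \<alpha> \<Longrightarrow> x \<in> elts \<alpha> \<Longrightarrow> vord x"
  unfolding vord_def by blast

lemma vord_zero [simp]: "vord vzero" by (simp add: vord_def)

lemma vord_succ [simp]: "vord \<alpha> \<Longrightarrow> vord (vsucc \<alpha>)"
  unfolding vord_def by auto

text \<open>Foundation applied to the members of \<open>vsucc \<alpha>\<close> with property
  \<open>P\<close>; by transitivity a minimal one among these has no smaller ordinal with
  \<open>P\<close> at all.\<close>

lemma vord_least:
  assumes "vord \<alpha>" "P \<alpha>"
  obtains \<beta> where "vord \<beta>" "P \<beta>" "\<And>\<gamma>. \<gamma> \<in> elts \<beta> \<Longrightarrow> \<not> P \<gamma>" "\<beta> \<in> elts (vsucc \<alpha>)"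
proof -
  obtain z where z: "elts z = {y \<in> elts (vsucc \<alpha>). P y}" using separation by metis
  then have "\<alpha> \<in> elts z" using assms by simp
  then obtain \<beta> where b: "\<beta> \<in> elts z" "elts \<beta> \<inter> elts z = {}" using foundation[of z] by auto
  have ord: "vord (vsucc \<alpha>)" "\<beta> \<in> elts (vsucc \<alpha>)" "P \<beta>" using assms b z by auto
  have "\<not> P \<gamma>" if "\<gamma> \<in> elts \<beta>" for \<gamma>
    using that b z vord_trans[OF ord(1,2)] by auto
  then show ?thesis using that[of \<beta>] ord vord_mem[OF ord(1,2)] by auto
qed

lemma vord_induct [consumes 1, case_names less]:
  assumes "vord \<alpha>" "\<And>\<beta>. vord \<beta> \<Longrightarrow> (\<And>\<gamma>. \<gamma> \<in> elts \<beta> \<Longrightarrow> P \<gamma>) \<Longrightarrow> P \<beta>"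
  shows "P \<alpha>"
proof (rule ccontr)
  assume "\<not> P \<alpha>"
  then obtain \<beta> where "vord \<beta>" "\<not> P \<beta>" "\<And>\<gamma>. \<gamma> \<in> elts \<beta> \<Longrightarrow> \<not> \<not> P \<gamma>"
    using vord_least[OF assms(1), of "\<lambda>x. \<not> P x"] by metis
  then show False using assms(2) by blast
qed

lemma vord_linear:
  assumes "vord \<alpha>" "vord \<beta>"
  shows "\<alpha> \<in> elts \<beta> \<or> \<alpha> = \<beta> \<or> \<beta> \<in> elts \<alpha>"
proof -
  have "\<forall>\<beta>. vord \<beta> \<longrightarrow> \<alpha> \<in> elts \<beta> \<or> \<alpha> = \<beta> \<or> \<beta> \<in> elts \<alpha>"
    using assms(1)
  proof (induction rule: vord_induct)
    case (less \<alpha>)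
    show ?case
    proof (intro allI impI)
      fix \<beta> :: 'a assume "vord \<beta>"
      then show "\<alpha> \<in> elts \<beta> \<or> \<alpha> = \<beta> \<or> \<beta> \<in> elts \<alpha>"
      proof (induction rule: vord_induct)
        case inner: (less \<beta>)
        show ?case
        proof (rule ccontr)
          assume n: "\<not> ?case"
          have "x \<in> elts \<beta>" if "x \<in> elts \<alpha>" for x
            using less(2)[OF that] inner(1) n that vord_trans[OF less(1) that] by blast
          moreover have "x \<in> elts \<alpha>" if "x \<in> elts \<beta>" for x
            using inner(2)[OF that] n that vord_trans[OF inner(1) that] by blast
          ultimately have "elts \<alpha> = elts \<beta>" by blast
          then show False using n by simp
        qed
      qed
    qed
  qed
  then show ?thesis using assms(2) by blast
qed

lemma vle_refl [simp]: "vle \<alpha> \<alpha>" by (simp add: vle_def)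

lemma vle_trans: "vle \<alpha> \<beta> \<Longrightarrow> vle \<beta> \<gamma> \<Longrightarrow> vle \<alpha> \<gamma>" by (auto simp: vle_def)

lemma vle_mem: "vord \<beta> \<Longrightarrow> \<alpha> \<in> elts \<beta> \<Longrightarrow> vle \<alpha> \<beta>" by (simp add: vle_def vord_trans)

lemma vle_iff: "vord \<alpha> \<Longrightarrow> vord \<beta> \<Longrightarrow> vle \<alpha> \<beta> \<longleftrightarrow> \<alpha> \<in> elts \<beta> \<or> \<alpha> = \<beta>"
  using vord_linear[of \<alpha> \<beta>] vle_mem[of \<beta> \<alpha>] unfolding vle_def by auto

lemma vle_linear: "vord \<alpha> \<Longrightarrow> vord \<beta> \<Longrightarrow> vle \<alpha> \<beta> \<or> \<beta> \<in> elts \<alpha>"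
  using vord_linear[of \<alpha> \<beta>] vle_iff by blast

lemma vle_antisym: "vle \<alpha> \<beta> \<Longrightarrow> vle \<beta> \<alpha> \<Longrightarrow> \<alpha> = \<beta>"
  unfolding vle_def by (rule extensionality) auto

lemma vord_cases:
  assumes "vord \<alpha>"
  obtains "\<alpha> = vzero" | \<beta> where "\<alpha> = vsucc \<beta>" "vord \<beta>" | "vlimit \<alpha>"
proof (cases "\<alpha> = vzero \<or> vlimit \<alpha>")
  case False
  then obtain \<beta> where b: "\<beta> \<in> elts \<alpha>" "vsucc \<beta> \<notin> elts \<alpha>" using assms by (auto simp: vlimit_def)
  have "vord \<beta>" using vord_mem assms b by auto
  then have "\<alpha> = vsucc \<beta>"
    using vord_linear[OF assms vord_succ] b mem_asym[of \<beta> \<alpha>] by auto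
  then show ?thesis using that \<open>vord \<beta>\<close> by blast
qed (use that in auto)

lemma vleast_props:
  assumes "vord \<alpha>" "P \<alpha>"
  shows "vord (vleast P)" "P (vleast P)" "\<And>\<beta>. \<beta> \<in> elts (vleast P) \<Longrightarrow> \<not> P \<beta>" "vle (vleast P) \<alpha>"
proof -
  obtain \<beta> where b: "vord \<beta>" "P \<beta>" "\<And>\<gamma>. \<gamma> \<in> elts \<beta> \<Longrightarrow> \<not> P \<gamma>"
    using vord_least[of \<alpha> P] assms by metis
  have "vleast P = \<beta>" unfolding vleast_def
  proof (rule the_equality)
    show "\<gamma> = \<beta>" if "vord \<gamma> \<and> P \<gamma> \<and> (\<forall>\<beta>\<in>elts \<gamma>. \<not> P \<beta>)" for \<gamma>
      using vord_linear[of \<gamma> \<beta>] that b by auto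
  qed (use b in auto)
  then show *: "vord (vleast P)" "P (vleast P)" "\<And>\<beta>. \<beta> \<in> elts (vleast P) \<Longrightarrow> \<not> P \<beta>"
    using b by auto
  show "vle (vleast P) \<alpha>" using vle_linear[OF *(1) assms(1)] *(3) assms(2) by auto
qed

lemma vord_vnat [simp]: "vord (vnat n)" by (induction n) auto

lemma elts_vnat: "elts (vnat n) = vnat ` {..<n}"
  by (induction n) (auto simp: lessThan_Suc)

lemma vnat_inject [simp]: "vnat m = vnat n \<longleftrightarrow> m = n"
proof -
  have "vnat m \<noteq> (vnat n :: 'a)" if "m < n" for m n
  proof
    assume "vnat m = (vnat n :: 'a)"
    moreover have "vnat m \<in> elts (vnat n :: 'a)" using that by (auto simp: elts_vnat)
    ultimately show False by simp
  qed
  then show ?thesis by (metis linorder_neqE_nat)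
qed

lemma vsmall_range_vnat [simp]: "vsmall (range (vnat :: nat \<Rightarrow> 'v::set_universe))"
proof -
  obtain z e :: 'v where z: "e \<in> elts z" "elts e = {}" "\<forall>x\<in>elts z. \<exists>y\<in>elts z. elts y = insert x (elts x)"
    using infinity by metis
  have z: "vnat n \<in> elts z" for n
  proof (induction n)
    case 0
    have "e = vzero" by (rule extensionality) (simp add: z(2))
    then show ?case using z(1) by simp
  next
    case (Suc n)
    then obtain y where "y \<in> elts z" "elts y = insert (vnat n) (elts (vnat n))" using z(3) by blast
    moreover from this have "y = vsucc (vnat n)" by (intro extensionality) simp
    ultimately show ?case by simp
  qed
  have "range vnat \<subseteq> elts z" using z by auto
  then show ?thesis by (rule vsmall_subset[OF vsmall_elts])
qed

lemma elts_vomega: "elts vomega = range vnat" by (simp add: vomega_def)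

lemma vord_vomega [simp]: "vord vomega"
  unfolding vord_def elts_vomega by (auto simp: elts_vnat)

text \<open>Replacement is available for functions on the universe, so a family indexed by
  \<open>nat\<close> is transported along the injection \<open>vnat\<close>.\<close>

lemma vsmall_range: "vsmall (range (f :: nat \<Rightarrow> 'v::set_universe))"
proof -
  have "vsmall ((\<lambda>x. f (inv vnat x)) ` range (vnat :: nat \<Rightarrow> 'v))" by (rule vsmall_image) simp
  moreover have "inv vnat (vnat n :: 'v) = n" for n by (rule inv_f_f) (simp add: inj_def)
  ultimately show ?thesis by (simp add: image_image)
qed

lemma vsmall_countable: "countable A \<Longrightarrow> vsmall A"
  using vsmall_range[of "from_nat_into A"] by (cases "A = {}") (auto simp: range_from_nat_into)

lemma finite_vord:
  assumes "vord \<alpha>" "finite (elts \<alpha>)"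
  shows "elts \<alpha> \<subseteq> elts vomega"
proof -
  have "infinite (elts (vomega :: 'a))"
    unfolding elts_vomega by (rule range_inj_infinite) (simp add: inj_def)
  then have "\<not> vle vomega \<alpha>" using assms(2) finite_subset by (auto simp: vle_def)
  then have "\<alpha> \<in> elts vomega" using vle_linear[of vomega \<alpha>] assms(1) by auto
  then show ?thesis by (rule vord_trans[OF vord_vomega])
qed

text \<open>Mostowski collapse \<open>F\<close> of a well-order of \<open>elts x\<close>: each
  element is sent to the set of images of its predecessors. The image is transitive with transitive
  members, and totality of the order makes \<open>F\<close> injective.\<close>

lemma numeration: "\<exists>\<alpha> :: 'v::set_universe. vord \<alpha> \<and> elts (x :: 'v) \<approx> elts \<alpha>"
proof -
  obtain r where r: "well_order_on (elts x) r" using well_order_on by blast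
  define R where "R = r - Id"
  have wf: "wf R" and tr: "trans R" and tot: "\<And>a b. a \<in> elts x \<Longrightarrow> b \<in> elts x \<Longrightarrow> a \<noteq> b \<Longrightarrow> (a, b) \<in> R \<or> (b, a) \<in> R"
    and fld: "\<And>a b. (a, b) \<in> R \<Longrightarrow> a \<in> elts x"
    using r unfolding R_def well_order_on_def linear_order_on_def partial_order_on_def preorder_on_def total_on_def
      refl_on_def by (auto intro: trans_diff_Id)
  define F :: "'v \<Rightarrow> 'v" where "F = wfrec R (\<lambda>f a. vset (f ` {b. (b, a) \<in> R}))"
  have F: "elts (F a) = F ` {b. (b, a) \<in> R}" for a
  proof -
    have "F a = vset (cut F R a ` {b. (b, a) \<in> R})" unfolding F_def by (subst wfrec[OF wf]) simp
    also have "cut F R a ` {b. (b, a) \<in> R} = F ` {b. (b, a) \<in> R}" by (rule image_cong) (auto simp: cut_apply)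
    finally have "F a = vset (F ` {b. (b, a) \<in> R})" .
    moreover have "vsmall (F ` {b. (b, a) \<in> R})"
      by (intro vsmall_image vsmall_subset[OF vsmall_elts[of x]]) (use fld in auto)
    ultimately show ?thesis by simp
  qed
  define \<alpha> :: 'v where "\<alpha> = vset (F ` elts x)"
  have \<alpha>: "elts \<alpha> = F ` elts x" by (simp add: \<alpha>_def vsmall_image)
  have "F a \<noteq> F b" if "(a, b) \<in> R" for a b
  proof -
    have "F a \<in> elts (F b)" using that F by auto
    then show ?thesis by auto
  qed
  then have "inj_on F (elts x)" unfolding inj_on_def using tot by metis
  then have "elts x \<approx> elts \<alpha>" unfolding eqpoll_def \<alpha> by (meson inj_on_imp_bij_betw)
  moreover have "vord \<alpha>"
    unfolding vord_def \<alpha>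
  proof (intro conjI ballI)
    show "elts y \<subseteq> F ` elts x" if "y \<in> F ` elts x" for y
      using that F fld by auto
    fix y z assume "y \<in> F ` elts x" "z \<in> elts y"
    then obtain a b where "y = F a" "(b, a) \<in> R" "z = F b" using F by auto
    then show "elts z \<subseteq> elts y" using F transD[OF tr] by auto
  qed
  ultimately show ?thesis by (intro exI[of _ \<alpha>] conjI)
qed

lemma vcard_props:
  "vord (vcard x)" "elts x \<approx> elts (vcard x)"
  using numeration[of x] vleast_props(1,2)[of _ "\<lambda>\<alpha>. elts x \<approx> elts \<alpha>"] unfolding vcard_def by auto

text \<open>Otherwise \<open>\<nu>\<close> is a member, hence a subset, of \<open>\<mu>\<close>.
  Then \<open>A\<close> embeds into \<open>\<nu>\<close> and \<open>\<nu>\<close> into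
  \<open>A\<close>, so Schroeder-Bernstein contradicts minimality of \<open>\<mu>\<close>.\<close>

lemma least_eqpoll_vle:
  assumes "vord \<mu>" "A \<approx> elts \<mu>" "\<And>\<beta>. \<beta> \<in> elts \<mu> \<Longrightarrow> \<not> A \<approx> elts \<beta>"
    and "A \<lesssim> B" "vord \<nu>" "B \<approx> elts \<nu>"
  shows "vle \<mu> \<nu>"
proof (rule ccontr)
  assume "\<not> vle \<mu> \<nu>"
  then have m: "\<nu> \<in> elts \<mu>" using vle_linear assms by blast
  have "A \<lesssim> elts \<nu>" using lepoll_trans2[OF assms(4,6)] .
  moreover have "elts \<nu> \<lesssim> A"
    using subset_imp_lepoll[OF vord_trans[OF assms(1) m]] lepoll_trans2 eqpoll_sym assms(2) by blast
  ultimately show False using lepoll_antisym assms(3)[OF m] by blast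
qed

text \<open>The description in \<open>weight\<close> is proper only if some base has the size of an
  ordinal. A base that injects into a set of the universe guarantees this and bounds the weight by
  the cardinality of that set.\<close>

lemma weight_props:
  fixes X :: "'v::set_universe topology" and x :: 'v
  assumes "base_of X B" "B \<lesssim> elts x"
  shows "vord (weight X)" "\<exists>B. base_of X B \<and> B \<approx> elts (weight X)"
    "\<And>\<beta> B. \<beta> \<in> elts (weight X) \<Longrightarrow> base_of X B \<Longrightarrow> \<not> B \<approx> elts \<beta>"
    "vle (weight X) (vcard x)"
proof -
  obtain f where f: "inj_on f B" "f ` B \<subseteq> elts x" using assms(2) by (auto simp: lepoll_def)
  have "vsmall (f ` B)" using vsmall_subset[OF vsmall_elts f(2)] .
  then obtain z where "elts z = f ` B" unfolding vsmall_def by auto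
  then have Bz: "B \<approx> elts z" using f(1) inj_on_imp_bij_betw unfolding eqpoll_def by metis
  define \<mu> :: 'v where "\<mu> = vleast (\<lambda>\<alpha>. B \<approx> elts \<alpha>)"
  obtain \<alpha> :: 'v where a: "vord \<alpha>" "B \<approx> elts \<alpha>" using numeration[of z] eqpoll_trans[OF Bz] by auto
  have mu: "vord \<mu>" "B \<approx> elts \<mu>" "\<And>\<beta>. \<beta> \<in> elts \<mu> \<Longrightarrow> \<not> B \<approx> elts \<beta>"
    unfolding \<mu>_def by (fact vleast_props[of \<alpha> "\<lambda>\<alpha>. B \<approx> elts \<alpha>", OF a])+
  have "vle \<mu> (vcard x)" using least_eqpoll_vle[OF mu assms(2) vcard_props] .
  moreover have P: "\<exists>B. base_of X B \<and> B \<approx> elts \<mu>" using mu(2) assms(1) by blast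
  have w: "vord (weight X)" "\<exists>B. base_of X B \<and> B \<approx> elts (weight X)"
    "\<And>\<beta>. \<beta> \<in> elts (weight X) \<Longrightarrow> \<not> (\<exists>B. base_of X B \<and> B \<approx> elts \<beta>)" "vle (weight X) \<mu>"
    unfolding weight_def by (fact vleast_props[of \<mu> "\<lambda>\<kappa>. \<exists>B. base_of X B \<and> B \<approx> elts \<kappa>", OF mu(1) P])+
  ultimately show "vle (weight X) (vcard x)" using vle_trans[OF w(4)] by simp
  show "vord (weight X)" "\<exists>B. base_of X B \<and> B \<approx> elts (weight X)"
    "\<And>\<beta> B. \<beta> \<in> elts (weight X) \<Longrightarrow> base_of X B \<Longrightarrow> \<not> B \<approx> elts \<beta>"
    using w by auto
qed

text \<open>An infinite successor is equipollent to its predecessor, which would carry a base of the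
  same size. This settles the successor case of (R2).\<close>

lemma weight_succ_finite:
  fixes X :: "'v::set_universe topology" and x :: 'v
  assumes "base_of X B" "B \<lesssim> elts x" "weight X = vsucc \<gamma>"
  shows "finite (elts (weight X))"
proof (rule ccontr)
  assume inf: "infinite (elts (weight X))"
  note w = weight_props[OF assms(1,2)]
  have "infinite (elts \<gamma>)" using inf assms(3) by simp
  then have "insert \<gamma> (elts \<gamma>) \<approx> elts \<gamma>" by (rule infinite_insert_eqpoll)
  moreover obtain B' where "base_of X B'" "B' \<approx> elts (weight X)" using w(2) by blast
  ultimately have "base_of X B'" "B' \<approx> elts \<gamma>" using assms(3) eqpoll_trans by auto
  then show False using w(3)[of \<gamma>] assms(3) by auto
qed

text \<open>
  A minimal \<open>\<xi>\<close> below which there are uncountably many values is a limit ordinal in which every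
  countable subset is bounded.
\<close>

lemma countable_on_ordinal:
  assumes "vord \<kappa>"
    and lim: "\<And>\<xi>. \<xi> \<in> elts (vsucc \<kappa>) \<Longrightarrow> vlimit \<xi> \<Longrightarrow>
      (\<And>A. countable A \<Longrightarrow> A \<subseteq> elts \<xi> \<Longrightarrow> \<exists>\<delta>\<in>elts \<xi>. \<forall>a\<in>A. vle a \<delta>) \<Longrightarrow>
      \<exists>\<delta>\<in>elts \<xi>. \<exists>E. countable E \<and> (\<forall>\<alpha>\<in>elts \<xi>. vle \<delta> \<alpha> \<longrightarrow> p \<alpha> \<longrightarrow> h \<alpha> \<in> E)"
  shows "countable (h ` {\<alpha> \<in> elts \<kappa>. p \<alpha>})"
proof (rule ccontr)
  define S where "S \<xi> = h ` {\<alpha> \<in> elts \<xi>. p \<alpha>}" for \<xi>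
  assume "\<not> countable (h ` {\<alpha> \<in> elts \<kappa>. p \<alpha>})"
  then have "\<not> countable (S \<kappa>)" by (simp add: S_def)
  then obtain \<xi> where \<xi>: "vord \<xi>" "\<not> countable (S \<xi>)" "\<And>\<gamma>. \<gamma> \<in> elts \<xi> \<Longrightarrow> \<not> \<not> countable (S \<gamma>)" "\<xi> \<in> elts (vsucc \<kappa>)"
    by (rule vord_least[OF assms(1)]) auto
  have "vlimit \<xi>"
    using \<xi>(1)
  proof (cases rule: vord_cases)
    case 1
    then show ?thesis using \<xi>(2) by (simp add: S_def)
  next
    case (2 \<beta>)
    have "S \<xi> \<subseteq> insert (h \<beta>) (S \<beta>)" by (auto simp: S_def 2)
    moreover have "countable (insert (h \<beta>) (S \<beta>))" using \<xi>(3)[of \<beta>] 2 by simp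
    ultimately have "countable (S \<xi>)" by (rule countable_subset)
    then show ?thesis using \<xi>(2) by simp
  qed
  moreover have "\<exists>\<delta>\<in>elts \<xi>. \<forall>a\<in>A. vle a \<delta>" if A: "countable A" "A \<subseteq> elts \<xi>" for A
  proof (rule ccontr)
    assume n: "\<not> (\<exists>\<delta>\<in>elts \<xi>. \<forall>a\<in>A. vle a \<delta>)"
    have "\<exists>a\<in>A. \<delta> \<in> elts a" if d: "\<delta> \<in> elts \<xi>" for \<delta>
    proof -
      obtain a where "a \<in> A" "\<not> vle a \<delta>" using n d by blast
      moreover have "vord a" "vord \<delta>" using vord_mem[OF \<xi>(1)] A(2) d \<open>a \<in> A\<close> by auto
      ultimately show ?thesis using vle_linear by blast
    qed
    then have "S \<xi> \<subseteq> (\<Union>a\<in>A. S a)" by (fastforce simp: S_def)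
    moreover have "countable (\<Union>a\<in>A. S a)" using A \<xi>(3) by (intro countable_UN) auto
    ultimately have "countable (S \<xi>)" by (rule countable_subset)
    then show False using \<xi>(2) by simp
  qed
  ultimately obtain \<delta> E where \<delta>: "\<delta> \<in> elts \<xi>" "countable E" "\<forall>\<alpha>\<in>elts \<xi>. vle \<delta> \<alpha> \<longrightarrow> p \<alpha> \<longrightarrow> h \<alpha> \<in> E"
    using lim[OF \<xi>(4)] by blast
  have "S \<xi> \<subseteq> S \<delta> \<union> E"
  proof
    fix y assume "y \<in> S \<xi>"
    then obtain \<alpha> where \<alpha>: "\<alpha> \<in> elts \<xi>" "p \<alpha>" "y = h \<alpha>" by (auto simp: S_def)
    have "vord \<alpha>" "vord \<delta>" using vord_mem[OF \<xi>(1)] \<alpha>(1) \<delta>(1) by auto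
    then show "y \<in> S \<delta> \<union> E" using vle_linear[of \<delta> \<alpha>] \<alpha> \<delta>(3) by (auto simp: S_def)
  qed
  moreover have "countable (S \<delta> \<union> E)" using \<xi>(3)[OF \<delta>(1)] \<delta>(2) by simp
  ultimately have "countable (S \<xi>)" by (rule countable_subset)
  then show False using \<xi>(2) by simp
qed

section \<open>Real numbers and continuous functions inside the universe\<close>

lemma vrat_inject [simp]: "vrat p = vrat q \<longleftrightarrow> p = q"
proof
  assume e: "vrat p = vrat q"
  obtain a b c d where q: "quotient_of p = (a, b)" "quotient_of q = (c, d)" by fastforce
  have "b > 0" "d > 0" using quotient_of_denom_pos[OF q(1)] quotient_of_denom_pos[OF q(2)] by auto
  moreover have "nat a = nat c" "nat (- a) = nat (- c)" "nat b = nat d" using e q by (auto simp: vrat_def)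
  ultimately have "a = c" "b = d" by linarith+
  then show "p = q" using q quotient_of_inject_eq by metis
qed simp

lemma vsmall_vreal: "vsmall (vrat ` Q)"
  by (rule vsmall_countable) auto

lemma elts_vreal: "elts (vreal x) = vrat ` {q. of_rat q < x}"
  unfolding vreal_def by (rule elts_vset[OF vsmall_vreal])

lemma vreal_inject [simp]: "vreal x = vreal y \<longleftrightarrow> x = y"
proof -
  have "vreal x \<noteq> (vreal y :: 'a)" if xy: "x < y" for x y
  proof -
    obtain q where q: "x < of_rat q" "of_rat q < y" using of_rat_dense[OF xy] by auto
    have "vrat q \<in> elts (vreal y :: 'a)" using q by (simp add: elts_vreal)
    moreover have "vrat q \<notin> elts (vreal x :: 'a)" using q by (auto simp: elts_vreal)
    ultimately show ?thesis by metis
  qed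
  then show ?thesis by (metis linorder_neqE_linordered_idom)
qed

lemma vsmall_reals [simp]: "vsmall (vreal ` R :: 'a::set_universe set)"
proof -
  have "elts (vset (range (vrat :: rat \<Rightarrow> 'a))) = range vrat" by (rule elts_vset[OF vsmall_vreal])
  then have "vreal ` R \<subseteq> {y :: 'a. elts y \<subseteq> elts (vset (range vrat))}"
    by (auto simp: elts_vreal)
  then show ?thesis by (rule vsmall_subset[OF vsmall_Pow])
qed

text \<open>Given to the models as a parameter, together with the set of coded reals. Continuity of
  a coded function is then expressible by a formula that does not have to define the real
  line.\<close>

definition vopen_reals :: "'v::set_universe" where
  "vopen_reals = vset {vset (vreal ` U) |U. open U}"

lemma elts_vopen_reals: "elts vopen_reals = {vset (vreal ` U) |U. open U}"
  unfolding vopen_reals_def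
proof (rule elts_vset, rule vsmall_subset[OF vsmall_Pow[of "vset (range vreal)"]])
  show "{vset (vreal ` U) |U. open U} \<subseteq> {y :: 'a. elts y \<subseteq> elts (vset (range vreal))}" by auto
qed

lemma elts_vcfun:
  assumes "topspace X = elts K"
  shows "elts (vcfun X f) = (\<lambda>x. vpair x (vreal (f x))) ` elts K"
  unfolding vcfun_def assms by (rule elts_vgraph)

lemma vcfun_mem:
  assumes "topspace X = elts K"
  shows "vpair x y \<in> elts (vcfun X f) \<longleftrightarrow> x \<in> elts K \<and> y = vreal (f x)"
  unfolding elts_vcfun[OF assms] by auto

section \<open>Definability and closure under witnesses\<close>

text \<open>Bound variables are included, in contrast to \<open>fv\<close>. A renaming that is
  injective on all of these cannot capture a variable.\<close>

primrec fm_vars :: "fm \<Rightarrow> nat set" where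
  "fm_vars (FMem i j) = {i, j}"
| "fm_vars (FEq i j) = {i, j}"
| "fm_vars (FNeg \<phi>) = fm_vars \<phi>"
| "fm_vars (FConj \<phi> \<psi>) = fm_vars \<phi> \<union> fm_vars \<psi>"
| "fm_vars (FEx i \<phi>) = insert i (fm_vars \<phi>)"
| "fm_vars (FAll i \<phi>) = insert i (fm_vars \<phi>)"

primrec fm_rename :: "(nat \<Rightarrow> nat) \<Rightarrow> fm \<Rightarrow> fm" where
  "fm_rename f (FMem i j) = FMem (f i) (f j)"
| "fm_rename f (FEq i j) = FEq (f i) (f j)"
| "fm_rename f (FNeg \<phi>) = FNeg (fm_rename f \<phi>)"
| "fm_rename f (FConj \<phi> \<psi>) = FConj (fm_rename f \<phi>) (fm_rename f \<psi>)"
| "fm_rename f (FEx i \<phi>) = FEx (f i) (fm_rename f \<phi>)"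
| "fm_rename f (FAll i \<phi>) = FAll (f i) (fm_rename f \<phi>)"

lemma finite_fm_vars: "finite (fm_vars \<phi>)" by (induction \<phi>) auto

lemma holds_cong: "(\<And>i. i \<in> fm_vars \<phi> \<Longrightarrow> a i = b i) \<Longrightarrow> holds N \<phi> a = holds N \<phi> b"
proof (induction \<phi> arbitrary: a b)
  case (FEx i \<phi>)
  show ?case unfolding holds.simps by (intro bex_cong refl FEx.IH) (use FEx.prems in auto)
next
  case (FAll i \<phi>)
  show ?case unfolding holds.simps by (intro ball_cong refl FAll.IH) (use FAll.prems in auto)
next
  case (FConj \<phi> \<psi>)
  show ?case unfolding holds.simps
    by (intro arg_cong2[where f = "(\<and>)"] FConj.IH) (use FConj.prems in auto)
next
  case (FNeg \<phi>)
  show ?case unfolding holds.simps by (intro arg_cong[where f = Not] FNeg.IH) (use FNeg.prems in auto)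
qed auto

lemma holds_upd:
  "inj_on f (insert i (fm_vars \<phi>)) \<Longrightarrow> holds N \<phi> (a(f i := x) \<circ> f) = holds N \<phi> ((a \<circ> f)(i := x))"
  by (intro holds_cong) (auto simp: inj_on_def)

lemma holds_rename: "inj_on f (fm_vars \<phi>) \<Longrightarrow> holds N (fm_rename f \<phi>) a = holds N \<phi> (a \<circ> f)"
proof (induction \<phi> arbitrary: a)
  case (FEx i \<phi>)
  then have "inj_on f (fm_vars \<phi>)" "inj_on f (insert i (fm_vars \<phi>))" by simp_all
  then show ?case by (simp only: FEx.IH holds_upd fm_rename.simps holds.simps)
next
  case (FAll i \<phi>)
  then have "inj_on f (fm_vars \<phi>)" "inj_on f (insert i (fm_vars \<phi>))" by simp_all
  then show ?case by (simp only: FAll.IH holds_upd fm_rename.simps holds.simps)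
next
  case (FConj \<phi> \<psi>)
  then show ?case by (auto simp: inj_on_Un)
qed auto

text \<open>Definability is semantic: only the existence of a formula is recorded. Properties can
  thus be written as HOL predicates and broken down by introduction rules, without exhibiting a
  syntax tree.\<close>

definition definable :: "((nat \<Rightarrow> 'v::set_universe) \<Rightarrow> bool) \<Rightarrow> bool" where
  "definable P \<longleftrightarrow> (\<exists>\<phi>. \<forall>a. holds UNIV \<phi> a = P a)"

lemma definable_mem: "definable (\<lambda>a. a i \<in> elts (a j))"
  unfolding definable_def by (rule exI[of _ "FMem i j"]) simp

lemma definable_eq: "definable (\<lambda>a. a i = a j)"
  unfolding definable_def by (rule exI[of _ "FEq i j"]) simp

lemma definable_not: "definable P \<Longrightarrow> definable (\<lambda>a. \<not> P a)"
  unfolding definable_def by (elim exE, rule_tac x="FNeg \<phi>" in exI) simp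

lemma definable_conj: "definable P \<Longrightarrow> definable Q \<Longrightarrow> definable (\<lambda>a. P a \<and> Q a)"
  unfolding definable_def by (elim exE, rule_tac x="FConj \<phi> \<phi>'" in exI) simp

lemma definable_imp: "definable P \<Longrightarrow> definable Q \<Longrightarrow> definable (\<lambda>a. P a \<longrightarrow> Q a)"
proof -
  assume "definable P" "definable Q"
  then have "definable (\<lambda>a. \<not> (P a \<and> \<not> Q a))" by (intro definable_not definable_conj)
  then show ?thesis by simp
qed

lemma definable_iff: "definable P \<Longrightarrow> definable Q \<Longrightarrow> definable (\<lambda>a. P a \<longleftrightarrow> Q a)"
proof -
  assume "definable P" "definable Q"
  then have "definable (\<lambda>a. (P a \<longrightarrow> Q a) \<and> (Q a \<longrightarrow> P a))" by (intro definable_imp definable_conj)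
  then show ?thesis by (simp add: iff_conv_conj_imp)
qed

lemma definable_disj: "definable P \<Longrightarrow> definable Q \<Longrightarrow> definable (\<lambda>a. P a \<or> Q a)"
proof -
  assume "definable P" "definable Q"
  then have "definable (\<lambda>a. \<not> P a \<longrightarrow> Q a)" by (intro definable_imp definable_not)
  then show ?thesis by (simp add: disj_imp)
qed

text \<open>
  The environment of the body has the bound variable in front; in the formula the bound variable
  gets a fresh name and all other indices are shifted back.
\<close>

lemma definable_ex:
  assumes "definable (\<lambda>b. P (b 0) (\<lambda>n. b (Suc n)))"
  shows "definable (\<lambda>a. \<exists>x. P x a)"
proof -
  obtain \<phi> where \<phi>: "\<And>b. holds UNIV \<phi> b = P (b 0) (\<lambda>n. b (Suc n))"
    using assms unfolding definable_def by auto
  obtain N where N: "\<And>i. i \<in> fm_vars \<phi> \<Longrightarrow> i < N"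
    using finite_nat_set_iff_bounded finite_fm_vars by metis
  define f where "f = (\<lambda>i. case i of 0 \<Rightarrow> N | Suc n \<Rightarrow> n)"
  have inj: "inj_on f (fm_vars \<phi>)"
    using N unfolding inj_on_def f_def by (fastforce split: nat.splits)
  have "holds UNIV (FEx N (fm_rename f \<phi>)) a = (\<exists>x. P x a)" for a
  proof -
    have "holds UNIV (fm_rename f \<phi>) (a(N := x)) = P x a" for x
    proof -
      define b where "b = (\<lambda>i. case i of 0 \<Rightarrow> x | Suc n \<Rightarrow> a n)"
      have "holds UNIV (fm_rename f \<phi>) (a(N := x)) = holds UNIV \<phi> (a(N := x) \<circ> f)"
        by (rule holds_rename[OF inj])
      also have "\<dots> = holds UNIV \<phi> b"
        using N by (intro holds_cong) (fastforce simp: b_def f_def split: nat.splits)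
      also have "\<dots> = P x a" by (simp add: \<phi> b_def)
      finally show ?thesis .
    qed
    then show ?thesis by simp
  qed
  then show ?thesis unfolding definable_def by blast
qed

lemma definable_all:
  assumes "definable (\<lambda>b. P (b 0) (\<lambda>n. b (Suc n)))"
  shows "definable (\<lambda>a. \<forall>x. P x a)"
proof -
  have "definable (\<lambda>a. \<not> (\<exists>x. \<not> P x a))" by (intro definable_not definable_ex assms)
  then show ?thesis by simp
qed

lemma definable_bex:
  assumes "definable (\<lambda>b. P (b 0) (\<lambda>n. b (Suc n)))"
  shows "definable (\<lambda>a. \<exists>x\<in>elts (a i). P x a)"
  unfolding Bex_def by (intro definable_ex definable_conj definable_mem assms)

lemma definable_ball:
  assumes "definable (\<lambda>b. P (b 0) (\<lambda>n. b (Suc n)))"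
  shows "definable (\<lambda>a. \<forall>x\<in>elts (a i). P x a)"
  unfolding Ball_def by (intro definable_all definable_imp definable_mem assms)

text \<open>Eliminates the \<open>vset\<close> terms in favour of membership and equality, the only
  atoms of the language.\<close>

lemma vpair_iff: "z = vpair x y \<longleftrightarrow>
   (\<forall>w. w \<in> elts z \<longleftrightarrow> (\<forall>v. v \<in> elts w \<longleftrightarrow> v = x) \<or> (\<forall>v. v \<in> elts w \<longleftrightarrow> v = x \<or> v = y))"
proof -
  have 1: "w = vset {x} \<longleftrightarrow> (\<forall>v. v \<in> elts w \<longleftrightarrow> v = x)" for w
    using elts_inject[of w "vset {x}"] by auto
  have 2: "w = vset {x, y} \<longleftrightarrow> (\<forall>v. v \<in> elts w \<longleftrightarrow> v = x \<or> v = y)" for w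
    using elts_inject[of w "vset {x, y}"] by auto
  have "z = vpair x y \<longleftrightarrow> elts z = {vset {x}, vset {x, y}}" by (metis elts_inject elts_vpair)
  also have "\<dots> \<longleftrightarrow> (\<forall>w. w \<in> elts z \<longleftrightarrow> w = vset {x} \<or> w = vset {x, y})" by auto
  finally show ?thesis unfolding 1 2 .
qed

lemma definable_eq_vpair: "definable (\<lambda>a. a i = vpair (a j) (a k))"
  unfolding vpair_iff by (intro definable_all definable_iff definable_disj definable_mem definable_eq)

lemma definable_vpair_mem: "definable (\<lambda>a. vpair (a i) (a j) \<in> elts (a k))"
proof -
  have "definable (\<lambda>a. \<exists>z\<in>elts (a k). z = vpair (a i) (a j))"
    by (intro definable_bex definable_eq_vpair)
  then show ?thesis by simp
qed

lemmas definable_intros = definable_mem definable_eq definable_not definable_conj definable_imp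
  definable_iff definable_disj definable_bex definable_ball definable_ex definable_all definable_vpair_mem

text \<open>Assignments are total, parameter lists are finite. The default \<open>vzero\<close>
  keeps every value in \<open>M\<close> as soon as \<open>vzero\<close> is in \<open>M\<close>, so
  absoluteness can be applied whichever variables a formula has.\<close>

definition env :: "'v list \<Rightarrow> nat \<Rightarrow> 'v::set_universe" where
  "env xs n = (if n < length xs then xs ! n else vzero)"

definition skolem_closed :: "'v::set_universe \<Rightarrow> ((nat \<Rightarrow> 'v) \<Rightarrow> bool) \<Rightarrow> bool" where
  "skolem_closed M P \<longleftrightarrow> (\<forall>xs. set xs \<subseteq> elts M \<longrightarrow> (\<exists>x. P (env (x # xs))) \<longrightarrow> (\<exists>x\<in>elts M. P (env (x # xs))))"

lemma ex_skolem_formulas: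
  fixes P :: "(nat \<Rightarrow> 'v::set_universe) \<Rightarrow> bool"
  assumes "definable P"
  shows "\<exists>\<Phi>. \<forall>M. (\<forall>\<phi>\<in>set \<Phi>. absolute_for M \<phi>) \<longrightarrow> vzero \<in> elts M \<longrightarrow> skolem_closed M P"
proof -
  obtain \<phi> where \<phi>: "\<And>a :: nat \<Rightarrow> 'v. holds UNIV \<phi> a = P a" using assms unfolding definable_def by auto
  have "skolem_closed M P" if M: "absolute_for M \<phi>" "absolute_for M (FEx 0 \<phi>)" "vzero \<in> elts M" for M
    unfolding skolem_closed_def
  proof (intro allI impI)
    fix xs :: "'v list" assume xs: "set xs \<subseteq> elts M" and ex: "\<exists>x. P (env (x # xs))"
    have env_M: "env (y # xs) i \<in> elts M" if "y \<in> elts M" for y i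
      using that xs M(3) by (cases i) (auto simp: env_def)
    have upd: "(env (vzero # xs))(0 := y) = env (y # xs)" for y
      by (rule ext) (auto simp: env_def nth_Cons split: nat.splits)
    have "holds UNIV (FEx 0 \<phi>) (env (vzero # xs))" using ex by (simp add: upd \<phi>)
    then have "holds (elts M) (FEx 0 \<phi>) (env (vzero # xs))"
      using M(2,3) env_M unfolding absolute_for_def by blast
    then obtain x where x: "x \<in> elts M" "holds (elts M) \<phi> (env (x # xs))" by (auto simp: upd)
    then have "P (env (x # xs))" using M(1) env_M \<phi> unfolding absolute_for_def by blast
    then show "\<exists>x\<in>elts M. P (env (x # xs))" using x(1) by blast
  qed
  then show ?thesis by (intro exI[of _ "[\<phi>, FEx 0 \<phi>]"]) simp
qed

lemma ex_skolem_formulas_list: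
  assumes "\<forall>P\<in>set Ps. definable P"
  shows "\<exists>\<Phi>. \<forall>M. (\<forall>\<phi>\<in>set \<Phi>. absolute_for M \<phi>) \<longrightarrow> vzero \<in> elts M \<longrightarrow> (\<forall>P\<in>set Ps. skolem_closed M P)"
  using assms
proof (induction Ps)
  case (Cons P Ps)
  then obtain \<Phi> where \<Phi>: "\<forall>M. (\<forall>\<phi>\<in>set \<Phi>. absolute_for M \<phi>) \<longrightarrow> vzero \<in> elts M \<longrightarrow> (\<forall>P\<in>set Ps. skolem_closed M P)"
    by auto
  obtain \<Psi> where \<Psi>: "\<forall>M. (\<forall>\<phi>\<in>set \<Psi>. absolute_for M \<phi>) \<longrightarrow> vzero \<in> elts M \<longrightarrow> skolem_closed M P"
    using ex_skolem_formulas Cons.prems by force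
  show ?case using \<Phi> \<Psi> by (intro exI[of _ "\<Phi> @ \<Psi>"]) simp
qed auto

section \<open>The canonical retraction of a model\<close>

text \<open>Totality is left out so that the empty relation can enumerate the empty set. Uniqueness
  of values is what lets a value be recovered in \<open>M\<close> from \<open>e\<close> and its
  index.\<close>

definition vfunctional :: "'v::set_universe \<Rightarrow> bool" where
  "vfunctional e \<longleftrightarrow> (\<forall>n c d. vpair n c \<in> elts e \<longrightarrow> vpair n d \<in> elts e \<longrightarrow> c = d)"

lemma ex_enumeration:
  assumes "countable A"
  shows "\<exists>e. vfunctional e \<and> (\<forall>n c. vpair n c \<in> elts e \<longrightarrow> c \<in> A) \<and> (\<forall>c\<in>A. \<exists>n\<in>elts vomega. vpair n c \<in> elts e)"
proof (cases "A = {}")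
  case True
  then show ?thesis by (intro exI[of _ vzero]) (simp add: vfunctional_def)
next
  case False
  define e where "e = vset (range (\<lambda>n. vpair (vnat n) (from_nat_into A n)))"
  have e: "elts e = range (\<lambda>n. vpair (vnat n) (from_nat_into A n))" unfolding e_def by (rule elts_vset[OF vsmall_range])
  have "vfunctional e" unfolding vfunctional_def e by auto
  moreover have "\<forall>n c. vpair n c \<in> elts e \<longrightarrow> c \<in> A" unfolding e using from_nat_into[OF False] by auto
  moreover have "\<exists>n\<in>elts vomega. vpair n c \<in> elts e" if c: "c \<in> A" for c
  proof
    show "vnat (to_nat_on A c) \<in> elts vomega" by (auto simp: elts_vomega)
    show "vpair (vnat (to_nat_on A c)) c \<in> elts e"
      unfolding e using from_nat_into_to_nat_on[OF assms c] by (intro image_eqI[of _ _ "to_nat_on A c"]) auto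
  qed
  ultimately show ?thesis by blast
qed

text \<open>The bound witness is variable 0, the parameters are the variables from 1 on.\<close>

definition in_prop :: "(nat \<Rightarrow> 'v::set_universe) \<Rightarrow> bool" where
  "in_prop a \<longleftrightarrow> a 0 \<in> elts (a 1)"

definition meet_prop :: "(nat \<Rightarrow> 'v::set_universe) \<Rightarrow> bool" where
  "meet_prop a \<longleftrightarrow> a 0 \<in> elts (a 1) \<and> a 0 \<in> elts (a 2)"

definition value_prop :: "(nat \<Rightarrow> 'v::set_universe) \<Rightarrow> bool" where
  "value_prop a \<longleftrightarrow> vpair (a 1) (a 0) \<in> elts (a 2)"

definition bound_prop :: "(nat \<Rightarrow> 'v::set_universe) \<Rightarrow> bool" where
  "bound_prop a \<longleftrightarrow> a 0 \<in> elts (a 1) \<and> vpair (a 3) (a 0) \<in> elts (a 2) \<and> vpair (a 4) (a 0) \<in> elts (a 2)"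

text \<open>With the parameters \<open>\<Gamma>\<close>, \<open>r\<close>, \<open>x\<close>: the
  witness is an index whose retraction fixes \<open>x\<close>.\<close>

definition fix_prop :: "(nat \<Rightarrow> 'v::set_universe) \<Rightarrow> bool" where
  "fix_prop a \<longleftrightarrow> a 0 \<in> elts (a 1) \<and> (\<exists>g. vpair (a 0) g \<in> elts (a 2) \<and> vpair (a 3) (a 3) \<in> elts g)"

text \<open>With the parameters \<open>\<Gamma>\<close>, \<open>r\<close>, \<open>K\<close> and a
  coded function \<open>f\<close>: an index \<open>s\<close> through which \<open>f\<close> factors,
  that is \<open>f = f \<circ> r s\<close> on \<open>K\<close>.\<close>

definition factor_prop :: "(nat \<Rightarrow> 'v::set_universe) \<Rightarrow> bool" where
  "factor_prop a \<longleftrightarrow> a 0 \<in> elts (a 1) \<and> (\<exists>g. vpair (a 0) g \<in> elts (a 2) \<and>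
     (\<forall>x\<in>elts (a 3). \<exists>y v. vpair x y \<in> elts g \<and> vpair x v \<in> elts (a 4) \<and> vpair y v \<in> elts (a 4)))"

text \<open>With the parameters \<open>vomega\<close>, \<open>D\<close>, \<open>\<tau>\<close>,
  \<open>K\<close> and the graph of \<open>r s\<close>: the witness enumerates points of
  \<open>D\<close> that meet every open set meeting the range of \<open>r s\<close>. The points are
  only asked to be in \<open>D\<close>, not in that range.\<close>

definition dense_prop :: "(nat \<Rightarrow> 'v::set_universe) \<Rightarrow> bool" where
  "dense_prop a \<longleftrightarrow> vfunctional (a 0) \<and>
     (\<forall>n c. vpair n c \<in> elts (a 0) \<longrightarrow> c \<in> elts (a 2)) \<and>
     (\<forall>U\<in>elts (a 3). (\<exists>x\<in>elts (a 4). \<exists>y\<in>elts U. vpair x y \<in> elts (a 5)) \<longrightarrow>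
        (\<exists>c\<in>elts U. \<exists>n\<in>elts (a 1). vpair n c \<in> elts (a 0)))"

text \<open>With the parameters \<open>vomega\<close>, a set of coded functions, \<open>K\<close>
  and the graph of \<open>r s\<close>: an enumeration of functions from that set separating points
  with different images under \<open>r s\<close>. Equality of images is phrased as a common value in
  the graph.\<close>

definition separating_prop :: "(nat \<Rightarrow> 'v::set_universe) \<Rightarrow> bool" where
  "separating_prop a \<longleftrightarrow> vfunctional (a 0) \<and>
     (\<forall>n c. vpair n c \<in> elts (a 0) \<longrightarrow> c \<in> elts (a 2)) \<and>
     (\<forall>x\<in>elts (a 3). \<forall>y\<in>elts (a 3). \<not> (\<exists>z. vpair x z \<in> elts (a 4) \<and> vpair y z \<in> elts (a 4)) \<longrightarrow>
        (\<exists>n\<in>elts (a 1). \<exists>f. vpair n f \<in> elts (a 0) \<and> \<not> (\<exists>v. vpair x v \<in> elts f \<and> vpair y v \<in> elts f)))"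

text \<open>With the parameters \<open>vomega\<close>, \<open>\<tau>\<close>, \<open>K\<close> and
  the graph of \<open>r s\<close>: an enumeration of a family as in \<open>countable_base\<close>,
  where the open set \<open>V\<close> has to contain a whole fibre of \<open>r s\<close>.\<close>

definition base_prop :: "(nat \<Rightarrow> 'v::set_universe) \<Rightarrow> bool" where
  "base_prop a \<longleftrightarrow> vfunctional (a 0) \<and>
     (\<forall>n c. vpair n c \<in> elts (a 0) \<longrightarrow> c \<in> elts (a 2)) \<and>
     (\<forall>V\<in>elts (a 2). \<forall>x\<in>elts (a 3).
        (\<forall>z\<in>elts (a 3). (\<exists>y. vpair x y \<in> elts (a 4) \<and> vpair z y \<in> elts (a 4)) \<longrightarrow> z \<in> elts V) \<longrightarrow>
        (\<exists>n\<in>elts (a 1). \<exists>U. vpair n U \<in> elts (a 0) \<and> x \<in> elts U \<and> (\<forall>w\<in>elts U. w \<in> elts V)))"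

text \<open>With the parameters \<open>K\<close>, \<open>\<tau>\<close>, the coded reals and their
  open sets: the witness is the set of all coded continuous functions on \<open>K\<close>. The three
  conjuncts say that \<open>f\<close> is a relation between \<open>K\<close> and the reals, a
  function, and continuous.\<close>

definition cfuns_prop :: "(nat \<Rightarrow> 'v::set_universe) \<Rightarrow> bool" where
  "cfuns_prop a \<longleftrightarrow> (\<forall>f. f \<in> elts (a 0) \<longleftrightarrow>
     (\<forall>p\<in>elts f. \<exists>x\<in>elts (a 1). \<exists>v\<in>elts (a 3). p = vpair x v) \<and>
     (\<forall>x\<in>elts (a 1). \<exists>v\<in>elts (a 3). vpair x v \<in> elts f \<and> (\<forall>w. vpair x w \<in> elts f \<longrightarrow> w = v)) \<and>
     (\<forall>W\<in>elts (a 4). \<exists>U\<in>elts (a 2). \<forall>x\<in>elts (a 1). x \<in> elts U \<longleftrightarrow> (\<exists>v\<in>elts W. vpair x v \<in> elts f)))"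

definition model_props :: "((nat \<Rightarrow> 'v::set_universe) \<Rightarrow> bool) list" where
  "model_props = [in_prop, meet_prop, value_prop, bound_prop, fix_prop, factor_prop, dense_prop,
     separating_prop, base_prop, cfuns_prop]"

lemma definable_vfunctional: "definable (\<lambda>a. vfunctional (a i))"
  unfolding vfunctional_def by (intro definable_intros)

lemma definable_model_props: "\<forall>P\<in>set model_props. definable P"
  unfolding model_props_def list.set ball_simps in_prop_def[abs_def] meet_prop_def[abs_def] value_prop_def[abs_def]
    bound_prop_def[abs_def] fix_prop_def[abs_def] factor_prop_def[abs_def] dense_prop_def[abs_def]
    separating_prop_def[abs_def] base_prop_def[abs_def] cfuns_prop_def[abs_def]
  by (intro conjI definable_intros definable_vfunctional definable_eq_vpair TrueI)

lemma mspace_cspace: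
  assumes "compact_space X"
  shows "f \<in> mspace (cspace X) \<longleftrightarrow> f \<in> extensional (topspace X) \<and> continuous_map X euclideanreal f"
  using compactin_mspace_cfunspace[of X euclidean_metric] assms by (auto simp: compact_space_def)

context subskeleton
begin

text \<open>Uniform convergence places \<open>f \<circ> r s\<close> arbitrarily near
  \<open>f \<circ> rlim T\<close> in the supremum metric, and \<open>A\<close> is closed. The
  restrictions make the compositions \<open>undefined\<close> off the space, as elements of
  \<open>cspace\<close> have to be.\<close>

lemma rlim_closed_family:
  assumes A: "closedin (mtopology_of (cspace X)) A" "f \<in> A"
    and inv: "\<And>s. s \<in> T \<Longrightarrow> restrict (f \<circ> r s) (topspace X) \<in> A"
  shows "restrict (f \<circ> rlim T) (topspace X) \<in> A"
proof (rule ccontr)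
  interpret C: Metric_space "mspace (cspace X)" "mdist (cspace X)" by (rule Metric_space_mspace_mdist)
  let ?g = "restrict (f \<circ> rlim T) (topspace X)"
  assume n: "?g \<notin> A"
  have cl: "closedin C.mtopology A" using A(1) by (simp add: mtopology_of_def)
  have "A \<subseteq> mspace (cspace X)" using closedin_subset[OF A(1)] unfolding topspace_mtopology_of .
  then have f: "continuous_map X euclideanreal f" using A(2) mspace_cspace[OF compact] by auto
  have "continuous_map X euclideanreal (f \<circ> rlim T)"
    by (rule continuous_map_compose[OF rlim_continuous f])
  then have g: "?g \<in> mspace (cspace X)"
    unfolding mspace_cspace[OF compact] by (auto intro: continuous_map_eq)
  then obtain e where e: "e > 0" "disjnt A (C.mball ?g e)"
    using cl n unfolding C.closedin_metric by blast
  \<comment> \<open>Half of \<open>e\<close>: strict pointwise bounds only give a non-strict bound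
    for the supremum distance.\<close>
  obtain s where s: "s \<in> T" "\<forall>t\<in>T. le s t \<longrightarrow> (\<forall>x\<in>topspace X. \<bar>f (r t x) - f (rlim T x)\<bar> < e / 2)"
    using uniform_limit[OF f, of "e / 2"] e by auto
  let ?h = "restrict (f \<circ> r s) (topspace X)"
  have hA: "?h \<in> A" using inv s by auto
  then have h: "?h \<in> mspace (cspace X)" using \<open>A \<subseteq> mspace (cspace X)\<close> by auto
  have "mdist (cspace X) ?g ?h \<le> e / 2"
  proof (rule mdist_cfunspace_le)
    fix x assume x: "x \<in> topspace X"
    have "\<bar>f (r s x) - f (rlim T x)\<bar> < e / 2" using s le_refl x by auto
    then show "mdist euclidean_metric (?g x) (?h x) \<le> e / 2" using x by (simp add: dist_real_def abs_minus_commute)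
  qed (use e in auto)
  then have "mdist (cspace X) ?g ?h < e" using e(1) by linarith
  then have "?h \<in> C.mball ?g e" unfolding C.in_mball using g h by blast
  then show False using e(2) hA by (auto simp: disjnt_iff)
qed

end

section \<open>Skeletons whose data are sets of the universe\<close>

locale coded_skeleton =
  fixes K \<tau> \<Gamma> leq r :: "'v::set_universe"
  assumes topo: "vtopology K \<tau>"
    and rfun: "vfunction r (elts \<Gamma>) {g. vfunction g (elts K) (elts K) \<and> continuous_map (vspace \<tau>) (vspace \<tau>) (vapp g)}"
    and rskel: "retractional_skeleton (vspace \<tau>) (elts \<Gamma>) (vrel leq) (\<lambda>s. vapp (vapp r s))"
begin

abbreviation "X \<equiv> vspace \<tau>"
abbreviation "le \<equiv> vrel leq"
abbreviation "rs \<equiv> \<lambda>s. vapp (vapp r s)"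
abbreviation "D \<equiv> induced_set X (elts \<Gamma>) rs"

sublocale skeleton X "elts \<Gamma>" le rs
  by unfold_locales (rule rskel)

lemma openin_iff: "openin X U \<longleftrightarrow> (\<exists>u\<in>elts \<tau>. U = elts u)"
  using topo unfolding vspace_def vtopology_def by (auto simp: topology_inverse')

lemma topspace_eq [simp]: "topspace X = elts K"
proof -
  have "topspace X = \<Union>(elts ` elts \<tau>)" unfolding topspace_def openin_iff by auto
  then show ?thesis using topo by (simp add: vtopology_def)
qed

lemma r_mem: "s \<in> elts \<Gamma> \<Longrightarrow> vpair s g \<in> elts r \<longleftrightarrow> g = vapp r s"
  by (rule vapp_eq[OF rfun])

lemma rs_mem: "s \<in> elts \<Gamma> \<Longrightarrow> x \<in> elts K \<Longrightarrow> vpair x y \<in> elts (vapp r s) \<longleftrightarrow> y = rs s x"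
  using vapp_in[OF rfun] by (intro vapp_eq) auto

lemma D_subset: "D \<subseteq> elts K"
  unfolding induced_set_def using in_space by auto

lemma elts_D [simp]: "elts (vset D) = D"
  by (rule elts_vset[OF vsmall_subset[OF vsmall_elts D_subset]])

lemma D_iff: "x \<in> D \<longleftrightarrow> x \<in> elts K \<and> (\<exists>s\<in>elts \<Gamma>. rs s x = x)"
  unfolding induced_set_def using image_eq by auto

lemma cfun_iff: "f \<in> mspace (cspace X) \<longleftrightarrow> f \<in> extensional (elts K) \<and> continuous_map X euclideanreal f"
  using mspace_cspace[OF compact] by simp

lemma cfun_mem [simp]: "vpair x y \<in> elts (vcfun X f) \<longleftrightarrow> x \<in> elts K \<and> y = vreal (f x)"
  by (rule vcfun_mem) simp

lemma vsmall_cfuns: "vsmall (vcfun X ` A)"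
proof -
  define P where "P = (\<Union>x\<in>elts K. (\<lambda>v. vpair x v) ` (vreal ` UNIV))"
  have "vsmall P" unfolding P_def by (intro vsmall_UN vsmall_image vsmall_elts vsmall_reals)
  then obtain p where p: "elts p = P" unfolding vsmall_def by auto
  have "vcfun X ` A \<subseteq> {y. elts y \<subseteq> elts p}"
  proof
    fix y assume "y \<in> vcfun X ` A"
    then obtain f where "elts y = (\<lambda>x. vpair x (vreal (f x))) ` elts K"
      using elts_vcfun[OF topspace_eq] by auto
    then have "elts y \<subseteq> P" unfolding P_def by auto
    then show "y \<in> {y. elts y \<subseteq> elts p}" by (simp add: p)
  qed
  then show ?thesis by (rule vsmall_subset[OF vsmall_Pow])
qed

lemma elts_cfuns [simp]: "elts (vset (vcfun X ` A)) = vcfun X ` A"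
  by (rule elts_vset[OF vsmall_cfuns])

text \<open>The formula has exactly one witness, so a witness found in a model can only be the set
  of all continuous functions itself.\<close>

lemma cfuns_prop_iff:
  "cfuns_prop (env [A, K, \<tau>, vset (range vreal), vopen_reals]) \<longleftrightarrow> A = vset (vcfun X ` mspace (cspace X))"
proof -
  let ?c = "\<lambda>f. (\<forall>p\<in>elts f. \<exists>x\<in>elts K. \<exists>v\<in>range vreal. p = vpair x v) \<and>
     (\<forall>x\<in>elts K. \<exists>v\<in>range vreal. vpair x v \<in> elts f \<and> (\<forall>w. vpair x w \<in> elts f \<longrightarrow> w = v)) \<and>
     (\<forall>W\<in>elts vopen_reals. \<exists>U\<in>elts \<tau>. \<forall>x\<in>elts K. x \<in> elts U \<longleftrightarrow> (\<exists>v\<in>elts W. vpair x v \<in> elts f))"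
  have "f \<in> vcfun X ` mspace (cspace X)" if f: "?c f" for f
  proof -
    have "\<forall>x\<in>elts K. \<exists>y. vpair x (vreal y) \<in> elts f \<and> (\<forall>w. vpair x w \<in> elts f \<longrightarrow> w = vreal y)" using f by blast
    then obtain h where h: "\<And>x. x \<in> elts K \<Longrightarrow> vpair x (vreal (h x)) \<in> elts f"
      "\<And>x w. x \<in> elts K \<Longrightarrow> vpair x w \<in> elts f \<Longrightarrow> w = vreal (h x)" by metis
    \<comment> \<open>\<open>h\<close> is arbitrary off \<open>K\<close>, while functions in
      \<open>cspace\<close> are extensional.\<close>
    define h' where "h' = restrict h (elts K)"
    have "elts f = elts (vcfun X h')"
    proof
      show "elts f \<subseteq> elts (vcfun X h')"
      proof
        fix p assume p: "p \<in> elts f"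
        then obtain x v where "x \<in> elts K" "p = vpair x v" using f by blast
        then show "p \<in> elts (vcfun X h')" using h(2)[of x v] p by (simp add: h'_def)
      qed
      show "elts (vcfun X h') \<subseteq> elts f" using h(1) by (auto simp: elts_vcfun[OF topspace_eq] h'_def)
    qed
    then have "f = vcfun X h'" by simp
    moreover have "continuous_map X euclideanreal h'"
      unfolding continuous_map
    proof (intro conjI allI impI)
      fix W :: "real set" assume "openin euclidean W"
      then have "vset (vreal ` W) \<in> elts vopen_reals" by (auto simp: elts_vopen_reals)
      then obtain u where u: "u \<in> elts \<tau>" "\<forall>x\<in>elts K. x \<in> elts u \<longleftrightarrow> (\<exists>v\<in>vreal ` W. vpair x v \<in> elts f)"
        using f by fastforce
      have "elts u \<subseteq> elts K" using u(1) openin_subset[of X "elts u"] openin_iff by auto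
      then have "{x \<in> topspace X. h' x \<in> W} = elts u" using u(2) \<open>f = vcfun X h'\<close> by auto
      then show "openin X {x \<in> topspace X. h' x \<in> W}" using u(1) openin_iff by auto
    qed auto
    ultimately show ?thesis using cfun_iff by (auto simp: h'_def)
  qed
  moreover have "?c f" if fm: "f \<in> vcfun X ` mspace (cspace X)" for f
  proof -
    obtain h where h: "f = vcfun X h" "continuous_map X euclideanreal h" using fm cfun_iff by auto
    have 3: "\<forall>W\<in>elts vopen_reals. \<exists>U\<in>elts \<tau>. \<forall>x\<in>elts K. x \<in> elts U \<longleftrightarrow> (\<exists>v\<in>elts W. vpair x v \<in> elts f)"
    proof
      fix W :: 'v assume W: "W \<in> elts vopen_reals"
      obtain O' where O': "open O'" "W = vset (vreal ` O')" using W by (auto simp: elts_vopen_reals)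
      have "openin X {x \<in> topspace X. h x \<in> O'}" using h(2) O'(1) by (auto simp: continuous_map)
      then obtain u where u: "u \<in> elts \<tau>" "{x \<in> topspace X. h x \<in> O'} = elts u" unfolding openin_iff by blast
      have "x \<in> elts u \<longleftrightarrow> h x \<in> O'" if "x \<in> elts K" for x
        unfolding u(2)[symmetric] using that by simp
      moreover have "(\<exists>v\<in>elts W. vpair x v \<in> elts f) \<longleftrightarrow> h x \<in> O'" if "x \<in> elts K" for x
        unfolding h(1) O'(2) cfun_mem elts_vset[OF vsmall_reals] using that by auto
      ultimately show "\<exists>U\<in>elts \<tau>. \<forall>x\<in>elts K. x \<in> elts U \<longleftrightarrow> (\<exists>v\<in>elts W. vpair x v \<in> elts f)"
        using u(1) by (intro bexI[of _ u]) simp_all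
    qed
    have 2: "\<forall>x\<in>elts K. \<exists>v\<in>range vreal. vpair x v \<in> elts f \<and> (\<forall>w. vpair x w \<in> elts f \<longrightarrow> w = v)"
      unfolding h(1) cfun_mem by blast
    have 1: "\<forall>p\<in>elts f. \<exists>x\<in>elts K. \<exists>v\<in>range vreal. p = vpair x v"
      unfolding h(1) elts_vcfun[OF topspace_eq] by blast
    show ?thesis by (intro conjI 1 2 3)
  qed
  ultimately have *: "?c f \<longleftrightarrow> f \<in> vcfun X ` mspace (cspace X)" for f by (rule iffI)
  have "cfuns_prop (env [A, K, \<tau>, vset (range vreal), vopen_reals]) \<longleftrightarrow> (\<forall>f. f \<in> elts A \<longleftrightarrow> ?c f)"
    unfolding cfuns_prop_def env_def by (simp add: eval_nat_numeral)
  also have "\<dots> \<longleftrightarrow> elts A = elts (vset (vcfun X ` mspace (cspace X)))"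
    unfolding * elts_cfuns by auto
  also have "\<dots> \<longleftrightarrow> A = vset (vcfun X ` mspace (cspace X))" by (rule elts_inject)
  finally show ?thesis .
qed

end

section \<open>The retraction of a single model: range, functions in the model, uniqueness and
  weight\<close>

locale elementary = coded_skeleton +
  fixes M
  assumes params: "{K, vset D, \<Gamma>, leq, r, \<tau>, vset (range vreal), vopen_reals} \<subseteq> elts M"
    and omega: "vomega \<in> elts M" "elts vomega \<subseteq> elts M"
    and closed: "\<And>P. P \<in> set model_props \<Longrightarrow> skolem_closed M P"
begin

lemma witness:
  assumes "P \<in> set model_props" "set xs \<subseteq> elts M" "P (env (x # xs))"
  obtains y where "y \<in> elts M" "P (env (y # xs))"
  using closed[OF assms(1)] assms(2,3) unfolding skolem_closed_def by blast

abbreviation "T \<equiv> elts \<Gamma> \<inter> elts M"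

text \<open>\<open>M\<close> contains some value of \<open>f\<close> at \<open>x\<close>, and there
  is only one.\<close>

lemma value_in_M:
  assumes "f \<in> elts M" "x \<in> elts M" "vpair x y \<in> elts f" "\<And>z. vpair x z \<in> elts f \<Longrightarrow> z = y"
  shows "y \<in> elts M"
proof -
  obtain z where "z \<in> elts M" "value_prop (env [z, x, f])"
    using witness[of value_prop "[x, f]" y] assms(1-3) by (auto simp: model_props_def value_prop_def env_def)
  then show ?thesis using assms(4)[of z] by (simp add: value_prop_def env_def)
qed

text \<open>The natural numbers are in \<open>M\<close>, so a countable set with an enumeration in
  \<open>M\<close> is a subset of \<open>M\<close>.\<close>

lemma enumerated_in_M:
  assumes "e \<in> elts M" "vfunctional e" "n \<in> elts vomega" "vpair n c \<in> elts e"
  shows "c \<in> elts M"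
proof (rule value_in_M[OF assms(1) _ assms(4)])
  show "n \<in> elts M" using assms(3) omega by auto
  show "z = c" if "vpair n z \<in> elts e" for z
    using assms(2)[unfolded vfunctional_def, rule_format, OF that assms(4)] .
qed

lemma r_in_M:
  assumes "s \<in> T"
  shows "vapp r s \<in> elts M"
proof (rule value_in_M)
  show "r \<in> elts M" "s \<in> elts M" using assms params by auto
  show "vpair s (vapp r s) \<in> elts r" using assms r_mem by auto
  show "z = vapp r s" if "vpair s z \<in> elts r" for z using that assms r_mem by auto
qed

lemma T_directed: "up_directed T le"
  unfolding up_directed_def
proof (intro conjI ballI)
  obtain s where s: "s \<in> elts \<Gamma>" using directed by (auto simp: up_directed_def)
  obtain t where "t \<in> elts M" "in_prop (env [t, \<Gamma>])"
    using witness[of in_prop "[\<Gamma>]" s] s params by (auto simp: model_props_def in_prop_def env_def)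
  then show "T \<noteq> {}" by (auto simp: in_prop_def env_def)
next
  fix s t assume st: "s \<in> T" "t \<in> T"
  then obtain u where u: "u \<in> elts \<Gamma>" "le s u" "le t u" using directed by (auto simp: up_directed_def)
  have bp: "bound_prop (env [v, \<Gamma>, leq, s, t]) \<longleftrightarrow> v \<in> elts \<Gamma> \<and> le s v \<and> le t v" for v
    by (simp add: bound_prop_def env_def vrel_def eval_nat_numeral)
  obtain v where "v \<in> elts M" "bound_prop (env [v, \<Gamma>, leq, s, t])"
    using witness[of bound_prop "[\<Gamma>, leq, s, t]" u] u st params unfolding bp by (auto simp: model_props_def)
  then show "\<exists>u\<in>T. le s u \<and> le t u" unfolding bp by auto
qed

sublocale subskeleton X "elts \<Gamma>" le rs T
  by unfold_locales (use T_directed in auto)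

lemma subskeleton_T: "subskeleton X (elts \<Gamma>) le rs T"
  by unfold_locales

lemma fixing_index:
  assumes "x \<in> D" "x \<in> elts M"
  shows "\<exists>s\<in>T. rs s x = x"
proof -
  have xK: "x \<in> elts K" using assms(1) D_subset by auto
  have fp: "fix_prop (env [s, \<Gamma>, r, x]) \<longleftrightarrow> s \<in> elts \<Gamma> \<and> rs s x = x" for s
  proof -
    have "fix_prop (env [s, \<Gamma>, r, x]) \<longleftrightarrow> s \<in> elts \<Gamma> \<and> (\<exists>g. vpair s g \<in> elts r \<and> vpair x x \<in> elts g)"
      by (simp add: fix_prop_def env_def eval_nat_numeral)
    then show ?thesis using r_mem[of s] rs_mem[of s x x] xK by auto
  qed
  obtain s where s: "s \<in> elts \<Gamma>" "rs s x = x" using assms(1) D_iff by auto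
  obtain t where "t \<in> elts M" "fix_prop (env [t, \<Gamma>, r, x])"
    using witness[of fix_prop "[\<Gamma>, r, x]" s] s assms params unfolding fp by (auto simp: model_props_def)
  then show ?thesis unfolding fp by auto
qed

lemma image_subset_closure:
  assumes s: "s \<in> T"
  shows "rs s ` elts K \<subseteq> X closure_of (D \<inter> elts M)"
proof -
  have sG: "s \<in> elts \<Gamma>" using s by auto
  have dp: "dense_prop (env [e, vomega, vset D, \<tau>, K, vapp r s]) \<longleftrightarrow> vfunctional e \<and>
     (\<forall>n c. vpair n c \<in> elts e \<longrightarrow> c \<in> D) \<and>
     (\<forall>U\<in>elts \<tau>. (\<exists>x\<in>elts K. rs s x \<in> elts U) \<longrightarrow> (\<exists>c\<in>elts U. \<exists>n\<in>elts vomega. vpair n c \<in> elts e))" for e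
  proof -
    have "(\<exists>y\<in>elts U. vpair x y \<in> elts (vapp r s)) \<longleftrightarrow> rs s x \<in> elts U" if "x \<in> elts K" for x U
      using rs_mem[OF sG that] by auto
    then show ?thesis
      by (simp add: dense_prop_def env_def eval_nat_numeral cong: bex_cong)
  qed
  obtain C where C: "countable C" "C \<subseteq> rs s ` topspace X" "rs s ` topspace X \<subseteq> X closure_of C"
    using countable_dense_subset[OF sG] by auto
  obtain e where e: "vfunctional e" "\<forall>n c. vpair n c \<in> elts e \<longrightarrow> c \<in> C" "\<forall>c\<in>C. \<exists>n\<in>elts vomega. vpair n c \<in> elts e"
    using ex_enumeration[OF C(1)] by auto
  have CD: "C \<subseteq> D" using C(2) sG unfolding induced_set_def by auto
  have "\<exists>c\<in>elts U. \<exists>n\<in>elts vomega. vpair n c \<in> elts e" if U: "U \<in> elts \<tau>" "x \<in> elts K" "rs s x \<in> elts U" for U x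
  proof -
    have "rs s x \<in> X closure_of C" using C(3) U(2) by auto
    moreover have "openin X (elts U)" using U(1) openin_iff by auto
    ultimately obtain c where "c \<in> C" "c \<in> elts U" using U(3) unfolding in_closure_of by blast
    then show ?thesis using e(3) by (rule_tac bexI[of _ c]) auto
  qed
  then have "dense_prop (env [e, vomega, vset D, \<tau>, K, vapp r s])"
    unfolding dp using e(1,2) CD by blast
  then obtain e' where e': "e' \<in> elts M" "dense_prop (env [e', vomega, vset D, \<tau>, K, vapp r s])"
    using witness[of dense_prop "[vomega, vset D, \<tau>, K, vapp r s]" e] params omega r_in_M[OF s]
    by (auto simp: model_props_def)
  show ?thesis
  proof (clarsimp simp: in_closure_of)
    fix x assume x: "x \<in> elts K"
    show "rs s x \<in> elts K \<and> (\<forall>U. rs s x \<in> U \<and> openin X U \<longrightarrow> (\<exists>y. y \<in> D \<and> y \<in> elts M \<and> y \<in> U))"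
    proof (intro conjI allI impI)
      show "rs s x \<in> elts K" using in_space[OF sG, of x] x by simp
      fix U assume "rs s x \<in> U \<and> openin X U"
      then obtain u where "u \<in> elts \<tau>" "U = elts u" "rs s x \<in> elts u" using openin_iff by auto
      then obtain c n where "c \<in> U" "n \<in> elts vomega" "vpair n c \<in> elts e'"
        using e'(2) x unfolding dp by blast
      then show "\<exists>y. y \<in> D \<and> y \<in> elts M \<and> y \<in> U"
        using e' enumerated_in_M unfolding dp by blast
    qed
  qed
qed

lemma limrange_eq: "limrange T = X closure_of (D \<inter> elts M)"
proof
  show "limrange T \<subseteq> X closure_of (D \<inter> elts M)"
    unfolding limrange_def by (rule closure_of_minimal) (use image_subset_closure in auto)
  have "D \<inter> elts M \<subseteq> limrange T"
  proof
    fix x assume "x \<in> D \<inter> elts M"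
    then obtain s where s: "s \<in> T" "rs s x = x" "x \<in> elts K" using fixing_index D_subset by blast
    then have "rs s x \<in> limrange T" using image_subset_limrange[of s] by auto
    then show "x \<in> limrange T" using s by simp
  qed
  then show "X closure_of (D \<inter> elts M) \<subseteq> limrange T" using limrange_closed by (rule closure_of_minimal)
qed

text \<open>By \<open>factor_through\<close> and closure under witnesses, \<open>f\<close> factors
  through some \<open>r t\<close> with \<open>t\<close> in \<open>M\<close>, and
  \<open>rlim T\<close> does not change the coordinate \<open>t\<close>.\<close>

lemma rlim_preserves:
  assumes f: "f \<in> mspace (cspace X)" "vcfun X f \<in> elts M" and x: "x \<in> elts K"
  shows "f (rlim T x) = f x"
proof -
  have fp: "factor_prop (env [s, \<Gamma>, r, K, vcfun X f]) \<longleftrightarrow> s \<in> elts \<Gamma> \<and> (\<forall>x\<in>elts K. f (rs s x) = f x)" for s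
  proof -
    have "factor_prop (env [s, \<Gamma>, r, K, vcfun X f]) \<longleftrightarrow> s \<in> elts \<Gamma> \<and> (\<exists>g. vpair s g \<in> elts r \<and>
       (\<forall>x\<in>elts K. \<exists>y v. vpair x y \<in> elts g \<and> vpair x v \<in> elts (vcfun X f) \<and> vpair y v \<in> elts (vcfun X f)))"
      by (simp add: factor_prop_def env_def eval_nat_numeral)
    also have "\<dots> \<longleftrightarrow> s \<in> elts \<Gamma> \<and>
       (\<forall>x\<in>elts K. \<exists>y v. vpair x y \<in> elts (vapp r s) \<and> vpair x v \<in> elts (vcfun X f) \<and> vpair y v \<in> elts (vcfun X f))"
      using r_mem[of s] by auto
    also have "\<dots> \<longleftrightarrow> s \<in> elts \<Gamma> \<and> (\<forall>x\<in>elts K. f (rs s x) = f x)"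
      using rs_mem[of s] in_space[of s] by auto
    finally show ?thesis .
  qed
  have fc: "continuous_map X euclideanreal f" using f(1) cfun_iff by auto
  obtain s where "s \<in> elts \<Gamma>" "\<forall>x\<in>topspace X. f (rs s x) = f x" using factor_through[OF fc] by auto
  then have "factor_prop (env [s, \<Gamma>, r, K, vcfun X f])" unfolding fp by simp
  then obtain t where "t \<in> elts M" "factor_prop (env [t, \<Gamma>, r, K, vcfun X f])"
    using witness[of factor_prop "[\<Gamma>, r, K, vcfun X f]" s] params f(2) by (auto simp: model_props_def)
  then have t: "t \<in> T" "\<forall>x\<in>elts K. f (rs t x) = f x" unfolding fp by auto
  have "f (rlim T x) = f (rs t (rlim T x))" using t(2) rlim_in[of x] x by simp
  also have "\<dots> = f (rs t x)" using r_rlim[OF t(1), of x] x by simp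
  also have "\<dots> = f x" using t(2) x by auto
  finally show ?thesis .
qed

text \<open>Distinct points of \<open>limrange T\<close> differ under some \<open>r s\<close> with
  \<open>s\<close> in \<open>M\<close>. The countable subfamily of \<open>A\<close> that detects all
  differences under \<open>r s\<close> can be enumerated in \<open>M\<close>, although the two
  points themselves need not be in \<open>M\<close>.\<close>

lemma separates_limrange:
  assumes A: "A \<subseteq> mspace (cspace X)" "separates_points A (elts K)" "vset (vcfun X ` A) \<in> elts M"
  shows "separates_points {f \<in> A. vcfun X f \<in> elts M} (limrange T)"
  unfolding separates_points_def
proof (intro ballI impI)
  fix x y assume xy: "x \<in> limrange T" "y \<in> limrange T" "x \<noteq> y"
  obtain s where s: "s \<in> T" "rs s x \<noteq> rs s y" using limrange_eqI[OF xy(1,2)] xy(3) by auto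
  have sG: "s \<in> elts \<Gamma>" using s by auto
  have xyK: "x \<in> elts K" "y \<in> elts K" using xy limrange_in_space by auto
  let ?A = "vset (vcfun X ` A)"
  have sp: "separating_prop (env [e, vomega, ?A, K, vapp r s]) \<longleftrightarrow> vfunctional e \<and>
     (\<forall>n c. vpair n c \<in> elts e \<longrightarrow> c \<in> vcfun X ` A) \<and>
     (\<forall>x\<in>elts K. \<forall>y\<in>elts K. rs s x \<noteq> rs s y \<longrightarrow>
       (\<exists>n\<in>elts vomega. \<exists>f. vpair n f \<in> elts e \<and> \<not> (\<exists>v. vpair x v \<in> elts f \<and> vpair y v \<in> elts f)))" for e
  proof -
    have "(\<exists>z. vpair x z \<in> elts (vapp r s) \<and> vpair y z \<in> elts (vapp r s)) \<longleftrightarrow> rs s x = rs s y"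
      if "x \<in> elts K" "y \<in> elts K" for x y
      using rs_mem[OF sG that(1)] rs_mem[OF sG that(2)] by auto
    then show ?thesis
      by (simp add: separating_prop_def env_def eval_nat_numeral cong: ball_cong)
  qed
  obtain A' where A': "countable A'" "A' \<subseteq> A"
    "\<forall>x\<in>topspace X. \<forall>y\<in>topspace X. rs s x \<noteq> rs s y \<longrightarrow> (\<exists>f\<in>A'. f x \<noteq> f y)"
    using countable_separating_subset[OF sG, of A] A(1,2) cfun_iff by auto
  obtain e where e: "vfunctional e" "\<forall>n c. vpair n c \<in> elts e \<longrightarrow> c \<in> vcfun X ` A'"
      "\<forall>c\<in>vcfun X ` A'. \<exists>n\<in>elts vomega. vpair n c \<in> elts e"
    using ex_enumeration[of "vcfun X ` A'"] A'(1) by auto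
  have "\<exists>n\<in>elts vomega. \<exists>f. vpair n f \<in> elts e \<and> \<not> (\<exists>v. vpair x v \<in> elts f \<and> vpair y v \<in> elts f)"
    if xy: "x \<in> elts K" "y \<in> elts K" "rs s x \<noteq> rs s y" for x y
  proof -
    obtain f where f: "f \<in> A'" "f x \<noteq> f y" using A'(3) xy by auto
    then obtain n where "n \<in> elts vomega" "vpair n (vcfun X f) \<in> elts e" using e(3) by auto
    moreover have "\<not> (\<exists>v. vpair x v \<in> elts (vcfun X f) \<and> vpair y v \<in> elts (vcfun X f))" using f(2) by simp
    ultimately show ?thesis by blast
  qed
  then have "separating_prop (env [e, vomega, ?A, K, vapp r s])" unfolding sp using e(1,2) A'(2) by blast
  then obtain e' where e': "e' \<in> elts M" "separating_prop (env [e', vomega, ?A, K, vapp r s])"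
    using witness[of separating_prop "[vomega, ?A, K, vapp r s]" e] params omega r_in_M[OF s(1)] A(3)
    by (auto simp: model_props_def)
  obtain n g where g: "n \<in> elts vomega" "vpair n g \<in> elts e'" "\<not> (\<exists>v. vpair x v \<in> elts g \<and> vpair y v \<in> elts g)"
    using e'(2) s(2) xyK unfolding sp by blast
  have gM: "g \<in> elts M" using enumerated_in_M[OF e'(1) _ g(1,2)] e'(2) unfolding sp by blast
  obtain f where f: "f \<in> A" "g = vcfun X f" using e'(2) g(2) unfolding sp by blast
  have "f x \<noteq> f y" using g(3) xyK unfolding f(2) by auto
  then show "\<exists>f\<in>{f \<in> A. vcfun X f \<in> elts M}. f x \<noteq> f y" using f gM by blast
qed

lemma cfuns_in_M: "vset (vcfun X ` mspace (cspace X)) \<in> elts M"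
proof -
  have "cfuns_prop (env [vset (vcfun X ` mspace (cspace X)), K, \<tau>, vset (range vreal), vopen_reals])"
    unfolding cfuns_prop_iff by (rule refl)
  then obtain A where "A \<in> elts M" "cfuns_prop (env [A, K, \<tau>, vset (range vreal), vopen_reals])"
    using witness[of cfuns_prop "[K, \<tau>, vset (range vreal), vopen_reals]" "vset (vcfun X ` mspace (cspace X))"] params
    by (auto simp: model_props_def)
  then show ?thesis unfolding cfuns_prop_iff by simp
qed

lemma cfuns_separate: "separates_points (mspace (cspace X)) (elts K)"
  unfolding separates_points_def
proof (intro ballI impI)
  fix x y assume xy: "x \<in> elts K" "y \<in> elts K" "x \<noteq> y"
  have cr: "completely_regular_space X" using rskel unfolding retractional_skeleton_def tychonoff_space_def by auto
  have "closedin X {y}" using Hausdorff xy by (simp add: closedin_Hausdorff_singleton)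
  then obtain f where f: "continuous_map X (top_of_set {0..1::real}) f" "f x = 0" "f ` {y} \<subseteq> {1}"
    using cr xy unfolding completely_regular_space_def by (metis Diff_iff singletonD topspace_eq)
  have "continuous_map X euclideanreal f" using f(1) by (simp add: continuous_map_in_subtopology)
  then have "continuous_map X euclideanreal (restrict f (elts K))" by (rule continuous_map_eq) simp
  then have "restrict f (elts K) \<in> mspace (cspace X)" unfolding cfun_iff by simp
  moreover have "restrict f (elts K) x \<noteq> restrict f (elts K) y" using f xy by simp
  ultimately show "\<exists>f\<in>mspace (cspace X). f x \<noteq> f y" by blast
qed

text \<open>For uniqueness, the images of \<open>x\<close> under two candidates both lie in
  \<open>limrange T\<close>, whose points are separated by functions in \<open>M\<close>; but each
  such function takes the value \<open>f x\<close> at both images.\<close>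

lemma canonical_rlim: "canonical_retraction X D M (rlim T)"
proof -
  have fits: "fits_model X D M (rlim T)"
    unfolding fits_model_def
  proof (intro conjI ballI impI)
    show "f x = f (rlim T x)" if "f \<in> mspace (cspace X)" "vcfun X f \<in> elts M" "x \<in> topspace X" for f x
      using rlim_preserves[OF that(1,2)] that(3) by simp
  qed (use rlim_retraction rlim_image limrange_eq in auto)
  have "\<rho> x = rlim T x" if \<rho>: "fits_model X D M \<rho>" and x: "x \<in> topspace X" for \<rho> x
  proof (rule ccontr)
    assume ne: "\<rho> x \<noteq> rlim T x"
    have "\<rho> x \<in> limrange T" using \<rho> x unfolding limrange_eq fits_model_def by blast
    moreover have "rlim T x \<in> limrange T" using rlim_in_limrange x by auto
    ultimately obtain f where f: "f \<in> mspace (cspace X)" "vcfun X f \<in> elts M" "f (\<rho> x) \<noteq> f (rlim T x)"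
      using separates_limrange[OF subset_refl cfuns_separate cfuns_in_M] ne
      unfolding separates_points_def by blast
    have "f (\<rho> x) = f x" using \<rho> f(1,2) x unfolding fits_model_def by metis
    then show False using f(3) rlim_preserves[OF f(1,2)] x by simp
  qed
  then show ?thesis using fits unfolding canonical_retraction_def by blast
qed

text \<open>Reduces the weight of the range to the size of \<open>M\<close>. Inside the range some
  fibre of an \<open>r s\<close> with \<open>s\<close> in \<open>M\<close> controls the given
  neighbourhood, and the countable base for the fibres of \<open>r s\<close> is enumerated in
  \<open>M\<close>.\<close>

lemma base_limrange: "base_of (subtopology X (limrange T)) {limrange T \<inter> elts U |U. U \<in> elts \<tau> \<inter> elts M}"
  unfolding base_of_def
proof (intro conjI ballI allI impI)
  fix V assume "V \<in> {limrange T \<inter> elts U |U. U \<in> elts \<tau> \<inter> elts M}"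
  then show "openin (subtopology X (limrange T)) V"
    using openin_iff by (auto simp: openin_subtopology_Int2)
next
  fix W y assume "openin (subtopology X (limrange T)) W \<and> y \<in> W"
  then obtain V where V: "openin X V" "W = V \<inter> limrange T" "y \<in> V" "y \<in> limrange T"
    unfolding openin_subtopology by auto
  have yK: "y \<in> elts K" using V limrange_in_space by auto
  obtain s where s: "s \<in> T" "\<forall>z\<in>limrange T. rs s z = rs s y \<longrightarrow> z \<in> V"
    using limrange_nbhd[OF V(4,3,1)] by auto
  have sG: "s \<in> elts \<Gamma>" using s by auto
  \<comment> \<open>The base for fibres needs an open set containing the full fibre in
    \<open>K\<close>, but only the part of the fibre in \<open>limrange T\<close> is known to be in
    \<open>V\<close>. Adding the open complement of \<open>limrange T\<close> closes this gap and
    does not change the trace on it.\<close>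
  define V' where "V' = V \<union> (topspace X - limrange T)"
  have "openin X V'" unfolding V'_def using V(1) limrange_closed by blast
  then obtain v where v: "v \<in> elts \<tau>" "V' = elts v" using openin_iff by auto
  have fib: "\<forall>z\<in>elts K. rs s z = rs s y \<longrightarrow> z \<in> elts v"
    using s(2) unfolding v(2)[symmetric] V'_def by auto
  have bp: "base_prop (env [e, vomega, \<tau>, K, vapp r s]) \<longleftrightarrow> vfunctional e \<and>
     (\<forall>n c. vpair n c \<in> elts e \<longrightarrow> c \<in> elts \<tau>) \<and>
     (\<forall>V\<in>elts \<tau>. \<forall>x\<in>elts K. (\<forall>z\<in>elts K. rs s z = rs s x \<longrightarrow> z \<in> elts V) \<longrightarrow>
        (\<exists>n\<in>elts vomega. \<exists>U. vpair n U \<in> elts e \<and> x \<in> elts U \<and> (\<forall>w\<in>elts U. w \<in> elts V)))" for e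
  proof -
    have "(\<exists>y. vpair x y \<in> elts (vapp r s) \<and> vpair z y \<in> elts (vapp r s)) \<longleftrightarrow> rs s z = rs s x"
      if "x \<in> elts K" "z \<in> elts K" for x z
      using rs_mem[OF sG that(1)] rs_mem[OF sG that(2)] by auto
    then show ?thesis
      by (simp add: base_prop_def env_def eval_nat_numeral cong: ball_cong)
  qed
  obtain B where B: "countable B" "\<forall>U\<in>B. openin X U"
    "\<forall>V x. openin X V \<longrightarrow> x \<in> topspace X \<longrightarrow> (\<forall>z\<in>topspace X. rs s z = rs s x \<longrightarrow> z \<in> V) \<longrightarrow>
      (\<exists>U\<in>B. x \<in> U \<and> U \<subseteq> V)"
    by (rule countable_base[OF sG])
  have Bv: "elts (vset U) = U" "vset U \<in> elts \<tau>" if "U \<in> B" for U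
    using B(2) that openin_iff[of U] by auto
  obtain e where e: "vfunctional e" "\<forall>n c. vpair n c \<in> elts e \<longrightarrow> c \<in> vset ` B"
      "\<forall>c\<in>vset ` B. \<exists>n\<in>elts vomega. vpair n c \<in> elts e"
    using ex_enumeration[of "vset ` B"] B(1) by auto
  have "\<exists>n\<in>elts vomega. \<exists>U. vpair n U \<in> elts e \<and> x \<in> elts U \<and> (\<forall>w\<in>elts U. w \<in> elts V)"
    if V: "V \<in> elts \<tau>" "x \<in> elts K" "\<forall>z\<in>elts K. rs s z = rs s x \<longrightarrow> z \<in> elts V" for V x
  proof -
    have "openin X (elts V)" using V(1) openin_iff by auto
    then obtain U where U: "U \<in> B" "x \<in> U" "U \<subseteq> elts V"
      using B(3)[rule_format, of "elts V" x] V(2,3) by auto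
    have "U \<subseteq> elts K" using B(2) U(1) openin_subset[of X U] by auto
    then have "\<forall>w\<in>U. w \<in> elts V" using U(3) by blast
    moreover obtain n where "n \<in> elts vomega" "vpair n (vset U) \<in> elts e" using e(3) U(1) by blast
    ultimately show ?thesis using Bv(1)[OF U(1)] U(2) by (intro bexI[of _ n] exI[of _ "vset U"]) auto
  qed
  then have "base_prop (env [e, vomega, \<tau>, K, vapp r s])" unfolding bp using e(1,2) Bv(2) by blast
  then obtain e' where e': "e' \<in> elts M" "base_prop (env [e', vomega, \<tau>, K, vapp r s])"
    using witness[of base_prop "[vomega, \<tau>, K, vapp r s]" e] params omega r_in_M[OF s(1)]
    by (auto simp: model_props_def)
  obtain n U where U: "n \<in> elts vomega" "vpair n U \<in> elts e'" "y \<in> elts U" "\<forall>w\<in>elts U. w \<in> elts v"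
    using e'(2) v(1) yK fib unfolding bp by blast
  have "U \<in> elts M" using enumerated_in_M[OF e'(1) _ U(1,2)] e'(2) unfolding bp by blast
  moreover have "U \<in> elts \<tau>" using e'(2) U(2) unfolding bp by blast
  moreover have "limrange T \<inter> elts U \<subseteq> W" using U(4) V(2) unfolding v(2)[symmetric] V'_def by auto
  ultimately show "\<exists>V\<in>{limrange T \<inter> elts U |U. U \<in> elts \<tau> \<inter> elts M}. y \<in> V \<and> V \<subseteq> W"
    using U(3) V(4) by blast
qed

lemma weight_limrange: "vle (weight (subtopology X (limrange T))) (vcard M)"
proof (rule weight_props(4)[OF base_limrange])
  have "{limrange T \<inter> elts U |U. U \<in> elts \<tau> \<inter> elts M} = (\<lambda>U. limrange T \<inter> elts U) ` (elts \<tau> \<inter> elts M)" by auto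
  also have "\<dots> \<lesssim> elts \<tau> \<inter> elts M" by (rule image_lepoll)
  also have "\<dots> \<lesssim> elts M" by (rule subset_imp_lepoll) auto
  finally show "{limrange T \<inter> elts U |U. U \<in> elts \<tau> \<inter> elts M} \<lesssim> elts M" .
qed

text \<open>A model containing all indices of the base \<open>\<U>\<close> meets \<open>D\<close> in a dense set.\<close>

lemma rlim_id:
  assumes U: "vfunction \<U> I (elts \<tau>)" "\<U> \<in> elts M" "I \<subseteq> elts M"
    "base_of X {elts (vapp \<U> i) |i. i \<in> I}" and x: "x \<in> elts K"
  shows "rlim T x = x"
proof (rule rlim_limrange)
  show "x \<in> limrange T"
    unfolding limrange_eq in_closure_of
  proof (intro conjI allI impI)
    fix W assume W: "x \<in> W \<and> openin X W"
    obtain i where i: "i \<in> I" "x \<in> elts (vapp \<U> i)" "elts (vapp \<U> i) \<subseteq> W"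
      using U(4) W unfolding base_of_def by blast
    have VM: "vapp \<U> i \<in> elts M"
    proof (rule value_in_M[OF U(2)])
      show "i \<in> elts M" using U(3) i(1) by auto
      show "vpair i (vapp \<U> i) \<in> elts \<U>" using vapp_eq[OF U(1) i(1)] by simp
      show "z = vapp \<U> i" if "vpair i z \<in> elts \<U>" for z using that vapp_eq[OF U(1) i(1)] by simp
    qed
    have "openin X (elts (vapp \<U> i))" using U(4) i(1) unfolding base_of_def by blast
    \<comment> \<open>Since \<open>r s x\<close> tends to \<open>x\<close>, the basic set meets
      \<open>D\<close>. Both sets are in \<open>M\<close>, so they have a common point in
      \<open>M\<close>.\<close>
    then obtain s0 where s0: "s0 \<in> elts \<Gamma>" "\<forall>s\<in>elts \<Gamma>. le s0 s \<longrightarrow> rs s x \<in> elts (vapp \<U> i)"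
      using net_limit[of x] x i(2) eventually_net_filter[OF directed poset] unfolding limitin_def by auto
    have "rs s0 x \<in> elts (vapp \<U> i)" "rs s0 x \<in> D"
      using s0 le_refl x unfolding induced_set_def by auto
    then obtain d where "d \<in> elts M" "meet_prop (env [d, vapp \<U> i, vset D])"
      using witness[of meet_prop "[vapp \<U> i, vset D]" "rs s0 x"] VM params
      by (auto simp: model_props_def meet_prop_def env_def)
    then have "d \<in> D \<inter> elts M" "d \<in> W" using i(3) by (auto simp: meet_prop_def env_def)
    then show "\<exists>y. y \<in> D \<inter> elts M \<and> y \<in> W" by (intro exI[of _ d] conjI)
  qed (use x in simp)
qed

end

section \<open>Chains of models\<close>

lemma sigma_closure_mono: "A \<subseteq> B \<Longrightarrow> sigma_closure G le A \<subseteq> sigma_closure G le B"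
  unfolding sigma_closure_def by (rule Inter_anti_mono) auto

lemma poset_vle: "poset_on A vle"
  unfolding poset_on_def
  by (auto intro!: reflp_onI antisymp_onI transp_onI intro: vle_antisym vle_trans)

lemma up_directed_vle:
  assumes "vord \<alpha>" "\<alpha> \<noteq> vzero"
  shows "up_directed (elts \<alpha>) vle"
  unfolding up_directed_def
proof (intro conjI ballI)
  show "elts \<alpha> \<noteq> {}" using assms(2) elts_inject[of \<alpha> vzero] by auto
  fix s t assume st: "s \<in> elts \<alpha>" "t \<in> elts \<alpha>"
  then have "vord s" "vord t" using vord_mem[OF assms(1)] by auto
  then show "\<exists>u\<in>elts \<alpha>. vle s u \<and> vle t u"
    using vle_linear[of s t] vle_mem[of s t] st vle_refl by blast
qed

lemma net_vle_nontrivial: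
  assumes "vord \<alpha>" "\<alpha> \<noteq> vzero"
  shows "net_filter (elts \<alpha>) vle \<noteq> bot"
proof
  assume "net_filter (elts \<alpha>) vle = bot"
  then have "eventually (\<lambda>_. False) (net_filter (elts \<alpha>) vle)" by simp
  then obtain s where "s \<in> elts \<alpha>" "\<forall>t\<in>elts \<alpha>. \<not> vle s t"
    unfolding eventually_net_filter[OF up_directed_vle[OF assms] poset_vle] by auto
  then show False using vle_refl by auto
qed

lemma limit_is_sup:
  assumes "vlimit \<xi>"
  shows "is_sup (Collect vord) vle (elts \<xi>) \<xi>"
proof -
  have o: "vord \<xi>" using assms by (simp add: vlimit_def)
  have "vle \<xi> u" if u: "vord u" "\<forall>a\<in>elts \<xi>. vle a u" for u
  proof (rule ccontr)
    assume "\<not> vle \<xi> u"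
    then have "u \<in> elts \<xi>" using vle_linear[OF o u(1)] by auto
    then have "vle (vsucc u) u" using assms u(2) by (simp add: vlimit_def)
    then show False by (simp add: vle_def)
  qed
  then show ?thesis using o vle_mem[OF o] by (auto simp: is_sup_def)
qed

context skeleton
begin

text \<open>\<open>rlim T' x\<close> has the coordinates of \<open>x\<close> for all indices in
  \<open>T\<close>, and the range grows with the index set, so \<open>rlim T'\<close> fixes the
  range of \<open>rlim T\<close>.\<close>

lemma rlim_nested:
  assumes "subskeleton X G le r T" "subskeleton X G le r T'" "T \<subseteq> T'" and x: "x \<in> topspace X"
  shows "rlim T (rlim T' x) = rlim T x" "rlim T' (rlim T x) = rlim T x" "rlim T x \<in> limrange T'"
proof -
  interpret S: subskeleton X G le r T by fact
  interpret S': subskeleton X G le r T' by fact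
  show "rlim T (rlim T' x) = rlim T x"
    by (rule S.rlim_eqI) (use assms(3) x in auto)
  have "limrange T \<subseteq> limrange T'"
    unfolding limrange_def by (rule closure_of_mono) (use assms(3) in auto)
  then show "rlim T x \<in> limrange T'" using S.rlim_in_limrange[OF x] by auto
  then show "rlim T' (rlim T x) = rlim T x" by (rule S'.rlim_limrange)
qed

text \<open>In the commutative case a retraction \<open>r u\<close> fixing \<open>x\<close> also
  fixes every \<open>r s x\<close>, so the limit stays in the closed range of
  \<open>r u\<close>.\<close>

lemma rlim_induced:
  assumes "subskeleton X G le r T" "full_skeleton X G r \<or> commutative_skeleton X G r"
    and x: "x \<in> induced_set X G r"
  shows "rlim T x \<in> induced_set X G r"
proof -
  interpret S: subskeleton X G le r T by fact
  obtain u where u: "u \<in> G" "x \<in> r u ` topspace X" using x by (auto simp: induced_set_def)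
  then have ux: "x \<in> topspace X" "r u x = x" using image_eq by auto
  show ?thesis using assms(2)
  proof
    assume "full_skeleton X G r"
    then show ?thesis using S.rlim_in[OF ux(1)] by (simp add: full_skeleton_def)
  next
    assume c: "commutative_skeleton X G r"
    obtain s0 where s0: "s0 \<in> T" using S.Tdir by (auto simp: up_directed_def)
    have "r u (r s x) = r s x" if "s \<in> T" for s
      using c u(1) that S.TG ux unfolding commutative_skeleton_def by (metis subsetD)
    then have "r s x \<in> r u ` topspace X" if "s \<in> T" for s
      using that ux image_eq[OF u(1)] by auto
    then have "rlim T x \<in> r u ` topspace X"
      using limitin_closedin[OF S.rlim_limit[OF ux(1)] image_closed[OF u(1)] _ S.net_nontrivial]
        S.ev_netI[OF s0] by auto
    then show ?thesis using u(1) by (auto simp: induced_set_def)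
  qed
qed

end

section \<open>The retractions along a continuous increasing chain of models\<close>

locale model_chain = coded_skeleton +
  fixes \<U> M
  assumes Ufun: "vfunction \<U> (elts (weight X)) (elts \<tau>)"
    and Ubase: "base_of X {elts (vapp \<U> i) |i. i \<in> elts (weight X)}"
    and Ra: "\<And>\<alpha>. \<alpha> \<in> elts (vsucc (weight X)) \<Longrightarrow> elementary K \<tau> \<Gamma> leq r (M \<alpha>)"
      "\<And>\<alpha>. \<alpha> \<in> elts (vsucc (weight X)) \<Longrightarrow> \<U> \<in> elts (M \<alpha>)"
    and Rb: "\<And>\<alpha>. \<alpha> \<in> elts (vsucc (weight X)) \<Longrightarrow> vle (vcard (M \<alpha>)) (vmax vomega (vcard \<alpha>))"
    and Rc: "\<And>\<alpha>. \<alpha> \<in> elts (weight X) \<Longrightarrow> elts (M \<alpha>) \<union> {\<alpha>} \<subseteq> elts (M (vsucc \<alpha>))"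
    and Rd: "\<And>\<alpha>. \<alpha> \<in> elts (vsucc (weight X)) \<Longrightarrow> vlimit \<alpha> \<Longrightarrow> elts (M \<alpha>) = (\<Union>\<beta>\<in>elts \<alpha>. elts (M \<beta>))"
begin

abbreviation "\<kappa> \<equiv> weight X"
abbreviation "stages \<equiv> elts (vsucc \<kappa>)"
abbreviation "T \<alpha> \<equiv> elts \<Gamma> \<inter> elts (M \<alpha>)"
abbreviation "\<rho> \<alpha> \<equiv> rlim (T \<alpha>)"

lemma base_lepoll: "{elts (vapp \<U> i) |i. i \<in> elts \<kappa>} \<lesssim> elts \<kappa>"
proof -
  have "{elts (vapp \<U> i) |i. i \<in> elts \<kappa>} = (\<lambda>i. elts (vapp \<U> i)) ` elts \<kappa>" by auto
  then show ?thesis by (simp add: image_lepoll)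
qed

lemma ord_weight [simp]: "vord \<kappa>"
  by (rule weight_props(1)[OF Ubase base_lepoll])

lemma upto_ord: "\<alpha> \<in> stages \<Longrightarrow> vord \<alpha>"
  using vord_mem[OF vord_succ[OF ord_weight]] .

lemma mem_upto: "\<beta> \<in> stages \<Longrightarrow> \<alpha> \<in> elts \<beta> \<Longrightarrow> \<alpha> \<in> elts \<kappa>"
  using vord_trans[OF ord_weight] by auto

lemma less_upto: "\<alpha> \<in> elts \<kappa> \<Longrightarrow> \<alpha> \<in> stages" by simp

lemma sub: "\<alpha> \<in> stages \<Longrightarrow> subskeleton X (elts \<Gamma>) le rs (T \<alpha>)"
  using elementary.subskeleton_T[OF Ra(1)] .

lemma M_mono_less:
  assumes "\<beta> \<in> stages" "\<alpha> \<in> elts \<beta>"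
  shows "elts (M \<alpha>) \<subseteq> elts (M \<beta>)"
proof -
  have "\<beta> \<in> stages \<longrightarrow> (\<forall>\<alpha>\<in>elts \<beta>. elts (M \<alpha>) \<subseteq> elts (M \<beta>))"
    using upto_ord[OF assms(1)]
  proof (induction rule: vord_induct)
    case (less \<beta>)
    show ?case
    proof (intro impI ballI)
      fix \<alpha> assume b: "\<beta> \<in> stages" and a: "\<alpha> \<in> elts \<beta>"
      show "elts (M \<alpha>) \<subseteq> elts (M \<beta>)"
        using less(1)
      proof (cases rule: vord_cases)
        case 1
        then show ?thesis using a by simp
      next
        case (2 \<gamma>)
        have g: "\<gamma> \<in> elts \<beta>" "\<gamma> \<in> elts \<kappa>" using 2 mem_upto[OF b, of \<gamma>] by auto
        have "elts (M \<gamma>) \<subseteq> elts (M \<beta>)" using Rc[OF g(2)] 2 by auto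
        moreover have "elts (M \<alpha>) \<subseteq> elts (M \<gamma>)"
          using less(2)[OF g(1)] less_upto[OF g(2)] a 2 by auto
        ultimately show ?thesis by auto
      next
        case 3
        then show ?thesis using Rd[OF b] a by auto
      qed
    qed
  qed
  then show ?thesis using assms by auto
qed

lemma M_mono: "\<beta> \<in> stages \<Longrightarrow> \<alpha> \<in> stages \<Longrightarrow> vle \<alpha> \<beta> \<Longrightarrow> elts (M \<alpha>) \<subseteq> elts (M \<beta>)"
  using M_mono_less[of \<beta> \<alpha>] vle_iff[OF upto_ord upto_ord] by blast

lemma T_mono: "\<beta> \<in> stages \<Longrightarrow> \<alpha> \<in> stages \<Longrightarrow> vle \<alpha> \<beta> \<Longrightarrow> T \<alpha> \<subseteq> T \<beta>"
  using M_mono by blast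

lemma R1:
  assumes "\<beta> \<in> stages" "\<alpha> \<in> stages" "vle \<alpha> \<beta>" "x \<in> elts K"
  shows "\<rho> \<alpha> (\<rho> \<beta> x) = \<rho> \<alpha> x" "\<rho> \<beta> (\<rho> \<alpha> x) = \<rho> \<alpha> x" "\<rho> \<alpha> x \<in> limrange (T \<beta>)"
  using rlim_nested[OF sub[OF assms(2)] sub[OF assms(1)] T_mono[OF assms(1-3)]] assms(4) by auto

text \<open>An index \<open>\<alpha>\<close> of the base belongs to
  \<open>M (vsucc \<alpha>)\<close> by (Rc), and this stage is at most \<open>\<kappa>\<close>; so
  the last model contains all indices of the base and \<open>rlim_id\<close> applies.\<close>

lemma R4:
  assumes "x \<in> elts K"
  shows "\<rho> \<kappa> x = x"
proof (rule elementary.rlim_id[OF Ra(1) Ufun Ra(2) _ Ubase assms])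
  show "elts \<kappa> \<subseteq> elts (M \<kappa>)"
  proof
    fix \<alpha> assume a: "\<alpha> \<in> elts \<kappa>"
    have "vle (vsucc \<alpha>) \<kappa>" using vord_trans[OF ord_weight a] a by (simp add: vle_def)
    moreover have "vord \<alpha>" using vord_mem[OF ord_weight a] .
    ultimately have "vsucc \<alpha> \<in> stages" using vle_iff[of "vsucc \<alpha>" \<kappa>] by auto
    then show "\<alpha> \<in> elts (M \<kappa>)"
      using M_mono[of \<kappa> "vsucc \<alpha>"] \<open>vle (vsucc \<alpha>) \<kappa>\<close> Rc[OF a] by auto
  qed
qed auto

text \<open>By (Rd) an index \<open>s\<close> of stage \<open>\<xi>\<close> already belongs to some
  stage \<open>\<gamma>\<close> below \<open>\<xi>\<close>, and \<open>\<eta>\<close> eventually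
  passes \<open>\<gamma>\<close>. From there on \<open>r s\<close> takes the value
  \<open>r s x\<close> on the net, so every coordinate is eventually constant.\<close>

lemma R3:
  assumes \<alpha>: "\<alpha> \<in> stages" and \<xi>: "\<xi> \<in> stages" "vlimit \<xi>"
    and \<eta>: "\<And>\<beta>. \<beta> \<in> elts \<alpha> \<Longrightarrow> \<eta> \<beta> \<in> elts \<kappa>"
      "\<And>\<beta> \<gamma>. \<beta> \<in> elts \<alpha> \<Longrightarrow> \<gamma> \<in> elts \<alpha> \<Longrightarrow> vle \<beta> \<gamma> \<Longrightarrow> vle (\<eta> \<beta>) (\<eta> \<gamma>)"
    and sup: "is_sup (Collect vord) vle (\<eta> ` elts \<alpha>) \<xi>" and x: "x \<in> elts K"
  shows "limitin X (\<lambda>\<beta>. \<rho> (\<eta> \<beta>) x) (\<rho> \<xi> x) (net_filter (elts \<alpha>) vle)"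
proof -
  interpret S: subskeleton X "elts \<Gamma>" le rs "T \<xi>" by (rule sub[OF \<xi>(1)])
  have o: "vord \<alpha>" "vord \<xi>" using upto_ord \<alpha> \<xi> by auto
  \<comment> \<open>The supremum of the empty family of ordinals is \<open>vzero\<close>, which is
    not a limit ordinal.\<close>
  have "\<alpha> \<noteq> vzero"
  proof
    assume "\<alpha> = vzero"
    then have "vle \<xi> vzero" using sup vord_zero unfolding is_sup_def by auto
    then have "\<xi> = vzero" by (intro vle_antisym) (auto simp: vle_def)
    then show False using \<xi>(2) by (simp add: vlimit_def)
  qed
  note ev = eventually_net_filter[OF up_directed_vle[OF o(1) this] poset_vle]
  have le_\<xi>: "vle (\<eta> \<beta>) \<xi>" if "\<beta> \<in> elts \<alpha>" for \<beta> using sup that by (auto simp: is_sup_def)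
  have xX: "x \<in> topspace X" using x by simp
  obtain \<beta>0 where \<beta>0: "\<beta>0 \<in> elts \<alpha>" using \<open>\<alpha> \<noteq> vzero\<close> elts_inject[of \<alpha> vzero] by auto
  show ?thesis
  proof (rule S.limitin_limrangeI)
    show "\<rho> \<xi> x \<in> limrange (T \<xi>)" using S.rlim_in_limrange[OF xX] .
    show "\<forall>\<^sub>F \<beta> in net_filter (elts \<alpha>) vle. \<rho> (\<eta> \<beta>) x \<in> limrange (T \<xi>)"
      unfolding ev using \<beta>0 R1(3)[OF \<xi>(1) _ le_\<xi> x] \<eta>(1) by auto
    fix s assume s: "s \<in> T \<xi>"
    then obtain \<gamma> where g: "\<gamma> \<in> elts \<xi>" "s \<in> T \<gamma>" using Rd[OF \<xi>] by auto
    have og: "vord \<gamma>" using vord_mem[OF o(2) g(1)] .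
    have "\<exists>\<beta>\<in>elts \<alpha>. vle \<gamma> (\<eta> \<beta>)"
    proof (rule ccontr)
      assume n: "\<not> (\<exists>\<beta>\<in>elts \<alpha>. vle \<gamma> (\<eta> \<beta>))"
      have "vle (\<eta> \<beta>) \<gamma>" if b: "\<beta> \<in> elts \<alpha>" for \<beta>
      proof -
        have "vord (\<eta> \<beta>)" using vord_mem[OF ord_weight \<eta>(1)[OF b]] .
        then show ?thesis using n b vle_linear[OF og, of "\<eta> \<beta>"] vle_mem[OF og] by auto
      qed
      then have "vle \<xi> \<gamma>" using sup og by (auto simp: is_sup_def)
      then show False using g(1) by (auto simp: vle_def)
    qed
    then obtain \<beta>1 where b1: "\<beta>1 \<in> elts \<alpha>" "vle \<gamma> (\<eta> \<beta>1)" by auto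
    have "rs s (\<rho> (\<eta> \<beta>) x) = rs s (\<rho> \<xi> x)" if b: "\<beta> \<in> elts \<alpha>" "vle \<beta>1 \<beta>" for \<beta>
    proof -
      have "vle \<gamma> (\<eta> \<beta>)" using vle_trans[OF b1(2) \<eta>(2)[OF b1(1) b]] .
      then have "s \<in> T (\<eta> \<beta>)"
        using g(2) T_mono[of "\<eta> \<beta>" \<gamma>] \<eta>(1)[OF b(1)] mem_upto[OF \<xi>(1) g(1)] by auto
      then have "rs s (\<rho> (\<eta> \<beta>) x) = rs s x"
        using subskeleton.r_rlim[OF sub[of "\<eta> \<beta>"] _ xX] \<eta>(1)[OF b(1)] by auto
      then show ?thesis using S.r_rlim[OF s xX] by simp
    qed
    then show "\<forall>\<^sub>F \<beta> in net_filter (elts \<alpha>) vle. rs s (\<rho> (\<eta> \<beta>) x) = rs s (\<rho> \<xi> x)"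
      unfolding ev using b1(1) by auto
  qed
qed

lemma R3_limit:
  assumes "\<xi> \<in> stages" "vlimit \<xi>" "x \<in> elts K"
  shows "limitin X (\<lambda>\<beta>. \<rho> \<beta> x) (\<rho> \<xi> x) (net_filter (elts \<xi>) vle)"
  using R3[OF assms(1,1,2), of "\<lambda>\<beta>. \<beta>"] limit_is_sup[OF assms(2)] mem_upto[OF assms(1)] assms(3) by simp

lemma weight_nonzero: "x \<in> elts K \<Longrightarrow> \<kappa> \<noteq> vzero"
proof
  assume "x \<in> elts K" "\<kappa> = vzero"
  then show False using Ubase openin_topspace[of X] unfolding base_of_def by fastforce
qed

text \<open>For a limit weight this is (R3) at \<open>\<kappa>\<close> combined with (R4). A
  successor weight is finite, hence a subset of \<open>vomega\<close> and of every model, so all the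
  retractions are the identity. Weight zero is impossible when there is a point.\<close>

lemma R2:
  assumes x: "x \<in> elts K"
  shows "limitin X (\<lambda>\<alpha>. \<rho> \<alpha> x) x (net_filter (elts \<kappa>) vle)"
  using ord_weight
proof (cases rule: vord_cases)
  case 1
  then show ?thesis using weight_nonzero[OF x] by simp
next
  case (2 \<gamma>)
  have "finite (elts \<kappa>)" by (rule weight_succ_finite[OF Ubase base_lepoll 2(1)])
  then have fin: "elts \<kappa> \<subseteq> elts vomega" by (rule finite_vord[OF ord_weight])
  have "\<rho> \<alpha> x = x" if "\<alpha> \<in> elts \<kappa>" for \<alpha>
  proof (rule elementary.rlim_id[OF Ra(1) Ufun Ra(2) _ Ubase x])
    show "elts \<kappa> \<subseteq> elts (M \<alpha>)" using fin elementary.omega(2)[OF Ra(1)[OF less_upto[OF that]]] by auto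
  qed (use that in auto)
  then have "\<forall>\<^sub>F \<alpha> in net_filter (elts \<kappa>) vle. \<rho> \<alpha> x = x"
    unfolding eventually_net_filter[OF up_directed_vle[OF ord_weight weight_nonzero[OF x]] poset_vle]
    using 2 by (intro bexI[of _ \<gamma>]) auto
  then show ?thesis using x by (intro limitin_eventually) auto
next
  case 3
  show ?thesis using R3_limit[OF _ 3 x] R4[OF x] by simp
qed

lemma R5:
  assumes "\<alpha> \<in> stages"
  defines "Y \<equiv> subtopology X (\<rho> \<alpha> ` elts K)" and "G \<equiv> sigma_closure (elts \<Gamma>) le (T \<alpha>)"
  shows "vle (weight Y) (vmax vomega (vcard \<alpha>)) \<and> retractional_skeleton Y G le rs \<and>
    induced_set Y G rs = D \<inter> \<rho> \<alpha> ` elts K"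
proof -
  interpret S: subskeleton X "elts \<Gamma>" le rs "T \<alpha>" by (rule sub[OF assms(1)])
  have im: "\<rho> \<alpha> ` elts K = limrange (T \<alpha>)" using S.rlim_image by simp
  show ?thesis
    unfolding Y_def G_def im
    using vle_trans[OF elementary.weight_limrange[OF Ra(1)[OF assms(1)]] Rb[OF assms(1)]]
      S.limrange_skeleton S.induced_set_limrange by simp
qed

lemma R6:
  assumes "closedin (mtopology_of (cspace X)) A" "\<forall>f\<in>A. \<forall>s\<in>elts \<Gamma>. restrict (f \<circ> rs s) (elts K) \<in> A"
  shows "{restrict (f \<circ> \<rho> \<alpha>) (elts K) |f \<alpha>. f \<in> A \<and> \<alpha> \<in> stages} \<subseteq> A"
proof clarify
  fix f \<alpha> assume f: "f \<in> A" and \<alpha>: "\<alpha> \<in> stages"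
  interpret S: subskeleton X "elts \<Gamma>" le rs "T \<alpha>" by (rule sub[OF \<alpha>])
  show "restrict (f \<circ> \<rho> \<alpha>) (elts K) \<in> A"
    using S.rlim_closed_family[OF assms(1) f] assms(2) f by simp
qed

text \<open>Points on which all retractions agree coincide by (R2), so a least disagreement exists.
  At a limit stage agreement below would carry over by continuity of the chain.\<close>

lemma R7:
  assumes x: "x \<in> elts K" and y: "y \<in> elts K" and ne: "x \<noteq> y"
  shows "\<exists>\<beta>\<in>elts \<kappa>. \<rho> \<beta> x \<noteq> \<rho> \<beta> y \<and> (\<forall>\<alpha>\<in>elts \<kappa>. \<rho> \<alpha> x \<noteq> \<rho> \<alpha> y \<longrightarrow> vle \<beta> \<alpha>) \<and>
    (\<beta> = vzero \<or> (\<exists>\<gamma>. vord \<gamma> \<and> \<beta> = vsucc \<gamma>))"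
proof -
  have net: "\<not> trivial_limit (net_filter (elts \<alpha>) vle)" if "vord \<alpha>" "\<alpha> \<noteq> vzero" for \<alpha> :: 'a
    using net_vle_nontrivial[OF that] by simp
  \<comment> \<open>Agreement below \<open>\<alpha>\<close> forces equal limits at
    \<open>\<alpha>\<close>. It is used with (R2) for existence and with \<open>R3_limit\<close> to
    exclude limit stages.\<close>
  have eq: "a = b" if h: "\<alpha> \<in> stages" "\<alpha> \<noteq> vzero" "\<And>\<beta>. \<beta> \<in> elts \<alpha> \<Longrightarrow> \<rho> \<beta> x = \<rho> \<beta> y"
    "limitin X (\<lambda>\<beta>. \<rho> \<beta> x) a (net_filter (elts \<alpha>) vle)"
    "limitin X (\<lambda>\<beta>. \<rho> \<beta> y) b (net_filter (elts \<alpha>) vle)" for \<alpha> a b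
  proof -
    have o: "vord \<alpha>" using upto_ord h(1) .
    obtain \<beta> where "\<beta> \<in> elts \<alpha>" using up_directed_vle[OF o h(2)] by (auto simp: up_directed_def)
    then have "\<forall>\<^sub>F \<beta> in net_filter (elts \<alpha>) vle. \<rho> \<beta> x = \<rho> \<beta> y"
      unfolding eventually_net_filter[OF up_directed_vle[OF o h(2)] poset_vle] using h(3) by auto
    then have "limitin X (\<lambda>\<beta>. \<rho> \<beta> y) a (net_filter (elts \<alpha>) vle)"
      using h(4) by (rule limitin_transform_eventually)
    then show ?thesis using limitin_Hausdorff_unique[OF _ h(5) net[OF o h(2)] Hausdorff] by simp
  qed
  have "\<exists>\<alpha>\<in>elts \<kappa>. \<rho> \<alpha> x \<noteq> \<rho> \<alpha> y"
    using eq[of \<kappa> x y] weight_nonzero[OF x] R2[OF x] R2[OF y] ne by auto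
  then obtain \<alpha> where \<alpha>: "\<alpha> \<in> elts \<kappa>" "\<rho> \<alpha> x \<noteq> \<rho> \<alpha> y" by auto
  obtain \<beta> where \<beta>: "vord \<beta>" "\<rho> \<beta> x \<noteq> \<rho> \<beta> y" "\<And>\<gamma>. \<gamma> \<in> elts \<beta> \<Longrightarrow> \<not> (\<rho> \<gamma> x \<noteq> \<rho> \<gamma> y)" "\<beta> \<in> elts (vsucc \<alpha>)"
    by (rule vord_least[OF vord_mem[OF ord_weight \<alpha>(1)], of "\<lambda>\<beta>. \<rho> \<beta> x \<noteq> \<rho> \<beta> y"]) (use \<alpha> in auto)
  have \<beta>\<kappa>: "\<beta> \<in> elts \<kappa>" using \<beta>(4) \<alpha>(1) vord_trans[OF ord_weight \<alpha>(1)] by auto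
  have min: "vle \<beta> \<gamma>" if "\<gamma> \<in> elts \<kappa>" "\<rho> \<gamma> x \<noteq> \<rho> \<gamma> y" for \<gamma>
    using vle_linear[OF \<beta>(1) vord_mem[OF ord_weight that(1)]] \<beta>(3) that(2) by auto
  have "\<beta> = vzero \<or> (\<exists>\<gamma>. vord \<gamma> \<and> \<beta> = vsucc \<gamma>)"
    using \<beta>(1)
  proof (cases rule: vord_cases)
    case 3
    have "\<rho> \<beta> x = \<rho> \<beta> y"
    proof (rule eq[of \<beta>])
      show "\<beta> \<noteq> vzero" using 3 by (simp add: vlimit_def)
      show "limitin X (\<lambda>\<beta>. \<rho> \<beta> x) (\<rho> \<beta> x) (net_filter (elts \<beta>) vle)"
        "limitin X (\<lambda>\<beta>. \<rho> \<beta> y) (\<rho> \<beta> y) (net_filter (elts \<beta>) vle)"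
        using R3_limit[OF less_upto[OF \<beta>\<kappa>] 3] x y by auto
      show "\<beta> \<in> stages" using \<beta>\<kappa> by simp
      show "\<rho> \<gamma> x = \<rho> \<gamma> y" if "\<gamma> \<in> elts \<beta>" for \<gamma> using \<beta>(3)[OF that] by simp
    qed
    then show ?thesis using \<beta>(2) by simp
  qed auto
  then show ?thesis using \<beta>\<kappa> \<beta>(2) min by blast
qed

lemma R8:
  assumes "\<alpha> \<in> stages"
  shows "up_directed (T \<alpha>) le" "x \<in> elts K \<Longrightarrow> limitin X (\<lambda>s. rs s x) (\<rho> \<alpha> x) (net_filter (T \<alpha>) le)"
  using subskeleton.Tdir[OF sub[OF assms]] subskeleton.rlim_limit[OF sub[OF assms]] by auto

lemma R9:
  assumes "\<alpha> \<in> stages" "t \<in> sigma_closure (elts \<Gamma>) le (T \<alpha>)" "x \<in> elts K"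
  shows "rs t (\<rho> \<alpha> x) = \<rho> \<alpha> (rs t x)"
  using subskeleton.TS_fix[OF sub[OF assms(1)] assms(2)] assms(3) by simp

lemma R10:
  assumes "A \<subseteq> mspace (cspace X)" "separates_points A (elts K)" "\<alpha> \<in> elts \<kappa>" "vset (vcfun X ` A) \<in> elts (M \<alpha>)"
  shows "separates_points {f \<in> A. vcfun X f \<in> elts (M \<alpha>)} (\<rho> \<alpha> ` elts K)"
    "f \<in> A \<Longrightarrow> vcfun X f \<in> elts (M \<alpha>) \<Longrightarrow> x \<in> elts K \<Longrightarrow> f (\<rho> \<alpha> x) = f x"
proof -
  interpret E: elementary K \<tau> \<Gamma> leq r "M \<alpha>" by (rule Ra(1)[OF less_upto[OF assms(3)]])
  have im: "\<rho> \<alpha> ` elts K = limrange (T \<alpha>)" using E.rlim_image by simp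
  show "separates_points {f \<in> A. vcfun X f \<in> elts (M \<alpha>)} (\<rho> \<alpha> ` elts K)"
    unfolding im by (rule E.separates_limrange[OF assms(1,2,4)])
  show "f (\<rho> \<alpha> x) = f x" if "f \<in> A" "vcfun X f \<in> elts (M \<alpha>)" "x \<in> elts K"
    using E.rlim_preserves[OF _ that(2,3)] assms(1) that(1) by auto
qed

text \<open>
  If every countable subset of \<open>\<xi>\<close> is bounded, then the index fixing \<open>\<rho> \<xi> x\<close> already comes from
  some \<open>M \<delta>\<close> with \<open>\<delta> < \<xi>\<close>, and from \<open>\<delta>\<close> on nothing changes below \<open>\<xi>\<close>.
\<close>

lemma eventually_constant:
  assumes \<xi>: "\<xi> \<in> stages" "vlimit \<xi>"
    and bd: "\<And>A. countable A \<Longrightarrow> A \<subseteq> elts \<xi> \<Longrightarrow> \<exists>\<delta>\<in>elts \<xi>. \<forall>a\<in>A. vle a \<delta>"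
    and x: "x \<in> elts K" "\<rho> \<xi> x \<in> D"
  shows "\<exists>\<delta>\<in>elts \<xi>. \<forall>\<alpha>\<in>elts \<xi>. vle \<delta> \<alpha> \<longrightarrow> \<rho> \<alpha> x = \<rho> \<xi> x"
proof -
  interpret S: subskeleton X "elts \<Gamma>" le rs "T \<xi>" by (rule sub[OF \<xi>(1)])
  have xX: "x \<in> topspace X" using x by simp
  let ?y = "\<rho> \<xi> x"
  have up: "\<alpha> \<in> stages" if "\<alpha> \<in> elts \<xi>" for \<alpha> using mem_upto[OF \<xi>(1) that] by simp
  obtain t where t: "t \<in> sigma_closure (elts \<Gamma>) le (T \<xi>)" "rs t ?y = ?y"
    using S.limrange_induced[OF S.rlim_in_limrange[OF xX] x(2)] by auto
  have "\<exists>\<delta>\<in>elts \<xi>. t \<in> sigma_closure (elts \<Gamma>) le (T \<delta>)"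
    using t(1) S.TG
  proof (induction rule: sigma_closure_induct)
    case (base s)
    then obtain \<delta> where "\<delta> \<in> elts \<xi>" "s \<in> T \<delta>" using Rd[OF \<xi>] by auto
    then show ?case using sigma_closure_superset[of "T \<delta>"] by blast
  next
    case (sup s t)
    then obtain d where d: "\<And>n. d n \<in> elts \<xi>" "\<And>n. s n \<in> sigma_closure (elts \<Gamma>) le (T (d n))" by metis
    \<comment> \<open>Here boundedness of countable sets enters: the countably many stages of the
      terms \<open>s n\<close> have a common bound below \<open>\<xi>\<close>, whose sigma-closure
      then contains the supremum.\<close>
    obtain \<delta> where \<delta>: "\<delta> \<in> elts \<xi>" "\<forall>a\<in>range d. vle a \<delta>" using bd[of "range d"] d(1) by auto
    have "s n \<in> sigma_closure (elts \<Gamma>) le (T \<delta>)" for n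
      using sigma_closure_mono[OF T_mono[OF up[OF \<delta>(1)] up[OF d(1)[of n]]]] d(2)[of n] \<delta>(2) by blast
    then have "increasing_seq (sigma_closure (elts \<Gamma>) le (T \<delta>)) le s"
      using sup(1) by (simp add: increasing_seq_def)
    then have "t \<in> sigma_closure (elts \<Gamma>) le (T \<delta>)" using sup(2) by (rule sigma_closure_sup)
    then show ?case using \<delta>(1) by blast
  qed
  then obtain \<delta> where \<delta>: "\<delta> \<in> elts \<xi>" "t \<in> sigma_closure (elts \<Gamma>) le (T \<delta>)" by auto
  have "\<rho> \<alpha> x = ?y" if \<alpha>: "\<alpha> \<in> elts \<xi>" "vle \<delta> \<alpha>" for \<alpha>
  proof -
    interpret A: subskeleton X "elts \<Gamma>" le rs "T \<alpha>" by (rule sub[OF up[OF \<alpha>(1)]])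
    have "t \<in> sigma_closure (elts \<Gamma>) le (T \<alpha>)"
      using sigma_closure_mono[OF T_mono[OF up[OF \<alpha>(1)] up[OF \<delta>(1)] \<alpha>(2)]] \<delta>(2) by blast
    then have "rs t ` topspace X \<subseteq> limrange (T \<alpha>)" by (rule A.TS_image)
    moreover have "?y \<in> rs t ` topspace X"
      by (rule image_eqI[where x = ?y]) (simp_all only: t(2) S.rlim_in[OF xX])
    ultimately have "\<rho> \<alpha> ?y = ?y" by (intro A.rlim_limrange) (rule subsetD)
    \<comment> \<open>The value \<open>\<rho> \<alpha> ?y\<close> is computed twice: it is
      \<open>?y\<close>, which lies in the range of stage \<open>\<alpha>\<close> thanks to
      \<open>t\<close>, and it is \<open>\<rho> \<alpha> x\<close> by (R1).\<close>
    moreover have "\<rho> \<alpha> ?y = \<rho> \<alpha> x"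
      using R1(1)[OF \<xi>(1) up[OF \<alpha>(1)] _ x(1)] vle_mem[OF upto_ord[OF \<xi>(1)] \<alpha>(1)] by simp
    ultimately show ?thesis by simp
  qed
  then show ?thesis using \<delta>(1) by blast
qed

text \<open>Invariance of \<open>D'\<close> puts every \<open>\<rho> \<xi> x\<close> into the
  induced set, so \<open>eventually_constant\<close> applies at the critical limits. A final segment
  below such a limit contributes at most one value and no jump at all.\<close>

lemma R11:
  assumes D': "D' \<subseteq> D" "\<forall>\<alpha>\<in>stages. \<rho> \<alpha> ` D' \<subseteq> D'" and x: "x \<in> D'"
  shows "countable {\<rho> \<alpha> x |\<alpha>. \<alpha> \<in> elts \<kappa>}" "countable {\<alpha> \<in> elts \<kappa>. \<rho> \<alpha> x \<noteq> \<rho> (vsucc \<alpha>) x}"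
proof -
  have xK: "x \<in> elts K" using x D'(1) D_subset by auto
  have c: "\<exists>\<delta>\<in>elts \<xi>. \<forall>\<alpha>\<in>elts \<xi>. vle \<delta> \<alpha> \<longrightarrow> \<rho> \<alpha> x = \<rho> \<xi> x"
    if "\<xi> \<in> stages" "vlimit \<xi>" "\<And>A. countable A \<Longrightarrow> A \<subseteq> elts \<xi> \<Longrightarrow> \<exists>\<delta>\<in>elts \<xi>. \<forall>a\<in>A. vle a \<delta>" for \<xi>
  proof (rule eventually_constant[OF that xK])
    show "\<rho> \<xi> x \<in> D" using D' x that(1) by blast
  qed
  have "countable ((\<lambda>\<alpha>. \<rho> \<alpha> x) ` {\<alpha> \<in> elts \<kappa>. True})"
  proof (rule countable_on_ordinal[OF ord_weight])
    fix \<xi> assume \<xi>: "\<xi> \<in> stages" "vlimit \<xi>" "\<And>A. countable A \<Longrightarrow> A \<subseteq> elts \<xi> \<Longrightarrow> \<exists>\<delta>\<in>elts \<xi>. \<forall>a\<in>A. vle a \<delta>"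
    then obtain \<delta> where "\<delta> \<in> elts \<xi>" "\<forall>\<alpha>\<in>elts \<xi>. vle \<delta> \<alpha> \<longrightarrow> \<rho> \<alpha> x = \<rho> \<xi> x" using c[OF \<xi>] by auto
    then show "\<exists>\<delta>\<in>elts \<xi>. \<exists>E. countable E \<and> (\<forall>\<alpha>\<in>elts \<xi>. vle \<delta> \<alpha> \<longrightarrow> True \<longrightarrow> \<rho> \<alpha> x \<in> E)"
      by (intro bexI[of _ \<delta>] exI[of _ "{\<rho> \<xi> x}"]) auto
  qed
  moreover have "{\<rho> \<alpha> x |\<alpha>. \<alpha> \<in> elts \<kappa>} = (\<lambda>\<alpha>. \<rho> \<alpha> x) ` {\<alpha> \<in> elts \<kappa>. True}" by auto
  ultimately show "countable {\<rho> \<alpha> x |\<alpha>. \<alpha> \<in> elts \<kappa>}" by simp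
  have "countable ((\<lambda>\<alpha>. \<alpha>) ` {\<alpha> \<in> elts \<kappa>. \<rho> \<alpha> x \<noteq> \<rho> (vsucc \<alpha>) x})"
  proof (rule countable_on_ordinal[OF ord_weight])
    fix \<xi> assume \<xi>: "\<xi> \<in> stages" "vlimit \<xi>" "\<And>A. countable A \<Longrightarrow> A \<subseteq> elts \<xi> \<Longrightarrow> \<exists>\<delta>\<in>elts \<xi>. \<forall>a\<in>A. vle a \<delta>"
    then obtain \<delta> where \<delta>: "\<delta> \<in> elts \<xi>" "\<forall>\<alpha>\<in>elts \<xi>. vle \<delta> \<alpha> \<longrightarrow> \<rho> \<alpha> x = \<rho> \<xi> x" using c[OF \<xi>] by auto
    have "\<rho> \<alpha> x = \<rho> (vsucc \<alpha>) x" if "\<alpha> \<in> elts \<xi>" "vle \<delta> \<alpha>" for \<alpha>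
    proof -
      have "vsucc \<alpha> \<in> elts \<xi>" using \<xi>(2) that(1) by (simp add: vlimit_def)
      moreover have "vle \<delta> (vsucc \<alpha>)" using that(2) by (auto simp: vle_def)
      ultimately show ?thesis using \<delta>(2) that by simp
    qed
    then show "\<exists>\<delta>\<in>elts \<xi>. \<exists>E. countable E \<and> (\<forall>\<alpha>\<in>elts \<xi>. vle \<delta> \<alpha> \<longrightarrow> \<rho> \<alpha> x \<noteq> \<rho> (vsucc \<alpha>) x \<longrightarrow> \<alpha> \<in> E)"
      using \<delta>(1) by (intro bexI[of _ \<delta>] exI[of _ "{}"]) auto
  qed
  then show "countable {\<alpha> \<in> elts \<kappa>. \<rho> \<alpha> x \<noteq> \<rho> (vsucc \<alpha>) x}" by simp
qed

end

section \<open>Choice of the parameters and formulas, and assembly of the properties\<close>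

theorem proposition17:
  shows "\<exists>(S :: 'v::set_universe) (\<Phi> :: fm list). countable (elts S) \<and>
   (\<forall>K \<tau> \<Gamma> leq r \<U> (M :: 'v \<Rightarrow> 'v).
     let X = vspace \<tau>;
         le = vrel leq;
         rs = (\<lambda>s. vapp (vapp r s));
         D = induced_set X (elts \<Gamma>) rs;
         \<kappa> = weight X;
         upto = elts (vsucc \<kappa>);
         S' = elts S \<union> {K, vset D, \<Gamma>, leq, r, \<tau>, \<U>}
     in
       vtopology K \<tau> \<longrightarrow> tychonoff_space X \<longrightarrow> compact_space X \<longrightarrow>
       elts leq \<subseteq> {vpair s t |s t. s \<in> elts \<Gamma> \<and> t \<in> elts \<Gamma>} \<longrightarrow>
       up_directed (elts \<Gamma>) le \<longrightarrow>
       vfunction r (elts \<Gamma>)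
         {g. vfunction g (elts K) (elts K) \<and> continuous_map X X (vapp g)} \<longrightarrow>
       retractional_skeleton X (elts \<Gamma>) le rs \<longrightarrow>
       vfunction \<U> (elts \<kappa>) (elts \<tau>) \<longrightarrow>
       base_of X {elts (vapp \<U> i) |i. i \<in> elts \<kappa>} \<longrightarrow>
       \<comment> \<open>(Ra)\<close>
       (\<forall>\<alpha>\<in>upto. suitable_model (M \<alpha>) \<Phi> S') \<longrightarrow>
       \<comment> \<open>(Rb)\<close>
       (\<forall>\<alpha>\<in>upto. vle (vcard (M \<alpha>)) (vmax vomega (vcard \<alpha>))) \<longrightarrow>
       \<comment> \<open>(Rc)\<close>
       (\<forall>\<alpha>\<in>elts \<kappa>. elts (M \<alpha>) \<union> {\<alpha>} \<subseteq> elts (M (vsucc \<alpha>))) \<longrightarrow>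
       \<comment> \<open>(Rd)\<close>
       (\<forall>\<alpha>\<in>upto. vlimit \<alpha> \<longrightarrow> elts (M \<alpha>) = (\<Union>\<beta>\<in>elts \<alpha>. elts (M \<beta>))) \<longrightarrow>
       (\<exists>\<rho> :: 'v \<Rightarrow> 'v \<Rightarrow> 'v.
         (\<forall>\<alpha>\<in>upto. canonical_retraction X D (M \<alpha>) (\<rho> \<alpha>)) \<and>
         \<comment> \<open>(R1)\<close>
         (\<forall>\<beta>\<in>upto. \<forall>\<alpha>\<in>elts \<beta>. \<forall>x\<in>elts K. \<rho> \<alpha> (\<rho> \<beta> x) = \<rho> \<alpha> x \<and> \<rho> \<beta> (\<rho> \<alpha> x) = \<rho> \<alpha> x) \<and>
         \<comment> \<open>(R2)\<close>
         (\<forall>x\<in>elts K. limitin X (\<lambda>\<alpha>. \<rho> \<alpha> x) x (net_filter (elts \<kappa>) vle)) \<and>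
         \<comment> \<open>(R3)\<close>
         (\<forall>\<alpha>\<in>upto. \<forall>\<eta>. \<forall>\<xi>\<in>upto.
            (\<forall>\<beta>\<in>elts \<alpha>. \<eta> \<beta> \<in> elts \<kappa>) \<and>
            (\<forall>\<beta>\<in>elts \<alpha>. \<forall>\<gamma>\<in>elts \<alpha>. vle \<beta> \<gamma> \<longrightarrow> vle (\<eta> \<beta>) (\<eta> \<gamma>)) \<and>
            vlimit \<xi> \<and> is_sup (Collect vord) vle (\<eta> ` elts \<alpha>) \<xi> \<longrightarrow>
            (\<forall>x\<in>elts K. limitin X (\<lambda>\<beta>. \<rho> (\<eta> \<beta>) x) (\<rho> \<xi> x) (net_filter (elts \<alpha>) vle))) \<and>
         \<comment> \<open>(R4)\<close>
         (\<forall>x\<in>elts K. \<rho> \<kappa> x = x) \<and>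
         \<comment> \<open>(R5)\<close>
         (\<forall>\<alpha>\<in>upto.
            let Y = subtopology X (\<rho> \<alpha> ` elts K);
                G = sigma_closure (elts \<Gamma>) le (elts \<Gamma> \<inter> elts (M \<alpha>))
            in vle (weight Y) (vmax vomega (vcard \<alpha>)) \<and>
               retractional_skeleton Y G le rs \<and>
               induced_set Y G rs = D \<inter> \<rho> \<alpha> ` elts K) \<and>
         \<comment> \<open>(R6)\<close>
         (\<forall>A. closedin (mtopology_of (cspace X)) A \<and>
              (\<forall>f\<in>A. \<forall>s\<in>elts \<Gamma>. restrict (f \<circ> rs s) (elts K) \<in> A) \<longrightarrow>
              {restrict (f \<circ> \<rho> \<alpha>) (elts K) |f \<alpha>. f \<in> A \<and> \<alpha> \<in> upto} \<subseteq> A) \<and>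
         \<comment> \<open>(R7)\<close>
         (\<forall>x\<in>elts K. \<forall>y\<in>elts K. x \<noteq> y \<longrightarrow>
            (\<exists>\<beta>\<in>elts \<kappa>. \<rho> \<beta> x \<noteq> \<rho> \<beta> y \<and>
               (\<forall>\<alpha>\<in>elts \<kappa>. \<rho> \<alpha> x \<noteq> \<rho> \<alpha> y \<longrightarrow> vle \<beta> \<alpha>) \<and>
               (\<beta> = vzero \<or> (\<exists>\<gamma>. vord \<gamma> \<and> \<beta> = vsucc \<gamma>)))) \<and>
         \<comment> \<open>(R8)\<close>
         (\<forall>\<alpha>\<in>upto. up_directed (elts \<Gamma> \<inter> elts (M \<alpha>)) le \<and>
            (\<forall>x\<in>elts K.
               limitin X (\<lambda>s. rs s x) (\<rho> \<alpha> x) (net_filter (elts \<Gamma> \<inter> elts (M \<alpha>)) le))) \<and>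
         \<comment> \<open>(R9)\<close>
         (\<forall>\<alpha>\<in>upto. \<forall>t\<in>sigma_closure (elts \<Gamma>) le (elts \<Gamma> \<inter> elts (M \<alpha>)).
            \<forall>x\<in>elts K. rs t (\<rho> \<alpha> x) = \<rho> \<alpha> (rs t x)) \<and>
         \<comment> \<open>(R10)\<close>
         (\<forall>A \<alpha>. A \<subseteq> mspace (cspace X) \<and> separates_points A (elts K) \<and> \<alpha> \<in> elts \<kappa> \<and>
            vset (vcfun X ` A) \<in> elts (M \<alpha>) \<longrightarrow>
            separates_points {f \<in> A. vcfun X f \<in> elts (M \<alpha>)} (\<rho> \<alpha> ` elts K) \<and>
            (\<forall>f\<in>A. vcfun X f \<in> elts (M \<alpha>) \<longrightarrow> (\<forall>x\<in>elts K. f (\<rho> \<alpha> x) = f x))) \<and>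
         \<comment> \<open>full or commutative skeletons\<close>
         (full_skeleton X (elts \<Gamma>) rs \<or> commutative_skeleton X (elts \<Gamma>) rs \<longrightarrow>
            (\<forall>\<alpha>\<in>upto. \<rho> \<alpha> ` D \<subseteq> D)) \<and>
         \<comment> \<open>(R11)\<close>
         (\<forall>D'. D' \<subseteq> D \<and> (\<forall>\<alpha>\<in>upto. \<rho> \<alpha> ` D' \<subseteq> D') \<longrightarrow>
            (\<forall>x\<in>D'. countable {\<rho> \<alpha> x |\<alpha>. \<alpha> \<in> elts \<kappa>} \<and>
                     countable {\<alpha> \<in> elts \<kappa>. \<rho> \<alpha> x \<noteq> \<rho> (vsucc \<alpha>) x}))))"
proof -
  \<comment> \<open>All natural numbers are included so that \<open>vomega\<close> is also a subset
    of each model, as enumerations require, and so that \<open>vnat 0\<close> supplies the default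
    value of \<open>env\<close>. The two sets of reals are the parameters of
    \<open>cfuns_prop\<close>.\<close>
  define S :: "'v set" where "S = {vomega, vset (range vreal), vopen_reals} \<union> range vnat"
  have S: "elts (vset S) = S" "countable S"
    unfolding S_def by (auto intro: elts_vset vsmall_countable)
  \<comment> \<open>The formulas depend only on the ten properties, with the space and the skeleton
    entering as parameters; hence \<open>\<Phi>\<close> can be fixed before them.\<close>
  obtain \<Phi> where \<Phi>: "\<And>M :: 'v. (\<forall>\<phi>\<in>set \<Phi>. absolute_for M \<phi>) \<Longrightarrow> vzero \<in> elts M \<Longrightarrow>
      (\<forall>P\<in>set model_props. skolem_closed M P)"
    using ex_skolem_formulas_list[OF definable_model_props] by metis
  show ?thesis
  proof (rule exI[of _ "vset S"], rule exI[of _ \<Phi>], unfold Let_def S(1), intro conjI allI impI, goal_cases)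
    case 1
    show ?case by (rule S(2))
  next
    case (2 K \<tau> \<Gamma> leq r \<U> M)
    interpret C: coded_skeleton K \<tau> \<Gamma> leq r
      by unfold_locales (fact 2)+
    have el: "elementary K \<tau> \<Gamma> leq r (M \<alpha>)" "\<U> \<in> elts (M \<alpha>)" if \<alpha>: "\<alpha> \<in> elts (vsucc (weight C.X))" for \<alpha>
    proof -
      have s: "suitable_model (M \<alpha>) \<Phi> (S \<union> {K, vset C.D, \<Gamma>, leq, r, \<tau>, \<U>})"
        using 2(10) \<alpha> by (rule bspec)
      then show "\<U> \<in> elts (M \<alpha>)" unfolding suitable_model_def by blast
      have m: "S \<subseteq> elts (M \<alpha>)" "{K, vset C.D, \<Gamma>, leq, r, \<tau>} \<subseteq> elts (M \<alpha>)"
        using s unfolding suitable_model_def by blast+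
      have nat: "range vnat \<subseteq> elts (M \<alpha>)" using m(1) unfolding S_def by blast
      then have "vnat 0 \<in> elts (M \<alpha>)" by blast
      then have "\<forall>P\<in>set model_props. skolem_closed (M \<alpha>) P"
        using \<Phi>[of "M \<alpha>"] s unfolding suitable_model_def by simp
      then show "elementary K \<tau> \<Gamma> leq r (M \<alpha>)"
        using m nat by unfold_locales (auto simp: S_def elts_vomega)
    qed
    interpret C: model_chain K \<tau> \<Gamma> leq r \<U> M
    proof (rule model_chain.intro, rule C.coded_skeleton_axioms, rule model_chain_axioms.intro)
      show "vle (vcard (M \<alpha>)) (vmax vomega (vcard \<alpha>))" if "\<alpha> \<in> elts (vsucc (weight C.X))" for \<alpha>
        using 2(11) that by (rule bspec)
      show "elts (M \<alpha>) \<union> {\<alpha>} \<subseteq> elts (M (vsucc \<alpha>))" if "\<alpha> \<in> elts (weight C.X)" for \<alpha>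
        using 2(12) that by (rule bspec)
      show "elts (M \<alpha>) = (\<Union>\<beta>\<in>elts \<alpha>. elts (M \<beta>))" if "\<alpha> \<in> elts (vsucc (weight C.X))" "vlimit \<alpha>" for \<alpha>
        using bspec[OF 2(13) that(1)] that(2) by (rule mp)
    qed (fact 2 el)+
    show ?case
    proof (rule exI[of _ C.\<rho>], intro conjI, goal_cases)
      case 1
      show ?case using elementary.canonical_rlim[OF C.Ra(1)] by (rule ballI)
    next
      case 2
      show ?case
      proof (intro ballI conjI)
        fix \<beta> \<alpha> x assume a: "\<beta> \<in> C.stages" "\<alpha> \<in> elts \<beta>" "x \<in> elts K"
        note R1 = C.R1[OF a(1) C.less_upto[OF C.mem_upto[OF a(1,2)]] vle_mem[OF C.upto_ord[OF a(1)] a(2)] a(3)]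
        show "C.\<rho> \<alpha> (C.\<rho> \<beta> x) = C.\<rho> \<alpha> x" "C.\<rho> \<beta> (C.\<rho> \<alpha> x) = C.\<rho> \<alpha> x" by (fact R1)+
      qed
    next
      case 3
      show ?case using C.R2 by (rule ballI)
    next
      case 4
      show ?case by (intro ballI allI impI, elim conjE, rule C.R3) auto
    next
      case 5
      show ?case using C.R4 by (rule ballI)
    next
      case 6
      show ?case using C.R5 by (rule ballI)
    next
      case 7
      show ?case using C.R6 by blast
    next
      case 8
      show ?case by (intro ballI impI C.R7)
    next
      case 9
      show ?case by (intro ballI conjI C.R8)
    next
      case 10
      show ?case by (intro ballI C.R9)
    next
      case 11
      show ?case by (intro allI impI conjI ballI, elim conjE, rule C.R10; assumption?) (elim conjE, rule C.R10, assumption+)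
    next
      case 12
      show ?case by (intro impI ballI image_subsetI, rule C.rlim_induced[OF C.sub])
    next
      case 13
      show ?case by (intro allI impI ballI conjI; elim conjE; rule C.R11; assumption)
    qed
  qed
qed

end
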